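(* Let $\mathcal{N}_1$ and $\mathcal{N}_2$ be metric spaces with $|\mathcal{N}_1|\ge 3$ such that $\mathcal{N}_2$ is a weak Prague space and $V_{ext}(\mathcal{N}_2)=\mathcal{N}_2$. Let $p\in(1,\infty)$. Then for the metric space $\mathcal{M}:=\mathcal{N}_1\oplus_p\mathcal{N}_2$ we have that $V_{ext}(\mathcal{M})=\mathcal{M}$ and the graph $(V_{ext}(\mathcal{M}),E_{ext}(\mathcal{M}))$ is $3$-connected. In particular, $\mathcal{M}$ is Lipschitz-free rigid. Moreover, if $\mathcal{N}_2$ is uniformly concave and does not contain isolated points, then $\mathcal{M}$ is a Prague space.
   Context: For metric spaces $\mathcal{N}_1,\mathcal{N}_2$ and $p\in[1,\infty)$, $\mathcal{N}_1\oplus_p\mathcal{N}_2$ is $\mathcal{N}_1\times\mathcal{N}_2$ with metric $d((x,y),(u,v))=(d_{\mathcal{N}_1}(x,u)^p+d_{\mathcal{N}_2}(y,v)^p)^{1/p}$. For a metric space $(\mathcal{M},d)$, let $\mathcal{F}_0(\mathcal{M})$ be the real vector space of finitely supported functions $x:\mathcal{M}\to\mathbb{R}$ with $\sum_{m}x(m)=0$, normed by $\|x\|=\sup\{|\sum_m x(m)f(m)| : f:\mathcal{M}\to\mathbb{R}\text{ is }1\text{-Lipschitz}\}$. The Lipschitz-free space $\mathcal{F}(\mathcal{M})$ is its completion. For $x\neq y$ put $m_{x,y}=(\chi_{\{x\}}-\chi_{\{y\}})/d(x,y)\in\mathcal{F}(\mathcal{M})$. $E_{ext}(\mathcal{M})$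 is the set of ordered pairs $(x,y)$ of distinct points such that $m_{x,y}$ is an extreme point of the closed unit ball of $\mathcal{F}(\mathcal{M})^{**}$; $V_{ext}(\mathcal{M})$ is the set of points incident with such pairs. $\mathcal{M}$ is a weak Prague space if $V_{ext}(\mathcal{M})$ is dense in $\mathcal{M}$ and the graph $(V_{ext}(\mathcal{M}),E_{ext}(\mathcal{M}))$ is connected; it is a Prague space if moreover for all $x,y\in V_{ext}(\mathcal{M})$ the distance $d(x,y)$ equals the infimum of $\sum_{i=1}^k d(x_{i-1},x_i)$ over all finite sequences $x=x_0,\dots,x_k=y$ with $(x_{i-1},x_i)\in E_{ext}(\mathcal{M})$. $\mathcal{M}$ is uniformly concave if for every $x\neq y\in\mathcal{M}$ and $\varepsilon>0$ there is $\delta>0$ such that $d(x,z)+d(z,y)-\delta>d(x,y)$ for all $z\in\mathcal{M}$ with $\min\{d(x,z),d(y,z)\}\ge\varepsilon$. A graph is $3$-connected if it remains connected after removing any at most two vertices. A map $g:\mathcal{M}\to\mathcal{M}$ is an $a$-dilation ($a>0$) if $d(x,y)=a\,d(g(x),g(y))$ for all $x,y$. $\mathcal{M}$ is Lipschitz-free rigid if for every surjective linear isometry $T$ of $\mathcal{F}(\mathcal{M})$ onto itself there exist $\varepsilon\in\{\pm1\}$, $a>0$ and a surjective $a$-dilation $g:\mathcal{M}\to\mathcal{M}$ such that $T(m_{x,y})=\varepsilon m_{g(x),g(y)}$ for all $x\neq y$ in $\mathcal{M}$.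
   Formalization: Lipschitz-free rigidity is stated only for complete M; without completeness it fails, e.g. N1 = Q, N2 = {0,1}, p = 2, where translation by √2 induces an isometry of F(M) sending a molecule of M to a molecule with endpoints outside M. *)

theory Defs
  imports "HOL-Analysis.Analysis" "HOL-Library.Function_Algebras"
begin

section \<open>Normed spaces carried by subsets\<close>

text \<open>
  The spaces below depend on a metric space given as a term, so they cannot be types. They are
  linear subspaces of function types, equipped with a norm. For this the pointwise real vector
  space structure on function types is needed.
\<close>

instantiation "fun" :: (type, real_vector) real_vector
begin

definition scaleR_fun_def: "scaleR r f = (\<lambda>x. r *\<^sub>R f x)"

instance
  by standard (auto simp: scaleR_fun_def plus_fun_def fun_eq_iff scaleR_add_right scaleR_add_left)

end

record 'v nspace =
  vecs :: "'v set"
  nrm :: "'v \<Rightarrow> real"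

definition linear_on :: "'v::real_vector set \<Rightarrow> ('v \<Rightarrow> 'w::real_vector) \<Rightarrow> bool" where
  "linear_on V T \<longleftrightarrow>
     (\<forall>x\<in>V. \<forall>y\<in>V. T (x + y) = T x + T y) \<and> (\<forall>r. \<forall>x\<in>V. T (r *\<^sub>R x) = r *\<^sub>R T x)"

definition unit_ball :: "'v nspace \<Rightarrow> 'v set" where
  "unit_ball X = {x \<in> vecs X. nrm X x \<le> 1}"

text \<open>Functionals are normalised to vanish outside the carrier, so that equality of functionals
  is equality of functions.\<close>

definition dual :: "'v::real_vector nspace \<Rightarrow> ('v \<Rightarrow> real) nspace" where
  "dual X = \<lparr>
     vecs = {\<phi>. linear_on (vecs X) \<phi> \<and> (\<exists>K. \<forall>x\<in>vecs X. \<bar>\<phi> x\<bar> \<le> K * nrm X x) \<and>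
                (\<forall>x. x \<notin> vecs X \<longrightarrow> \<phi> x = 0)},
     nrm = (\<lambda>\<phi>. SUP x\<in>unit_ball X. \<bar>\<phi> x\<bar>)\<rparr>"

definition bidual_embed :: "'v::real_vector nspace \<Rightarrow> 'v \<Rightarrow> ('v \<Rightarrow> real) \<Rightarrow> real" where
  "bidual_embed X x = (\<lambda>\<phi>. if \<phi> \<in> vecs (dual X) then \<phi> x else 0)"

text \<open>The completion of a normed space, realised as the norm closure of its canonical image in
  its (complete) bidual.\<close>

definition completion :: "'v::real_vector nspace \<Rightarrow> (('v \<Rightarrow> real) \<Rightarrow> real) nspace" where
  "completion X = \<lparr>
     vecs = {\<psi> \<in> vecs (dual (dual X)).
               \<forall>e>0. \<exists>x\<in>vecs X. nrm (dual (dual X)) (\<psi> - bidual_embed X x) < e},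
     nrm = nrm (dual (dual X))\<rparr>"

definition surj_linear_isometry :: "'v::real_vector nspace \<Rightarrow> ('v \<Rightarrow> 'v) \<Rightarrow> bool" where
  "surj_linear_isometry X T \<longleftrightarrow>
     linear_on (vecs X) T \<and> T ` vecs X = vecs X \<and> (\<forall>x\<in>vecs X. nrm X (T x) = nrm X x)"


section \<open>Lipschitz-free spaces\<close>

definition pairing :: "('a \<Rightarrow> real) \<Rightarrow> ('a \<Rightarrow> real) \<Rightarrow> real" where
  "pairing x f = (\<Sum>m | x m \<noteq> 0. x m * f m)"

definition one_Lipschitz :: "'a metric \<Rightarrow> ('a \<Rightarrow> real) set" where
  "one_Lipschitz M = {f. \<forall>u\<in>mspace M. \<forall>v\<in>mspace M. \<bar>f u - f v\<bar> \<le> mdist M u v}"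

definition free0 :: "'a metric \<Rightarrow> ('a \<Rightarrow> real) nspace" where
  "free0 M = \<lparr>
     vecs = {x. finite {m. x m \<noteq> 0} \<and> {m. x m \<noteq> 0} \<subseteq> mspace M \<and> (\<Sum>m | x m \<noteq> 0. x m) = 0},
     nrm = (\<lambda>x. SUP f\<in>one_Lipschitz M. \<bar>pairing x f\<bar>)\<rparr>"

type_synonym 'a free = "(('a \<Rightarrow> real) \<Rightarrow> real) \<Rightarrow> real"

definition free_space :: "'a metric \<Rightarrow> 'a free nspace" where
  "free_space M = completion (free0 M)"

definition molecule :: "'a metric \<Rightarrow> 'a \<Rightarrow> 'a \<Rightarrow> 'a free" where
  "molecule M x y =
     bidual_embed (free0 M) (\<lambda>m. (indicator {x} m - indicator {y} m) / mdist M x y)"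


text \<open>The canonical embedding of \<open>free0 M\<close> into its completion is isometric.\<close>

lemma pairing_superset:
  assumes "finite S" "{m. x m \<noteq> 0} \<subseteq> S"
  shows "pairing x f = (\<Sum>m\<in>S. x m * f m)"
  unfolding pairing_def using assms by (intro sum.mono_neutral_left) auto

lemma free0_pairing_linear:
  assumes "x \<in> vecs (free0 M)" "y \<in> vecs (free0 M)"
  shows "pairing (x + y) f = pairing x f + pairing y f"
proof -
  let ?S = "{m. x m \<noteq> 0} \<union> {m. y m \<noteq> 0}"
  have fin: "finite ?S" using assms by (auto simp: free0_def)
  show ?thesis
    using pairing_superset[OF fin, of x f] pairing_superset[OF fin, of y f]
      pairing_superset[OF fin, of "x + y" f]
    by (auto simp: subset_iff sum.distrib algebra_simps)
qed

lemma free0_pairing_scaleR: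
  assumes "x \<in> vecs (free0 M)"
  shows "pairing (r *\<^sub>R x) f = r * pairing x f"
proof -
  have fin: "finite {m. x m \<noteq> 0}" using assms by (auto simp: free0_def)
  show ?thesis
    using pairing_superset[OF fin, of x f] pairing_superset[OF fin, of "r *\<^sub>R x" f]
    by (auto simp: scaleR_fun_def sum_distrib_left algebra_simps)
qed

lemma free0_scaleR:
  assumes "x \<in> vecs (free0 M)"
  shows "r *\<^sub>R x \<in> vecs (free0 M)"
proof (cases "r = 0")
  case False
  then show ?thesis using assms
    by (simp add: free0_def scaleR_fun_def flip: sum_distrib_left)
qed (use assms in \<open>simp add: free0_def\<close>)

lemma free0_bdd:
  assumes "x \<in> vecs (free0 M)"
  shows "bdd_above ((\<lambda>f. \<bar>pairing x f\<bar>) ` one_Lipschitz M)"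
proof (cases "{m. x m \<noteq> 0} = {}")
  case True
  then show ?thesis by (auto simp: pairing_def)
next
  case False
  then obtain z where z: "x z \<noteq> 0" by auto
  have sub: "m \<in> mspace M" if "x m \<noteq> 0" for m
    using assms that by (auto simp: free0_def)
  have sum0: "(\<Sum>m | x m \<noteq> 0. x m) = 0" using assms by (simp add: free0_def)
  have "\<bar>pairing x f\<bar> \<le> (\<Sum>m | x m \<noteq> 0. \<bar>x m\<bar> * mdist M m z)"
    if "f \<in> one_Lipschitz M" for f
  proof -
    have "pairing x f = (\<Sum>m | x m \<noteq> 0. x m * (f m - f z))"
      using sum0 by (simp add: pairing_def right_diff_distrib sum_subtractf
          flip: sum_distrib_right)
    also have "\<bar>\<dots>\<bar> \<le> (\<Sum>m | x m \<noteq> 0. \<bar>x m * (f m - f z)\<bar>)"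
      by (rule sum_abs)
    also have "\<dots> \<le> (\<Sum>m | x m \<noteq> 0. \<bar>x m\<bar> * mdist M m z)"
      using that sub z by (intro sum_mono) (auto simp: abs_mult one_Lipschitz_def
          intro!: mult_left_mono)
    finally show ?thesis .
  qed
  then show ?thesis by (rule bdd_aboveI2)
qed

lemma free0_nrm_upper:
  "x \<in> vecs (free0 M) \<Longrightarrow> f \<in> one_Lipschitz M \<Longrightarrow> \<bar>pairing x f\<bar> \<le> nrm (free0 M) x"
  using cSUP_upper[OF _ free0_bdd] by (simp add: free0_def)

lemma zero_one_Lipschitz: "(\<lambda>_. 0) \<in> one_Lipschitz M"
  by (simp add: one_Lipschitz_def)

lemma free0_nrm_nonneg:
  "x \<in> vecs (free0 M) \<Longrightarrow> 0 \<le> nrm (free0 M) x"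
  using free0_nrm_upper[OF _ zero_one_Lipschitz] by (force simp: pairing_def)

lemma free0_nrm_scaleR:
  assumes "x \<in> vecs (free0 M)"
  shows "nrm (free0 M) (r *\<^sub>R x) \<le> \<bar>r\<bar> * nrm (free0 M) x"
proof -
  have "nrm (free0 M) (r *\<^sub>R x) = (SUP f\<in>one_Lipschitz M. \<bar>pairing (r *\<^sub>R x) f\<bar>)"
    by (simp add: free0_def)
  also have "\<dots> \<le> \<bar>r\<bar> * nrm (free0 M) x"
    using zero_one_Lipschitz[of M] free0_nrm_upper[OF assms]
    by (intro cSUP_least) (auto simp: free0_pairing_scaleR[OF assms] abs_mult mult_left_mono)
  finally show ?thesis .
qed

lemma zero_free0: "(\<lambda>_. 0) \<in> unit_ball (free0 M)"
  using zero_one_Lipschitz[of M]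
  by (auto simp: unit_ball_def free0_def pairing_def intro!: cSUP_least)

lemma free0_dual_bound:
  assumes \<phi>: "\<phi> \<in> vecs (dual (free0 M))" and x: "x \<in> vecs (free0 M)"
  shows "\<bar>\<phi> x\<bar> \<le> nrm (dual (free0 M)) \<phi> * nrm (free0 M) x"
proof -
  obtain K where K: "\<And>y. y \<in> vecs (free0 M) \<Longrightarrow> \<bar>\<phi> y\<bar> \<le> K * nrm (free0 M) y"
    and lin: "linear_on (vecs (free0 M)) \<phi>"
    using \<phi> by (auto simp: dual_def)
  have bdd: "bdd_above ((\<lambda>y. \<bar>\<phi> y\<bar>) ` unit_ball (free0 M))"
  proof (rule bdd_aboveI2)
    fix y assume "y \<in> unit_ball (free0 M)"
    then have y: "y \<in> vecs (free0 M)" "nrm (free0 M) y \<le> 1" by (auto simp: unit_ball_def)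
    have "\<bar>\<phi> y\<bar> \<le> K * nrm (free0 M) y" using K y by simp
    also have "\<dots> \<le> \<bar>K\<bar> * 1"
      using y free0_nrm_nonneg[OF y(1)] by (intro mult_mono) auto
    finally show "\<bar>\<phi> y\<bar> \<le> \<bar>K\<bar>" by simp
  qed
  show ?thesis
  proof (cases "nrm (free0 M) x = 0")
    case True
    then show ?thesis using K[OF x] by simp
  next
    case False
    define r where "r = inverse (nrm (free0 M) x)"
    have pos: "nrm (free0 M) x > 0" using False free0_nrm_nonneg[OF x] by simp
    then have "r *\<^sub>R x \<in> unit_ball (free0 M)"
      using free0_scaleR[OF x] free0_nrm_scaleR[OF x, of r] by (auto simp: unit_ball_def r_def)
    then have "\<bar>\<phi> (r *\<^sub>R x)\<bar> \<le> nrm (dual (free0 M)) \<phi>"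
      using cSUP_upper[OF _ bdd] by (simp add: dual_def)
    moreover have "\<phi> (r *\<^sub>R x) = r * \<phi> x"
      using lin x by (simp add: linear_on_def)
    ultimately have "r * \<bar>\<phi> x\<bar> \<le> nrm (dual (free0 M)) \<phi>"
      using pos by (simp add: r_def abs_mult)
    then show ?thesis
      using pos by (simp add: r_def field_simps)
  qed
qed

theorem free0_embedding_isometric:
  assumes x: "x \<in> vecs (free0 M)"
  shows "nrm (free_space M) (bidual_embed (free0 M) x) = nrm (free0 M) x"
proof -
  let ?D = "dual (free0 M)"
  have "nrm (free_space M) (bidual_embed (free0 M) x) = (SUP \<phi>\<in>unit_ball ?D. \<bar>\<phi> x\<bar>)"
    unfolding free_space_def completion_def
    by (simp add: dual_def[of ?D]) (auto simp: bidual_embed_def unit_ball_def intro!: SUP_cong)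
  also have "\<dots> = nrm (free0 M) x"
  proof (rule antisym)
    have up: "\<bar>\<phi> x\<bar> \<le> nrm (free0 M) x" if "\<phi> \<in> unit_ball ?D" for \<phi>
    proof -
      have "\<bar>\<phi> x\<bar> \<le> nrm ?D \<phi> * nrm (free0 M) x"
        using that x by (intro free0_dual_bound) (auto simp: unit_ball_def)
      also have "\<dots> \<le> 1 * nrm (free0 M) x"
        using that free0_nrm_nonneg[OF x] by (intro mult_right_mono) (auto simp: unit_ball_def)
      finally show ?thesis by simp
    qed
    define \<Phi> where "\<Phi> = (\<lambda>f y. if y \<in> vecs (free0 M) then pairing y f else 0)"
    have add: "y + z \<in> vecs (free0 M)"
      if "y \<in> vecs (free0 M)" "z \<in> vecs (free0 M)" for y z
    proof -
      have fin: "finite {m. (y + z) m \<noteq> 0}"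
        by (rule finite_subset[of _ "{m. y m \<noteq> 0} \<union> {m. z m \<noteq> 0}"])
          (use that in \<open>auto simp: free0_def\<close>)
      have "pairing (y + z) (\<lambda>_. 1) = 0"
        unfolding free0_pairing_linear[OF that] using that by (simp add: free0_def pairing_def)
      with fin that show ?thesis
        by (auto simp: free0_def pairing_def) (metis (mono_tags, lifting) add_0 mem_Collect_eq subsetD)
    qed
    have \<Phi>: "\<Phi> f \<in> unit_ball ?D" if "f \<in> one_Lipschitz M" for f
    proof -
      have "\<Phi> f \<in> vecs ?D"
        using free0_nrm_upper[OF _ that]
        by (auto simp: dual_def linear_on_def \<Phi>_def add free0_scaleR free0_pairing_linear
            free0_pairing_scaleR intro!: exI[of _ 1])
      moreover have "nrm ?D (\<Phi> f) \<le> 1"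
        using zero_free0[of M] free0_nrm_upper[OF _ that]
        by (auto simp: dual_def unit_ball_def \<Phi>_def intro!: cSUP_least intro: order_trans)
      ultimately show ?thesis by (simp add: unit_ball_def)
    qed
    show "(SUP \<phi>\<in>unit_ball ?D. \<bar>\<phi> x\<bar>) \<le> nrm (free0 M) x"
      using \<Phi>[OF zero_one_Lipschitz] up by (intro cSUP_least) auto
    have "\<bar>pairing x f\<bar> \<le> (SUP \<phi>\<in>unit_ball ?D. \<bar>\<phi> x\<bar>)" if "f \<in> one_Lipschitz M" for f
      using cSUP_upper[OF \<Phi>[OF that], of "\<lambda>\<phi>. \<bar>\<phi> x\<bar>"] up x
      by (auto simp: \<Phi>_def bdd_above_def)
    then have "(SUP f\<in>one_Lipschitz M. \<bar>pairing x f\<bar>) \<le> (SUP \<phi>\<in>unit_ball ?D. \<bar>\<phi> x\<bar>)"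
      using zero_one_Lipschitz[of M] by (intro cSUP_least) auto
    then show "nrm (free0 M) x \<le> (SUP \<phi>\<in>unit_ball ?D. \<bar>\<phi> x\<bar>)"
      by (simp add: free0_def)
  qed
  finally show ?thesis .
qed


section \<open>Prague spaces\<close>

definition E_ext :: "'a metric \<Rightarrow> ('a \<times> 'a) set" where
  "E_ext M = {(x, y). x \<in> mspace M \<and> y \<in> mspace M \<and> x \<noteq> y \<and>
     bidual_embed (free_space M) (molecule M x y)
       extreme_point_of unit_ball (dual (dual (free_space M)))}"

definition V_ext :: "'a metric \<Rightarrow> 'a set" where
  "V_ext M = Field (E_ext M)"

text \<open>Graphs are given by a vertex set and a symmetric set of ordered pairs; edges leaving the
  vertex set are ignored. The empty graph counts as connected.\<close>

definition connected_graph :: "'a set \<Rightarrow> ('a \<times> 'a) set \<Rightarrow> bool" where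
  "connected_graph V E \<longleftrightarrow> (\<forall>u\<in>V. \<forall>v\<in>V. (u, v) \<in> (E \<inter> V \<times> V)\<^sup>*)"

definition three_connected_graph :: "'a set \<Rightarrow> ('a \<times> 'a) set \<Rightarrow> bool" where
  "three_connected_graph V E \<longleftrightarrow>
     (\<forall>S. S \<subseteq> V \<and> finite S \<and> card S \<le> 2 \<longrightarrow> connected_graph (V - S) E)"

definition weak_Prague :: "'a metric \<Rightarrow> bool" where
  "weak_Prague M \<longleftrightarrow>
     mtopology_of M closure_of V_ext M = mspace M \<and> connected_graph (V_ext M) (E_ext M)"

definition walk_lengths :: "'a metric \<Rightarrow> 'a \<Rightarrow> 'a \<Rightarrow> real set" where
  "walk_lengths M x y = {(\<Sum>i<k. mdist M (w i) (w (Suc i))) | k w.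
     w 0 = x \<and> w k = y \<and> (\<forall>i<k. (w i, w (Suc i)) \<in> E_ext M)}"

definition Prague :: "'a metric \<Rightarrow> bool" where
  "Prague M \<longleftrightarrow> weak_Prague M \<and>
     (\<forall>x\<in>V_ext M. \<forall>y\<in>V_ext M. mdist M x y = Inf (walk_lengths M x y))"

definition uniformly_concave :: "'a metric \<Rightarrow> bool" where
  "uniformly_concave M \<longleftrightarrow>
     (\<forall>x\<in>mspace M. \<forall>y\<in>mspace M. x \<noteq> y \<longrightarrow> (\<forall>\<epsilon>>0. \<exists>\<delta>>0. \<forall>z\<in>mspace M.
        min (mdist M x z) (mdist M y z) \<ge> \<epsilon> \<longrightarrow>
          mdist M x z + mdist M z y - \<delta> > mdist M x y))"

definition no_isolated_points :: "'a metric \<Rightarrow> bool" where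
  "no_isolated_points M \<longleftrightarrow> (\<forall>x\<in>mspace M. \<not> openin (mtopology_of M) {x})"

definition surj_dilation :: "'a metric \<Rightarrow> real \<Rightarrow> ('a \<Rightarrow> 'a) \<Rightarrow> bool" where
  "surj_dilation M a g \<longleftrightarrow> g ` mspace M = mspace M \<and>
     (\<forall>x\<in>mspace M. \<forall>y\<in>mspace M. mdist M x y = a * mdist M (g x) (g y))"

text \<open>A metric space and its metric completion have the same Lipschitz-free space. If \<open>M\<close> is
  incomplete, an isometry may therefore send molecules of \<open>M\<close> to molecules of the completion that
  involve points outside \<open>M\<close>; rigidity is a reasonable notion for complete \<open>M\<close> only.\<close>

definition Lipschitz_free_rigid :: "'a metric \<Rightarrow> bool" where
  "Lipschitz_free_rigid M \<longleftrightarrow>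
     (\<forall>T. surj_linear_isometry (free_space M) T \<longrightarrow>
        (\<exists>\<epsilon>\<in>{1, -1}. \<exists>a>0. \<exists>g. surj_dilation M a g \<and>
           (\<forall>x\<in>mspace M. \<forall>y\<in>mspace M. x \<noteq> y \<longrightarrow>
              T (molecule M x y) = \<epsilon> *\<^sub>R molecule M (g x) (g y))))"


section \<open>Sums of metric spaces\<close>

definition lp_sum :: "real \<Rightarrow> 'a metric \<Rightarrow> 'b metric \<Rightarrow> ('a \<times> 'b) metric" where
  "lp_sum p N1 N2 = metric (mspace N1 \<times> mspace N2,
     \<lambda>(x, y) (u, v). (mdist N1 x u powr p + mdist N2 y v powr p) powr (1 / p))"

text \<open>The type \<open>'a metric\<close> is abstract: the next facts show that \<open>lp_sum\<close> has the intended
  carrier and distance.\<close>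

lemma powr_convex_comb:
  fixes p t x y :: real
  assumes "1 \<le> p" "0 < t" "t < 1" "0 \<le> x" "0 \<le> y"
  shows "(t * x + (1 - t) * y) powr p \<le> t * x powr p + (1 - t) * y powr p"
proof -
  have le: "s powr p \<le> s" if "0 < s" "s < 1" for s :: real
    using powr_mono'[of 1 p s] that assms(1) by simp
  consider "x = 0" | "y = 0" | "0 < x" "0 < y" using assms by linarith
  then show ?thesis
  proof cases
    case 1
    then show ?thesis
      using le[of "1 - t"] assms by (simp add: powr_mult mult_right_mono)
  next
    case 2
    then show ?thesis
      using le[of t] assms by (simp add: powr_mult mult_right_mono)
  next
    case 3
    then show ?thesis
      using convex_onD[OF powr_convex[OF assms(1)], of "1 - t" x y] assms by simp
  qed
qed

lemma Minkowski_two: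
  fixes p a b c e :: real
  assumes p: "1 \<le> p" and "0 \<le> a" "0 \<le> b" "0 \<le> c" "0 \<le> e"
  shows "((a + b) powr p + (c + e) powr p) powr (1 / p)
          \<le> (a powr p + c powr p) powr (1 / p) + (b powr p + e powr p) powr (1 / p)"
proof -
  define A where "A = (a powr p + c powr p) powr (1 / p)"
  define B where "B = (b powr p + e powr p) powr (1 / p)"
  have Ap: "A powr p = a powr p + c powr p" and Bp: "B powr p = b powr p + e powr p"
    using p by (auto simp: A_def B_def powr_powr)
  have "A \<ge> 0" "B \<ge> 0" by (auto simp: A_def B_def)
  then consider "A = 0" | "B = 0" | "0 < A" "0 < B" by linarith
  then have "((a + b) powr p + (c + e) powr p) powr (1 / p) \<le> A + B"
  proof cases
    case 1
    then have "a powr p + c powr p = 0" using Ap p by simp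
    then have "a = 0" "c = 0"
      by (smt (verit) powr_ge_zero powr_eq_0_iff)+
    then show ?thesis using 1 by (simp add: B_def)
  next
    case 2
    then have "b powr p + e powr p = 0" using Bp p by simp
    then have "b = 0" "e = 0"
      by (smt (verit) powr_ge_zero powr_eq_0_iff)+
    then show ?thesis using 2 by (simp add: A_def)
  next
    case 3
    define t where "t = A / (A + B)"
    have t: "0 < t" "t < 1" and t1: "1 - t = B / (A + B)"
      using 3 by (auto simp: t_def field_simps)
    have conv: "((x + y) / (A + B)) powr p
        \<le> t * (x powr p / A powr p) + (1 - t) * (y powr p / B powr p)"
      if "0 \<le> x" "0 \<le> y" for x y
    proof -
      have "(x + y) / (A + B) = t * (x / A) + (1 - t) * (y / B)"
        unfolding t1 using 3 by (simp add: t_def add_divide_distrib)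
      then show ?thesis
        using powr_convex_comb[OF p t, of "x / A" "y / B"] that 3 by (simp add: powr_divide)
    qed
    have "((a + b) powr p + (c + e) powr p) / (A + B) powr p
        = ((a + b) / (A + B)) powr p + ((c + e) / (A + B)) powr p"
      using 3 assms by (simp add: powr_divide add_divide_distrib[of "_ powr _" "_ powr _"])
    also have "\<dots> \<le> t * ((a powr p + c powr p) / A powr p)
        + (1 - t) * ((b powr p + e powr p) / B powr p)"
      using conv[of a b] conv[of c e] assms by (simp add: algebra_simps add_divide_distrib)
    also have "\<dots> = 1"
      using 3 by (simp flip: Ap Bp)
    finally have "(a + b) powr p + (c + e) powr p \<le> (A + B) powr p"
      using 3 by (simp add: divide_le_eq)
    then have "((a + b) powr p + (c + e) powr p) powr (1 / p) \<le> ((A + B) powr p) powr (1 / p)"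
      using p by (intro powr_mono2) auto
    then show ?thesis using 3 p by (simp add: powr_powr)
  qed
  then show ?thesis by (simp add: A_def B_def)
qed

lemma Metric_space_lp_sum:
  assumes "1 \<le> p"
  shows "Metric_space (mspace N1 \<times> mspace N2)
     (\<lambda>(x, y) (u, v). (mdist N1 x u powr p + mdist N2 y v powr p) powr (1 / p))"
proof (unfold_locales, goal_cases)
  case (1 x y)
  then show ?case by (auto split: prod.splits)
next
  case (2 x y)
  then show ?case by (auto simp: mdist_commute split: prod.splits)
next
  case (3 x y)
  have "r powr p + s powr p = 0 \<longleftrightarrow> r = 0 \<and> s = 0" for r s :: real
    by (smt (verit) powr_ge_zero powr_eq_0_iff)
  with 3 assms show ?case by (auto split: prod.splits)
next
  case (4 x y z)
  obtain x1 x2 y1 y2 z1 z2 where eqs: "x = (x1, x2)" "y = (y1, y2)" "z = (z1, z2)"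
    by (metis surj_pair)
  have m: "x1 \<in> mspace N1" "y1 \<in> mspace N1" "z1 \<in> mspace N1"
    "x2 \<in> mspace N2" "y2 \<in> mspace N2" "z2 \<in> mspace N2"
    using 4 eqs by auto
  have "(mdist N1 x1 z1 powr p + mdist N2 x2 z2 powr p) powr (1 / p)
     \<le> ((mdist N1 x1 y1 + mdist N1 y1 z1) powr p + (mdist N2 x2 y2 + mdist N2 y2 z2) powr p)
         powr (1 / p)"
    using assms m by (intro powr_mono2 add_mono) (auto intro: mdist_triangle)
  also have "\<dots> \<le> (mdist N1 x1 y1 powr p + mdist N2 x2 y2 powr p) powr (1 / p)
      + (mdist N1 y1 z1 powr p + mdist N2 y2 z2 powr p) powr (1 / p)"
    using assms by (intro Minkowski_two) auto
  finally show ?case by (simp add: eqs)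
qed

lemma mspace_lp_sum:
  "1 \<le> p \<Longrightarrow> mspace (lp_sum p N1 N2) = mspace N1 \<times> mspace N2"
  by (simp add: lp_sum_def Metric_space.mspace_metric Metric_space_lp_sum)

lemma mdist_lp_sum:
  "1 \<le> p \<Longrightarrow> mdist (lp_sum p N1 N2) (x, y) (u, v)
     = (mdist N1 x u powr p + mdist N2 y v powr p) powr (1 / p)"
  by (simp add: lp_sum_def Metric_space.mdist_metric Metric_space_lp_sum)

end

theory Submission
  imports Defs
begin

text \<open>
  Call distinct points \<open>x\<close>, \<open>y\<close> a sharp pair if the excess \<open>d(x,z) + d(z,y) - d(x,y)\<close> of a detour is
  bounded away from zero over all \<open>z\<close> that keep a given distance from both \<open>x\<close> and \<open>y\<close>. Everything
  rests on the fact that the sharp pairs are exactly the edges in \<open>E_ext\<close>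
  (\<open>E_ext_iff_sharp_pair\<close>). If detours of vanishing excess exist, then \<open>m\<^sub>x\<^sub>y\<close> is nearly a convex
  combination of \<open>m\<^sub>x\<^sub>z\<close> and \<open>m\<^sub>z\<^sub>y\<close>, and weak* cluster points of these molecules exhibit \<open>m\<^sub>x\<^sub>y\<close> inside
  a segment of the bidual ball. Conversely, for a sharp pair there is a function \<open>g\<close> with slope \<open>1\<close>
  from \<open>y\<close> to \<open>x\<close> whose slope between two points is at most \<open>1 - s\<close> unless one of them is close to \<open>x\<close>
  and the other close to \<open>y\<close> (\<open>sharp_pair_tent\<close>). This leaves room for adding \<open>\<plusminus> s * h\<close> for every
  1-Lipschitz \<open>h\<close> with \<open>h x = h y\<close>, and so a functional in the unit ball that nearly norms \<open>g\<close> is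
  close to \<open>m\<^sub>x\<^sub>y\<close> in norm (\<open>sharp_pair_denting\<close>): \<open>g\<close> cuts off a slice of small diameter. One of the
  ends of a segment through \<open>m\<^sub>x\<^sub>y\<close> lies in arbitrarily small slices and therefore equals \<open>m\<^sub>x\<^sub>y\<close>.

  The same slices control isometries. Let \<open>T\<close> be a surjective isometry of the free space. The
  functional \<open>g \<circ> T\<inverse>\<close> is given by a Lipschitz function, whose norm is its largest slope, that is, the
  supremum of its values at molecules. Hence the slice of \<open>g\<close> contains the preimage of a molecule,
  and \<open>T m\<^sub>x\<^sub>y\<close> is a norm limit of molecules. In a complete space such a limit is a molecule
  (\<open>molecules_closed\<close>). So \<open>T\<close> and its inverse send edge molecules to molecules; as the graph is
  connected, they preserve the space of finitely supported functions with zero sum.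

  What remains is a linear form of Whitney's theorem on 3-connected graphs
  (\<open>three_connected_linear_rigidity\<close>). The zero-sum functions that vanish at a vertex \<open>v\<close> form a
  hyperplane, spanned by the edges that avoid \<open>v\<close>. If the images of these edges formed two clusters
  without a common vertex, then some vertex \<open>u\<close> would lie on edges with images in different clusters;
  a path between the other ends of these edges that avoids \<open>u\<close> and \<open>v\<close> closes a cycle, and the
  linear relation of this cycle would split into two relations although \<open>u\<close> lies on just one edge of
  each part. So the images form a single cluster, and for dimension reasons it omits exactly one vertex
  \<open>g v\<close>. Intersecting these hyperplanes, \<open>T\<close> maps \<open>\<delta>\<^sub>x - \<delta>\<^sub>y\<close> to a multiple of
  \<open>\<delta>\<^sub>g\<^sub>(\<^sub>x\<^sub>) - \<delta>\<^sub>g\<^sub>(\<^sub>y\<^sub>)\<close>; the factor is constant on triangles and hence constant, and comparing norms shows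
  that \<open>g\<close> is a dilation.

  In the \<open>p\<close>-sum, every edge \<open>b\<close>, \<open>d\<close> of \<open>\<N>\<^sub>2\<close> yields all edges between the fibres over \<open>b\<close> and \<open>d\<close>
  (\<open>sharp_pair_lp_sum\<close>), because near equality in Minkowski's inequality forces the second coordinate
  close to \<open>b\<close> or \<open>d\<close> and the first coordinate close to the corresponding end as well. Fibres have at
  least three points, so that two removed vertices leave something of each fibre and the connectivity
  of the graph of \<open>\<N>\<^sub>2\<close> survives. If \<open>\<N>\<^sub>2\<close> is uniformly concave, all its pairs are edges; then only
  points of a common fibre can lack a direct edge, and they are joined through a neighbouring fibre at
  arbitrarily small cost.
\<close>

section \<open>Seminormed spaces, duals and completions\<close>

definition seminormed :: "'v::real_vector nspace \<Rightarrow> bool" where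
  "seminormed X \<longleftrightarrow> subspace (vecs X) \<and> (\<forall>x\<in>vecs X. 0 \<le> nrm X x) \<and>
     (\<forall>x\<in>vecs X. \<forall>y\<in>vecs X. nrm X (x + y) \<le> nrm X x + nrm X y) \<and>
     (\<forall>r. \<forall>x\<in>vecs X. nrm X (r *\<^sub>R x) = \<bar>r\<bar> * nrm X x)"

lemma seminormedD:
  assumes "seminormed X"
  shows "0 \<in> vecs X" "nrm X 0 = 0"
    "x \<in> vecs X \<Longrightarrow> 0 \<le> nrm X x"
    "x \<in> vecs X \<Longrightarrow> r *\<^sub>R x \<in> vecs X"
    "x \<in> vecs X \<Longrightarrow> nrm X (r *\<^sub>R x) = \<bar>r\<bar> * nrm X x"
    "x \<in> vecs X \<Longrightarrow> y \<in> vecs X \<Longrightarrow> x + y \<in> vecs X"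
    "x \<in> vecs X \<Longrightarrow> y \<in> vecs X \<Longrightarrow> x - y \<in> vecs X"
    "x \<in> vecs X \<Longrightarrow> y \<in> vecs X \<Longrightarrow> nrm X (x + y) \<le> nrm X x + nrm X y"
proof -
  show z: "0 \<in> vecs X" using assms by (auto simp: seminormed_def subspace_0)
  have "nrm X (0 *\<^sub>R 0) = \<bar>0\<bar> * nrm X 0" using assms z unfolding seminormed_def by blast
  then show "nrm X 0 = 0" by simp
qed (use assms in \<open>auto simp: seminormed_def subspace_add subspace_diff subspace_scale\<close>)

lemma seminormed_nrm_minus:
  assumes "seminormed X" "x \<in> vecs X" "y \<in> vecs X"
  shows "nrm X (x - y) = nrm X (y - x)"
  using seminormedD(5)[OF assms(1) seminormedD(7)[OF assms], of "-1"] by simp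

lemma linear_onD:
  assumes "linear_on V T"
  shows "x \<in> V \<Longrightarrow> y \<in> V \<Longrightarrow> T (x + y) = T x + T y" "x \<in> V \<Longrightarrow> T (r *\<^sub>R x) = r *\<^sub>R T x"
  using assms by (auto simp: linear_on_def)

lemma linear_on_diff:
  assumes "linear_on V T" "subspace V" "x \<in> V" "y \<in> V"
  shows "T (x - y) = T x - T y"
proof -
  have "T (x + (-1) *\<^sub>R y) = T x + (-1) *\<^sub>R T y"
    using assms by (simp only: linear_onD subspace_scale)
  then show ?thesis by simp
qed

lemma linear_on_0: "linear_on V T \<Longrightarrow> subspace V \<Longrightarrow> T 0 = 0"
  by (metis linear_onD(2) scaleR_zero_left subspace_0)

lemma linear_on_sum:
  assumes "linear_on V T" "subspace V" "finite I" "\<And>i. i \<in> I \<Longrightarrow> x i \<in> V"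
  shows "T (\<Sum>i\<in>I. r i *\<^sub>R x i) = (\<Sum>i\<in>I. r i *\<^sub>R T (x i))"
  using assms(3,4)
proof (induction I rule: finite_induct)
  case empty
  then show ?case using linear_on_0[OF assms(1,2)] by simp
next
  case (insert i I)
  have "(\<Sum>i\<in>I. r i *\<^sub>R x i) \<in> V"
    using assms(2) insert by (auto intro!: subspace_sum subspace_scale)
  then show ?case
    using assms(1,2) insert by (simp add: linear_onD subspace_scale)
qed

lemma dual_iff:
  "\<phi> \<in> vecs (dual X) \<longleftrightarrow> linear_on (vecs X) \<phi> \<and> (\<exists>K. \<forall>x\<in>vecs X. \<bar>\<phi> x\<bar> \<le> K * nrm X x) \<and>
     (\<forall>x. x \<notin> vecs X \<longrightarrow> \<phi> x = 0)"
  by (simp add: dual_def)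

lemma dual_linear: "\<phi> \<in> vecs (dual X) \<Longrightarrow> linear_on (vecs X) \<phi>"
  by (simp add: dual_def)

lemma dual_outside: "\<phi> \<in> vecs (dual X) \<Longrightarrow> x \<notin> vecs X \<Longrightarrow> \<phi> x = 0"
  by (simp add: dual_def)

lemma dual_nrm_le:
  assumes "seminormed X" "0 \<le> K" "\<And>x. x \<in> vecs X \<Longrightarrow> \<bar>\<phi> x\<bar> \<le> K * nrm X x"
  shows "nrm (dual X) \<phi> \<le> K"
proof -
  have "0 \<in> unit_ball X" using seminormedD(1,2)[OF assms(1)] by (simp add: unit_ball_def)
  moreover have "\<bar>\<phi> x\<bar> \<le> K" if "x \<in> unit_ball X" for x
  proof -
    have "\<bar>\<phi> x\<bar> \<le> K * nrm X x" using that assms(3) by (simp add: unit_ball_def)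
    also have "\<dots> \<le> K * 1" using that assms(2) by (intro mult_left_mono) (auto simp: unit_ball_def)
    finally show ?thesis by simp
  qed
  ultimately show ?thesis unfolding dual_def by (auto intro!: cSUP_least)
qed

lemma dual_bdd_above:
  assumes X: "seminormed X" and \<phi>: "\<phi> \<in> vecs (dual X)"
  shows "bdd_above ((\<lambda>y. \<bar>\<phi> y\<bar>) ` unit_ball X)"
proof -
  obtain K where K: "\<And>y. y \<in> vecs X \<Longrightarrow> \<bar>\<phi> y\<bar> \<le> K * nrm X y"
    using \<phi> by (auto simp: dual_iff)
  show ?thesis
  proof (rule bdd_aboveI2)
    fix y assume "y \<in> unit_ball X"
    then have y: "y \<in> vecs X" "nrm X y \<le> 1" by (auto simp: unit_ball_def)
    have "\<bar>\<phi> y\<bar> \<le> K * nrm X y" using K y by simp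
    also have "\<dots> \<le> \<bar>K\<bar> * 1"
      using y seminormedD(3)[OF X y(1)] by (intro mult_mono) auto
    finally show "\<bar>\<phi> y\<bar> \<le> \<bar>K\<bar>" by simp
  qed
qed

lemma dual_bound:
  assumes X: "seminormed X" and \<phi>: "\<phi> \<in> vecs (dual X)" and x: "x \<in> vecs X"
  shows "\<bar>\<phi> x\<bar> \<le> nrm (dual X) \<phi> * nrm X x"
proof -
  obtain K where K: "\<And>y. y \<in> vecs X \<Longrightarrow> \<bar>\<phi> y\<bar> \<le> K * nrm X y"
    using \<phi> by (auto simp: dual_iff)
  note bdd = dual_bdd_above[OF X \<phi>]
  show ?thesis
  proof (cases "nrm X x = 0")
    case True
    then show ?thesis using K[OF x] by simp
  next
    case False
    define r where "r = inverse (nrm X x)"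
    have pos: "nrm X x > 0" using False seminormedD(3)[OF X x] by simp
    then have "r *\<^sub>R x \<in> unit_ball X"
      using seminormedD(4,5)[OF X x] by (auto simp: unit_ball_def r_def)
    then have "\<bar>\<phi> (r *\<^sub>R x)\<bar> \<le> nrm (dual X) \<phi>"
      using cSUP_upper[OF _ bdd] by (simp add: dual_def)
    moreover have "\<phi> (r *\<^sub>R x) = r * \<phi> x"
      using linear_onD(2)[OF dual_linear[OF \<phi>] x] by simp
    ultimately have "r * \<bar>\<phi> x\<bar> \<le> nrm (dual X) \<phi>"
      using pos by (simp add: r_def abs_mult)
    then show ?thesis
      using pos by (simp add: r_def field_simps)
  qed
qed

lemma dual_nrm_nonneg:
  assumes "seminormed X" "\<phi> \<in> vecs (dual X)"
  shows "0 \<le> nrm (dual X) \<phi>"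
proof -
  note bdd = dual_bdd_above[OF assms]
  have "0 \<in> unit_ball X" using seminormedD(1,2)[OF assms(1)] by (simp add: unit_ball_def)
  then have "\<bar>\<phi> 0\<bar> \<le> nrm (dual X) \<phi>"
    using cSUP_upper[OF _ bdd] by (simp add: dual_def)
  then show ?thesis by linarith
qed

lemma subspace_dual:
  assumes X: "seminormed X"
  shows "subspace (vecs (dual X))"
proof (rule subspaceI)
  show "0 \<in> vecs (dual X)" by (auto simp: dual_iff linear_on_def intro!: exI[of _ 0])
next
  fix \<phi> \<psi> assume a: "\<phi> \<in> vecs (dual X)" "\<psi> \<in> vecs (dual X)"
  have "\<bar>(\<phi> + \<psi>) x\<bar> \<le> (nrm (dual X) \<phi> + nrm (dual X) \<psi>) * nrm X x" if "x \<in> vecs X" for x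
    using dual_bound[OF X a(1) that] dual_bound[OF X a(2) that] by (simp add: algebra_simps)
  then have "\<exists>K. \<forall>x\<in>vecs X. \<bar>(\<phi> + \<psi>) x\<bar> \<le> K * nrm X x" by blast
  then show "\<phi> + \<psi> \<in> vecs (dual X)"
    using a unfolding dual_iff by (auto simp: linear_on_def distrib_left)
next
  fix r \<phi> assume a: "\<phi> \<in> vecs (dual X)"
  have "\<bar>(r *\<^sub>R \<phi>) x\<bar> \<le> (\<bar>r\<bar> * nrm (dual X) \<phi>) * nrm X x" if "x \<in> vecs X" for x
    using mult_left_mono[OF dual_bound[OF X a that], of "\<bar>r\<bar>"]
    by (simp add: scaleR_fun_def abs_mult algebra_simps)
  then have "\<exists>K. \<forall>x\<in>vecs X. \<bar>(r *\<^sub>R \<phi>) x\<bar> \<le> K * nrm X x" by blast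
  then show "r *\<^sub>R \<phi> \<in> vecs (dual X)"
    using a unfolding dual_iff by (auto simp: linear_on_def distrib_left scaleR_fun_def)
qed

lemma seminormed_dual:
  assumes X: "seminormed X"
  shows "seminormed (dual X)"
proof -
  note S = subspace_dual[OF X]
  have add: "nrm (dual X) (\<phi> + \<psi>) \<le> nrm (dual X) \<phi> + nrm (dual X) \<psi>"
    if a: "\<phi> \<in> vecs (dual X)" "\<psi> \<in> vecs (dual X)" for \<phi> \<psi>
  proof (rule dual_nrm_le[OF X])
    show "0 \<le> nrm (dual X) \<phi> + nrm (dual X) \<psi>"
      using dual_nrm_nonneg[OF X] a by (simp add: add_nonneg_nonneg)
    show "\<bar>(\<phi> + \<psi>) x\<bar> \<le> (nrm (dual X) \<phi> + nrm (dual X) \<psi>) * nrm X x" if "x \<in> vecs X" for x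
      using dual_bound[OF X a(1) that] dual_bound[OF X a(2) that] by (simp add: algebra_simps)
  qed
  have le: "nrm (dual X) (r *\<^sub>R \<phi>) \<le> \<bar>r\<bar> * nrm (dual X) \<phi>" if a: "\<phi> \<in> vecs (dual X)" for r \<phi>
  proof (rule dual_nrm_le[OF X])
    show "0 \<le> \<bar>r\<bar> * nrm (dual X) \<phi>" using dual_nrm_nonneg[OF X a] by simp
    show "\<bar>(r *\<^sub>R \<phi>) x\<bar> \<le> \<bar>r\<bar> * nrm (dual X) \<phi> * nrm X x" if "x \<in> vecs X" for x
      using mult_left_mono[OF dual_bound[OF X a that], of "\<bar>r\<bar>"]
      by (simp add: scaleR_fun_def abs_mult algebra_simps)
  qed
  have eq: "nrm (dual X) (r *\<^sub>R \<phi>) = \<bar>r\<bar> * nrm (dual X) \<phi>" if a: "\<phi> \<in> vecs (dual X)" for r \<phi>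
  proof (cases "r = 0")
    case True
    then show ?thesis
      using le[OF a, of 0] dual_nrm_nonneg[OF X subspace_0[OF S]] by simp
  next
    case False
    have "nrm (dual X) (inverse r *\<^sub>R (r *\<^sub>R \<phi>)) \<le> \<bar>inverse r\<bar> * nrm (dual X) (r *\<^sub>R \<phi>)"
      by (rule le) (rule subspace_scale[OF S a])
    then have "\<bar>r\<bar> * nrm (dual X) \<phi> \<le> nrm (dual X) (r *\<^sub>R \<phi>)"
      using False by (simp add: field_simps)
    with le[OF a, of r] show ?thesis by simp
  qed
  show ?thesis
    unfolding seminormed_def using S add eq dual_nrm_nonneg[OF X] by blast
qed

lemma dual_nrm_zero:
  assumes "seminormed X" "\<phi> \<in> vecs (dual X)" "nrm (dual X) \<phi> \<le> 0"
  shows "\<phi> = 0"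
proof
  fix x
  show "\<phi> x = 0 x"
  proof (cases "x \<in> vecs X")
    case True
    have "\<bar>\<phi> x\<bar> \<le> nrm (dual X) \<phi> * nrm X x" using dual_bound[OF assms(1,2) True] .
    also have "\<dots> \<le> 0" using assms seminormedD(3)[OF assms(1) True]
      by (simp add: mult_nonpos_nonneg)
    finally show ?thesis by simp
  qed (use assms(2) in \<open>simp add: dual_outside\<close>)
qed

lemma bidual_embed_mem:
  assumes X: "seminormed X" and x: "x \<in> vecs X"
  shows "bidual_embed X x \<in> vecs (dual (dual X))"
    and "nrm (dual (dual X)) (bidual_embed X x) \<le> nrm X x"
proof -
  have S: "subspace (vecs (dual X))" by (rule subspace_dual[OF X])
  have b: "\<bar>bidual_embed X x \<phi>\<bar> \<le> nrm X x * nrm (dual X) \<phi>" if "\<phi> \<in> vecs (dual X)" for \<phi>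
    using dual_bound[OF X that x] that by (simp add: bidual_embed_def mult.commute)
  then show "bidual_embed X x \<in> vecs (dual (dual X))"
    unfolding dual_iff[of "bidual_embed X x"] using subspace_add[OF S] subspace_scale[OF S]
    by (auto simp: linear_on_def bidual_embed_def scaleR_fun_def intro!: exI[of _ "nrm X x"])
  show "nrm (dual (dual X)) (bidual_embed X x) \<le> nrm X x"
    using b seminormedD(3)[OF X x] by (intro dual_nrm_le seminormed_dual X) auto
qed

lemma bidual_embed_add:
  assumes "x \<in> vecs X" "y \<in> vecs X"
  shows "bidual_embed X (x + y) = bidual_embed X x + bidual_embed X y"
  using assms by (auto simp: bidual_embed_def fun_eq_iff dual_iff linear_on_def)

lemma bidual_embed_scaleR:
  assumes "x \<in> vecs X"
  shows "bidual_embed X (r *\<^sub>R x) = r *\<^sub>R bidual_embed X x"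
  using assms by (auto simp: bidual_embed_def fun_eq_iff dual_iff linear_on_def scaleR_fun_def)

lemma bidual_embed_linear: "linear_on (vecs X) (bidual_embed X)"
  by (simp add: linear_on_def bidual_embed_add bidual_embed_scaleR)

lemma bidual_embed_completion:
  assumes X: "seminormed X" and x: "x \<in> vecs X"
  shows "bidual_embed X x \<in> vecs (completion X)"
proof -
  have "nrm (dual (dual X)) 0 = 0"
    by (rule seminormedD(2)) (intro seminormed_dual X)
  then show ?thesis
    using bidual_embed_mem(1)[OF X x] x by (force simp: completion_def)
qed

lemma completion_bidual: "\<psi> \<in> vecs (completion X) \<Longrightarrow> \<psi> \<in> vecs (dual (dual X))"
  by (simp add: completion_def)

lemma completion_nrm: "nrm (completion X) = nrm (dual (dual X))"
  by (simp add: completion_def)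

lemma completion_dense:
  assumes "\<psi> \<in> vecs (completion X)" "e > 0"
  obtains x where "x \<in> vecs X" "nrm (completion X) (\<psi> - bidual_embed X x) < e"
  using assms by (auto simp: completion_def)

lemma seminormed_completion:
  assumes X: "seminormed X"
  shows "seminormed (completion X)"
proof -
  let ?D = "dual (dual X)"
  have D: "seminormed ?D" by (intro seminormed_dual X)
  have XS: "subspace (vecs X)" using X by (simp add: seminormed_def)
  have "subspace (vecs (completion X))"
  proof (rule subspaceI)
    have "bidual_embed X 0 = 0"
      using linear_on_0[OF bidual_embed_linear XS] .
    then show "0 \<in> vecs (completion X)"
      using bidual_embed_completion[OF X seminormedD(1)[OF X]] by simp
  next
    fix \<phi> \<psi> assume a: "\<phi> \<in> vecs (completion X)" "\<psi> \<in> vecs (completion X)"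
    have "\<exists>x\<in>vecs X. nrm ?D (\<phi> + \<psi> - bidual_embed X x) < e" if "e > 0" for e
    proof -
      obtain x where x: "x \<in> vecs X" "nrm ?D (\<phi> - bidual_embed X x) < e / 2"
        using completion_dense[OF a(1), of "e / 2"] \<open>e > 0\<close> by (auto simp: completion_nrm)
      obtain y where y: "y \<in> vecs X" "nrm ?D (\<psi> - bidual_embed X y) < e / 2"
        using completion_dense[OF a(2), of "e / 2"] \<open>e > 0\<close> by (auto simp: completion_nrm)
      have eq: "\<phi> + \<psi> - bidual_embed X (x + y)
          = (\<phi> - bidual_embed X x) + (\<psi> - bidual_embed X y)"
        by (simp add: bidual_embed_add x y)
      have "nrm ?D (\<phi> + \<psi> - bidual_embed X (x + y)) \<le> nrm ?D (\<phi> - bidual_embed X x) + nrm ?D (\<psi> - bidual_embed X y)"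
        unfolding eq by (intro seminormedD(8)[OF D] seminormedD(7)[OF D] completion_bidual a
            bidual_embed_mem X x y)
      also have "\<dots> < e" using x y by simp
      finally show ?thesis by (rule bexI) (rule seminormedD(6)[OF X x(1) y(1)])
    qed
    then show "\<phi> + \<psi> \<in> vecs (completion X)"
      using a seminormedD(6)[OF D] by (auto simp: completion_def)
  next
    fix r \<phi> assume a: "\<phi> \<in> vecs (completion X)"
    have "\<exists>x\<in>vecs X. nrm ?D (r *\<^sub>R \<phi> - bidual_embed X x) < e" if "e > 0" for e
    proof -
      obtain x where x: "x \<in> vecs X" "nrm ?D (\<phi> - bidual_embed X x) < e / (\<bar>r\<bar> + 1)"
        using completion_dense[OF a, of "e / (\<bar>r\<bar> + 1)"] \<open>e > 0\<close> by (auto simp: completion_nrm)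
      have mem: "\<phi> - bidual_embed X x \<in> vecs ?D"
        by (intro seminormedD(7)[OF D] completion_bidual a bidual_embed_mem X x)
      have "r *\<^sub>R \<phi> - bidual_embed X (r *\<^sub>R x) = r *\<^sub>R (\<phi> - bidual_embed X x)"
        by (simp add: bidual_embed_scaleR x scaleR_diff_right)
      then have "nrm ?D (r *\<^sub>R \<phi> - bidual_embed X (r *\<^sub>R x)) = \<bar>r\<bar> * nrm ?D (\<phi> - bidual_embed X x)"
        by (simp add: seminormedD(5)[OF D mem])
      also have "\<dots> \<le> (\<bar>r\<bar> + 1) * nrm ?D (\<phi> - bidual_embed X x)"
        using seminormedD(3)[OF D mem] by (simp add: algebra_simps)
      also have "\<dots> < e" using x by (simp add: field_simps)
      finally show ?thesis by (rule bexI) (rule seminormedD(4)[OF X x(1)])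
    qed
    then show "r *\<^sub>R \<phi> \<in> vecs (completion X)"
      using a seminormedD(4)[OF D] by (auto simp: completion_def)
  qed
  then show ?thesis
    unfolding seminormed_def completion_nrm
    using seminormedD(3,5,8)[OF D] completion_bidual by blast
qed

lemma scaleR_apply: "(r *\<^sub>R f) x = r *\<^sub>R f x"
  by (simp add: scaleR_fun_def)

section \<open>Finitely supported functions with zero sum\<close>

definition dipole :: "'a \<Rightarrow> 'a \<Rightarrow> 'a \<Rightarrow> real" where
  "dipole u v = (\<lambda>m. indicator {u} m - indicator {v} m)"

lemma dipole_pairing: "pairing (dipole u v) f = f u - f v"
proof -
  have "pairing (dipole u v) f = (\<Sum>m\<in>{u, v}. dipole u v m * f m)"
    by (rule pairing_superset) (auto simp: dipole_def indicator_def)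
  then show ?thesis by (cases "u = v") (auto simp: dipole_def)
qed

lemma dipole_add: "dipole u v + dipole v w = dipole u w"
  by (auto simp: dipole_def)

lemma dipole_minus: "- dipole u v = dipole v u"
  by (auto simp: dipole_def)

lemma dipole_diff: "dipole u w - dipole v w = dipole u v"
  by (auto simp: dipole_def)

lemma dipole_self: "dipole u u = 0"
  by (auto simp: dipole_def)

definition zero_sum :: "'a set \<Rightarrow> ('a \<Rightarrow> real) set" where
  "zero_sum A = {x. finite {m. x m \<noteq> 0} \<and> {m. x m \<noteq> 0} \<subseteq> A \<and> (\<Sum>m | x m \<noteq> 0. x m) = 0}"

lemma dipole_zero_sum: "u \<in> A \<Longrightarrow> v \<in> A \<Longrightarrow> dipole u v \<in> zero_sum A"
proof -
  assume uv: "u \<in> A" "v \<in> A"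
  have sub: "{m. dipole u v m \<noteq> 0} \<subseteq> {u, v}" by (auto simp: dipole_def indicator_def)
  have "(\<Sum>m | dipole u v m \<noteq> 0. dipole u v m) = 0"
    using dipole_pairing[of u v "\<lambda>_. 1"] by (simp add: pairing_def)
  moreover have "finite {m. dipole u v m \<noteq> 0}" using sub finite_subset by auto
  ultimately show "dipole u v \<in> zero_sum A" using sub uv by (auto simp: zero_sum_def)
qed

lemma zero_sum_iff_superset:
  assumes "finite S" "{m. x m \<noteq> 0} \<subseteq> S"
  shows "x \<in> zero_sum A \<longleftrightarrow> {m. x m \<noteq> 0} \<subseteq> A \<and> (\<Sum>m\<in>S. x m) = 0"
proof -
  have "(\<Sum>m | x m \<noteq> 0. x m) = (\<Sum>m\<in>S. x m)"
    using assms by (intro sum.mono_neutral_left) auto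
  then show ?thesis using assms finite_subset by (auto simp: zero_sum_def)
qed

lemma subspace_zero_sum: "subspace (zero_sum A)"
proof (rule subspaceI)
  show "0 \<in> zero_sum A" by (simp add: zero_sum_def)
next
  fix x y assume a: "x \<in> zero_sum A" "y \<in> zero_sum A"
  let ?S = "{m. x m \<noteq> 0} \<union> {m. y m \<noteq> 0}"
  have S: "finite ?S" using a by (simp add: zero_sum_def)
  have "{m. (x + y) m \<noteq> 0} \<subseteq> ?S" by auto
  moreover have "?S \<subseteq> A" using a by (auto simp: zero_sum_def)
  moreover have "(\<Sum>m\<in>?S. x m) = 0" "(\<Sum>m\<in>?S. y m) = 0"
    using a zero_sum_iff_superset[OF S] by auto
  ultimately show "x + y \<in> zero_sum A"
    using zero_sum_iff_superset[OF S, of "x + y" A] by (auto simp: sum.distrib)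
next
  fix r x assume a: "x \<in> zero_sum A"
  let ?S = "{m. x m \<noteq> 0}"
  have S: "finite ?S" using a by (simp add: zero_sum_def)
  have "{m. (r *\<^sub>R x) m \<noteq> 0} \<subseteq> ?S" by (auto simp: scaleR_fun_def)
  then show "r *\<^sub>R x \<in> zero_sum A"
    using a zero_sum_iff_superset[OF S, of "r *\<^sub>R x" A]
    by (auto simp: zero_sum_def scaleR_fun_def simp flip: sum_distrib_left)
qed

lemma zero_sum_mono: "A \<subseteq> B \<Longrightarrow> zero_sum A \<subseteq> zero_sum B"
  by (auto simp: zero_sum_def)

lemma zero_sum_outside: "x \<in> zero_sum A \<Longrightarrow> m \<notin> A \<Longrightarrow> x m = 0"
  by (auto simp: zero_sum_def)

lemma zero_sum_restrict:
  assumes "x \<in> zero_sum A" "\<And>m. m \<in> A - B \<Longrightarrow> x m = 0"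
  shows "x \<in> zero_sum B"
  using assms by (auto simp: zero_sum_def)

lemma zero_sum_disjoint:
  assumes "x \<in> zero_sum A" "x \<in> zero_sum B" "A \<inter> B = {}"
  shows "x = 0"
proof
  fix m show "x m = 0 m" using assms zero_sum_outside[of x _ m] by (cases "m \<in> A") auto
qed

lemma zero_sum_pair:
  assumes "x \<in> zero_sum {u, v}"
  shows "x = x u *\<^sub>R dipole u v"
proof -
  have "(\<Sum>m\<in>{u, v}. x m) = 0"
    using assms zero_sum_iff_superset[of "{u, v}" x "{u, v}"] by (auto simp: zero_sum_def)
  then have "u = v \<and> x u = 0 \<or> u \<noteq> v \<and> x v = - x u" by (cases "u = v") auto
  then show ?thesis
    using zero_sum_outside[OF assms] by (auto simp: dipole_def scaleR_fun_def indicator_def fun_eq_iff)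
qed

lemma sum_fun_apply: "(\<Sum>m\<in>A. F m) z = (\<Sum>m\<in>A. F m z)" for F :: "'b \<Rightarrow> 'a \<Rightarrow> real"
  by (induction A rule: infinite_finite_induct) auto

lemma dipole_decomp:
  assumes "finite {m. x m \<noteq> 0}" "(\<Sum>m | x m \<noteq> 0. x m) = 0"
  shows "x = (\<Sum>m | x m \<noteq> 0. x m *\<^sub>R dipole m b)"
proof
  fix z
  have "(\<Sum>m | x m \<noteq> 0. x m *\<^sub>R dipole m b) z
      = (\<Sum>m | x m \<noteq> 0. x m * indicator {m} z) - (\<Sum>m | x m \<noteq> 0. x m) * indicator {b} z"
    by (simp add: sum_fun_apply scaleR_fun_def dipole_def algebra_simps sum_subtractf sum_distrib_left)
  also have "\<dots> = (\<Sum>m | x m \<noteq> 0. if m = z then x m else 0)"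
    using assms(2) by (auto intro!: sum.cong simp: indicator_def)
  also have "\<dots> = x z" using assms(1) by simp
  finally show "x z = (\<Sum>m | x m \<noteq> 0. x m *\<^sub>R dipole m b) z" by simp
qed

section \<open>Lipschitz functions as functionals on the free space\<close>

definition lip :: "'a metric \<Rightarrow> real \<Rightarrow> ('a \<Rightarrow> real) \<Rightarrow> bool" where
  "lip M K f \<longleftrightarrow> (\<forall>u\<in>mspace M. \<forall>v\<in>mspace M. \<bar>f u - f v\<bar> \<le> K * mdist M u v)"

lemma lipI: "(\<And>u v. u \<in> mspace M \<Longrightarrow> v \<in> mspace M \<Longrightarrow> \<bar>f u - f v\<bar> \<le> K * mdist M u v) \<Longrightarrow> lip M K f"
  by (simp add: lip_def)

lemma lipD: "lip M K f \<Longrightarrow> u \<in> mspace M \<Longrightarrow> v \<in> mspace M \<Longrightarrow> \<bar>f u - f v\<bar> \<le> K * mdist M u v"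
  by (simp add: lip_def)

lemma one_Lipschitz_lip: "f \<in> one_Lipschitz M \<longleftrightarrow> lip M 1 f"
  by (simp add: one_Lipschitz_def lip_def)

lemma lip_mono: "lip M K f \<Longrightarrow> K \<le> L \<Longrightarrow> lip M L f"
  unfolding lip_def by (meson mdist_nonneg mult_right_mono order_trans)

lemma lip_comb:
  assumes "lip M K f" "lip M L g"
  shows "lip M (K + \<bar>r\<bar> * L) (\<lambda>z. f z + r * g z)"
proof (rule lipI)
  fix u v assume uv: "u \<in> mspace M" "v \<in> mspace M"
  have "(f u + r * g u) - (f v + r * g v) = (f u - f v) + r * (g u - g v)"
    by (simp add: algebra_simps)
  also have "\<bar>\<dots>\<bar> \<le> \<bar>f u - f v\<bar> + \<bar>r\<bar> * \<bar>g u - g v\<bar>"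
    using abs_triangle_ineq[of "f u - f v" "r * (g u - g v)"] by (simp add: abs_mult)
  also have "\<dots> \<le> K * mdist M u v + \<bar>r\<bar> * (L * mdist M u v)"
    using assms uv by (intro add_mono mult_left_mono) (auto dest: lipD)
  finally show "\<bar>(f u + r * g u) - (f v + r * g v)\<bar> \<le> (K + \<bar>r\<bar> * L) * mdist M u v"
    by (simp add: algebra_simps)
qed

lemma lip_scale: "lip M K f \<Longrightarrow> lip M (\<bar>r\<bar> * K) (\<lambda>z. r * f z)"
  using lip_comb[of M 0 "\<lambda>_. 0" K f r] by (simp add: lip_def)

lemma lip_dist: "y \<in> mspace M \<Longrightarrow> lip M 1 (\<lambda>z. mdist M z y)"
  by (rule lipI) (smt (verit) mdist_commute mdist_triangle)

lemma lip_dist': "y \<in> mspace M \<Longrightarrow> lip M 1 (\<lambda>z. mdist M y z)"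
  using lip_dist[of y M] by (simp add: mdist_commute)

lemma mdist_pos: "x \<in> mspace M \<Longrightarrow> y \<in> mspace M \<Longrightarrow> x \<noteq> y \<Longrightarrow> 0 < mdist M x y"
  by (rule Metric_space.mdist_pos_less[OF Metric_space_mspace_mdist])

lemma free0_iff:
  "x \<in> vecs (free0 M) \<longleftrightarrow>
     finite {m. x m \<noteq> 0} \<and> {m. x m \<noteq> 0} \<subseteq> mspace M \<and> (\<Sum>m | x m \<noteq> 0. x m) = 0"
  by (simp add: free0_def)

lemma free0_pairing_one: "x \<in> vecs (free0 M) \<Longrightarrow> pairing x (\<lambda>_. c) = 0"
  by (simp add: free0_iff pairing_def flip: sum_distrib_right)

lemma vecs_free0: "vecs (free0 M) = zero_sum (mspace M)"
  by (auto simp: free0_iff zero_sum_def)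

lemma subspace_free0: "subspace (vecs (free0 M))"
  unfolding vecs_free0 by (rule subspace_zero_sum)

lemma dipole_free0: "u \<in> mspace M \<Longrightarrow> v \<in> mspace M \<Longrightarrow> dipole u v \<in> vecs (free0 M)"
  unfolding vecs_free0 by (rule dipole_zero_sum)

text \<open>For \<open>K = 0\<close> one cannot rescale to a 1-Lipschitz function; then \<open>f\<close> is constant and the pairing
  vanishes.\<close>

lemma lip_pairing_bound:
  assumes f: "lip M K f" and K: "0 \<le> K" and x: "x \<in> vecs (free0 M)"
  shows "\<bar>pairing x f\<bar> \<le> K * nrm (free0 M) x"
proof (cases "K = 0")
  case False
  then have "(\<lambda>z. inverse K * f z) \<in> one_Lipschitz M"
    using lip_scale[OF f, of "inverse K"] K by (simp add: one_Lipschitz_lip)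
  then have "\<bar>pairing x (\<lambda>z. inverse K * f z)\<bar> \<le> nrm (free0 M) x"
    by (rule free0_nrm_upper[OF x])
  moreover have "pairing x (\<lambda>z. inverse K * f z) = inverse K * pairing x f"
    by (simp add: pairing_def sum_distrib_left algebra_simps)
  ultimately have "\<bar>inverse K * pairing x f\<bar> \<le> nrm (free0 M) x" by (simp only:)
  then show ?thesis using False K by (simp add: abs_mult field_simps)
next
  case True
  have "pairing x f = 0"
  proof (cases "{m. x m \<noteq> 0} = {}")
    case True
    then show ?thesis by (simp add: pairing_def)
  next
    case False
    then obtain z where z: "x z \<noteq> 0" by auto
    have "pairing x f = pairing x (\<lambda>_. f z)"
      unfolding pairing_def
    proof (rule sum.cong[OF refl])
      fix m assume "m \<in> {m. x m \<noteq> 0}"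
      then have "m \<in> mspace M" "z \<in> mspace M" using x z by (auto simp: free0_iff)
      then show "x m * f m = x m * f z" using lipD[OF f, of m z] \<open>K = 0\<close> by simp
    qed
    then show ?thesis using free0_pairing_one[OF x] by simp
  qed
  then show ?thesis using True by simp
qed

lemma free0_nrm_le:
  assumes "\<And>f. f \<in> one_Lipschitz M \<Longrightarrow> \<bar>pairing x f\<bar> \<le> K"
  shows "nrm (free0 M) x \<le> K"
  unfolding free0_def using assms zero_one_Lipschitz[of M] by (auto intro!: cSUP_least)

lemma seminormed_free0: "seminormed (free0 M)"
proof -
  have add: "nrm (free0 M) (x + y) \<le> nrm (free0 M) x + nrm (free0 M) y"
    if "x \<in> vecs (free0 M)" "y \<in> vecs (free0 M)" for x y
  proof (rule free0_nrm_le)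
    fix f assume f: "f \<in> one_Lipschitz M"
    show "\<bar>pairing (x + y) f\<bar> \<le> nrm (free0 M) x + nrm (free0 M) y"
      using free0_nrm_upper[OF that(1) f] free0_nrm_upper[OF that(2) f]
      by (simp add: free0_pairing_linear[OF that])
  qed
  have scale: "nrm (free0 M) (r *\<^sub>R x) = \<bar>r\<bar> * nrm (free0 M) x" if x: "x \<in> vecs (free0 M)" for r x
  proof (cases "r = 0")
    case True
    then show ?thesis
      using free0_nrm_scaleR[OF x, of r] free0_nrm_nonneg[OF free0_scaleR[OF x, of r]] by simp
  next
    case False
    then show ?thesis
      using free0_nrm_scaleR[OF x, of r] free0_nrm_scaleR[OF free0_scaleR[OF x, of r], of "inverse r"]
      by (simp add: field_simps)
  qed
  show ?thesis
    unfolding seminormed_def using subspace_free0 add scale free0_nrm_nonneg by blast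
qed

lemma seminormed_free_space: "seminormed (free_space M)"
  by (simp add: free_space_def seminormed_completion seminormed_free0)

lemma dipole_nrm:
  assumes "u \<in> mspace M" "v \<in> mspace M"
  shows "nrm (free0 M) (dipole u v) \<le> mdist M u v"
  using assms by (intro free0_nrm_le) (auto simp: dipole_pairing one_Lipschitz_def)

text \<open>The functional is set to zero outside the carrier, as membership in \<open>dual\<close> requires.\<close>

definition lip_eval :: "'a metric \<Rightarrow> ('a \<Rightarrow> real) \<Rightarrow> ('a \<Rightarrow> real) \<Rightarrow> real" where
  "lip_eval M f = (\<lambda>y. if y \<in> vecs (free0 M) then pairing y f else 0)"

lemma lip_eval_dual:
  assumes "lip M K f" "0 \<le> K"
  shows "lip_eval M f \<in> vecs (dual (free0 M))" "nrm (dual (free0 M)) (lip_eval M f) \<le> K"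
proof -
  have b: "\<bar>lip_eval M f x\<bar> \<le> K * nrm (free0 M) x" if "x \<in> vecs (free0 M)" for x
    using lip_pairing_bound[OF assms that] that by (simp add: lip_eval_def)
  then have "\<exists>K. \<forall>x\<in>vecs (free0 M). \<bar>lip_eval M f x\<bar> \<le> K * nrm (free0 M) x" by blast
  then show "lip_eval M f \<in> vecs (dual (free0 M))"
    unfolding dual_iff
    by (auto simp: linear_on_def lip_eval_def free0_pairing_linear free0_pairing_scaleR
        subspace_add[OF subspace_free0] free0_scaleR)
  show "nrm (dual (free0 M)) (lip_eval M f) \<le> K"
    using b assms(2) by (intro dual_nrm_le seminormed_free0) auto
qed

lemma lip_eval_comb: "lip_eval M (\<lambda>z. f z + r * g z) = lip_eval M f + r *\<^sub>R lip_eval M g"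
  by (auto simp: lip_eval_def fun_eq_iff scaleR_fun_def pairing_def sum.distrib sum_distrib_left
      algebra_simps)

lemma lip_eval_scale: "lip_eval M (\<lambda>z. r * f z) = r *\<^sub>R lip_eval M f"
  by (auto simp: lip_eval_def fun_eq_iff scaleR_fun_def pairing_def sum_distrib_left algebra_simps)

text \<open>If the space is empty, so is the support of \<open>x\<close>, and the base point may be arbitrary.\<close>

lemma free0_functional_repr:
  assumes lin: "linear_on (vecs (free0 M)) \<phi>" and b: "b \<in> mspace M \<or> mspace M = {}"
    and x: "x \<in> vecs (free0 M)"
  shows "\<phi> x = pairing x (\<lambda>u. \<phi> (dipole u b))"
proof -
  have "\<phi> x = \<phi> (\<Sum>m | x m \<noteq> 0. x m *\<^sub>R dipole m b)"
    using x dipole_decomp[of x b] by (simp add: free0_iff)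
  also have "\<dots> = (\<Sum>m | x m \<noteq> 0. x m *\<^sub>R \<phi> (dipole m b))"
    using x b by (intro linear_on_sum[OF lin subspace_free0] dipole_free0) (auto simp: free0_iff)
  finally show ?thesis by (simp add: pairing_def)
qed

text \<open>The dual of the free space is the space of Lipschitz functions modulo constants: a functional is
  determined by its values on the differences of a point and a base point.\<close>

lemma dual_free0_repr:
  assumes \<phi>: "\<phi> \<in> vecs (dual (free0 M))"
  obtains h where "lip M (nrm (dual (free0 M)) \<phi>) h" "\<phi> = lip_eval M h"
proof -
  obtain b where b: "b \<in> mspace M \<or> mspace M = {}" by blast
  let ?h = "\<lambda>u. \<phi> (dipole u b)"
  have "\<phi> = lip_eval M ?h"
    using free0_functional_repr[OF dual_linear[OF \<phi>] b] dual_outside[OF \<phi>]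
    by (auto simp: lip_eval_def)
  moreover have "lip M (nrm (dual (free0 M)) \<phi>) ?h"
  proof (rule lipI)
    fix u v assume uv: "u \<in> mspace M" "v \<in> mspace M"
    then have "?h u - ?h v = \<phi> (dipole u b - dipole v b)"
      using b by (subst linear_on_diff[OF dual_linear[OF \<phi>] subspace_free0]) (auto intro: dipole_free0)
    then have "\<bar>?h u - ?h v\<bar> \<le> nrm (dual (free0 M)) \<phi> * nrm (free0 M) (dipole u v)"
      using dual_bound[OF seminormed_free0 \<phi> dipole_free0[OF uv]] by (simp add: dipole_diff)
    also have "\<dots> \<le> nrm (dual (free0 M)) \<phi> * mdist M u v"
      using dipole_nrm[OF uv] dual_nrm_nonneg[OF seminormed_free0 \<phi>] by (intro mult_left_mono)
    finally show "\<bar>?h u - ?h v\<bar> \<le> nrm (dual (free0 M)) \<phi> * mdist M u v" .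
  qed
  ultimately show ?thesis using that by blast
qed

lemma free_space_dual_dual:
  "\<psi> \<in> vecs (free_space M) \<Longrightarrow> \<psi> \<in> vecs (dual (dual (free0 M)))"
  "nrm (free_space M) = nrm (dual (dual (free0 M)))"
  by (simp_all add: free_space_def completion_bidual completion_nrm)

lemma free_space_bound:
  assumes "\<psi> \<in> vecs (free_space M)" "lip M K f" "0 \<le> K"
  shows "\<bar>\<psi> (lip_eval M f)\<bar> \<le> K * nrm (free_space M) \<psi>"
proof -
  have "\<bar>\<psi> (lip_eval M f)\<bar> \<le> nrm (free_space M) \<psi> * nrm (dual (free0 M)) (lip_eval M f)"
    using dual_bound[OF seminormed_dual[OF seminormed_free0] free_space_dual_dual(1)[OF assms(1)]
        lip_eval_dual(1)[OF assms(2,3)]] by (simp add: free_space_dual_dual(2))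
  also have "\<dots> \<le> nrm (free_space M) \<psi> * K"
    using lip_eval_dual(2)[OF assms(2,3)] seminormedD(3)[OF seminormed_free_space assms(1)]
    by (intro mult_left_mono)
  finally show ?thesis by (simp add: mult.commute)
qed

lemma free_space_nrm_le:
  assumes \<psi>: "\<psi> \<in> vecs (free_space M)" and K: "0 \<le> K"
    and le: "\<And>f. lip M 1 f \<Longrightarrow> \<bar>\<psi> (lip_eval M f)\<bar> \<le> K"
  shows "nrm (free_space M) \<psi> \<le> K"
  unfolding free_space_dual_dual(2)
proof (rule dual_nrm_le[OF seminormed_dual[OF seminormed_free0] K])
  fix \<phi> assume \<phi>: "\<phi> \<in> vecs (dual (free0 M))"
  let ?n = "nrm (dual (free0 M)) \<phi>"
  obtain h where h: "lip M ?n h" "\<phi> = lip_eval M h" using dual_free0_repr[OF \<phi>] .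
  have n0: "0 \<le> ?n" by (rule dual_nrm_nonneg[OF seminormed_free0 \<phi>])
  have lin: "linear_on (vecs (dual (free0 M))) \<psi>"
    by (rule dual_linear[OF free_space_dual_dual(1)[OF \<psi>]])
  show "\<bar>\<psi> \<phi>\<bar> \<le> K * ?n"
  proof (cases "?n = 0")
    case True
    then have "\<phi> = 0" using dual_nrm_zero[OF seminormed_free0 \<phi>] by simp
    then show ?thesis
      using linear_on_0[OF lin subspace_dual[OF seminormed_free0]] True by simp
  next
    case False
    have l: "lip M 1 (\<lambda>z. inverse ?n * h z)"
      using lip_scale[OF h(1), of "inverse ?n"] False n0 by simp
    have "lip_eval M (\<lambda>z. inverse ?n * h z) = inverse ?n *\<^sub>R \<phi>"
      unfolding lip_eval_scale using h(2) by (rule arg_cong[OF sym])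
    then have "\<psi> (lip_eval M (\<lambda>z. inverse ?n * h z)) = inverse ?n * \<psi> \<phi>"
      using linear_onD(2)[OF lin \<phi>] by simp
    then have "\<bar>inverse ?n * \<psi> \<phi>\<bar> \<le> K" using le[OF l] by (simp only:)
    then show ?thesis using False n0 by (simp add: abs_mult field_simps)
  qed
qed

lemma free_space_eqI:
  assumes "\<psi> \<in> vecs (free_space M)" "\<psi>' \<in> vecs (free_space M)"
    and "\<And>f. lip M 1 f \<Longrightarrow> \<psi> (lip_eval M f) = \<psi>' (lip_eval M f)"
  shows "\<psi> = \<psi>'"
proof -
  have mem: "\<psi> - \<psi>' \<in> vecs (free_space M)" using assms seminormedD(7)[OF seminormed_free_space] by blast
  have "nrm (free_space M) (\<psi> - \<psi>') \<le> 0"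
    using assms(3) by (intro free_space_nrm_le mem) auto
  then have "\<psi> - \<psi>' = 0"
    using dual_nrm_zero[OF seminormed_dual[OF seminormed_free0] free_space_dual_dual(1)[OF mem]]
    by (simp add: free_space_dual_dual(2))
  then show ?thesis by simp
qed

lemma embed_free_space:
  "w \<in> vecs (free0 M) \<Longrightarrow> bidual_embed (free0 M) w \<in> vecs (free_space M)"
  by (simp add: free_space_def bidual_embed_completion seminormed_free0)

lemma embed_lip_eval:
  "lip M K f \<Longrightarrow> 0 \<le> K \<Longrightarrow> w \<in> vecs (free0 M) \<Longrightarrow> bidual_embed (free0 M) w (lip_eval M f) = pairing w f"
  using lip_eval_dual(1) by (auto simp: bidual_embed_def) (simp add: lip_eval_def)

text \<open>A nonzero finitely supported function is detected by a bump at one of its support points that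
  is narrow enough to vanish at the others.\<close>

lemma embed_inj: "inj_on (bidual_embed (free0 M)) (vecs (free0 M))"
proof (rule inj_onI)
  fix x y assume xy: "x \<in> vecs (free0 M)" "y \<in> vecs (free0 M)"
    and eq: "bidual_embed (free0 M) x = bidual_embed (free0 M) y"
  show "x = y"
  proof (rule ccontr)
    assume "x \<noteq> y"
    then have ne: "{m. (x - y) m \<noteq> 0} \<noteq> {}" by (auto simp: fun_eq_iff)
    then obtain z where z: "(x - y) z \<noteq> 0" by auto
    have w: "x - y \<in> vecs (free0 M)" using seminormedD(7)[OF seminormed_free0 xy] .
    let ?S = "{m. (x - y) m \<noteq> 0}"
    have S: "finite ?S" "?S \<subseteq> mspace M" using w by (auto simp: free0_iff)
    define r where "r = Min ((\<lambda>m. mdist M m z) ` (?S - {z}) \<union> {1})"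
    have pos: "mdist M m z > 0" if "m \<in> ?S - {z}" for m
      using S that z mdist_pos[of m M z] by blast
    have r: "r > 0" "\<And>m. m \<in> ?S - {z} \<Longrightarrow> r \<le> mdist M m z"
      using S pos by (auto simp: r_def)
    define f where "f = (\<lambda>m. max (r - mdist M m z) 0)"
    have f: "lip M 1 f"
    proof (rule lipI)
      fix u v assume "u \<in> mspace M" "v \<in> mspace M"
      then show "\<bar>f u - f v\<bar> \<le> 1 * mdist M u v"
        using lipD[OF lip_dist, of z M u v] S z by (auto simp: f_def)
    qed
    have "z \<in> mspace M" using S z by blast
    then have zz: "mdist M z z = 0" by simp
    have "pairing (x - y) f = (\<Sum>m\<in>?S. if m = z then (x - y) z * r else 0)"
      unfolding pairing_def by (rule sum.cong) (use S z r zz in \<open>auto simp: f_def\<close>)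
    also have "\<dots> = (x - y) z * r" using z S by simp
    finally have "pairing (x - y) f \<noteq> 0" using z r by simp
    moreover have "pairing (x - y) f = 0"
    proof -
      have "bidual_embed (free0 M) (x - y) = 0"
        using linear_on_diff[OF bidual_embed_linear subspace_free0 xy] eq by simp
      then show ?thesis using embed_lip_eval[OF f _ w] by simp
    qed
    ultimately show False by simp
  qed
qed

lemma molecule_dipole:
  assumes "x \<in> mspace M" "y \<in> mspace M"
  shows "molecule M x y = (1 / mdist M x y) *\<^sub>R bidual_embed (free0 M) (dipole x y)"
proof -
  have "(\<lambda>m. (indicator {x} m - indicator {y} m) / mdist M x y) = (1 / mdist M x y) *\<^sub>R dipole x y"
    by (auto simp: dipole_def scaleR_fun_def)
  then show ?thesis
    using bidual_embed_scaleR[OF dipole_free0[OF assms]] by (simp add: molecule_def)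
qed

lemma molecule_free_space:
  "x \<in> mspace M \<Longrightarrow> y \<in> mspace M \<Longrightarrow> molecule M x y \<in> vecs (free_space M)"
  by (simp add: molecule_dipole seminormedD(4)[OF seminormed_free_space] embed_free_space dipole_free0)

lemma molecule_lip_eval:
  assumes "x \<in> mspace M" "y \<in> mspace M" "lip M K f" "0 \<le> K"
  shows "molecule M x y (lip_eval M f) = (f x - f y) / mdist M x y"
  using embed_lip_eval[OF assms(3,4) dipole_free0[OF assms(1,2)]] assms
  by (simp add: molecule_dipole scaleR_fun_def dipole_pairing)

lemma molecule_nrm:
  assumes "x \<in> mspace M" "y \<in> mspace M"
  shows "nrm (free_space M) (molecule M x y) \<le> 1"
proof (rule free_space_nrm_le[OF molecule_free_space[OF assms]])
  fix f assume "lip M 1 f"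
  then show "\<bar>molecule M x y (lip_eval M f)\<bar> \<le> 1"
    using assms lipD[of M 1 f x y] by (cases "mdist M x y = 0") (auto simp: molecule_lip_eval divide_le_eq)
qed simp

lemma molecule_nrm_eq:
  assumes "x \<in> mspace M" "y \<in> mspace M" "x \<noteq> y"
  shows "nrm (free_space M) (molecule M x y) = 1"
proof -
  have "molecule M x y (lip_eval M (\<lambda>z. mdist M z y)) = 1"
    using assms by (simp add: molecule_lip_eval[OF assms(1,2) lip_dist])
  then have "1 \<le> nrm (free_space M) (molecule M x y)"
    using free_space_bound[OF molecule_free_space[OF assms(1,2)] lip_dist[OF assms(2)]] by simp
  then show ?thesis using molecule_nrm[OF assms(1,2)] by simp
qed

text \<open>The same description for functionals on the completion, by density. Two bounded functionals that
  agree on the finitely supported elements agree.\<close>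

lemma free_space_functional_repr:
  assumes lin: "linear_on (vecs (free_space M)) \<xi>" and K: "0 \<le> K"
    and bd: "\<And>\<psi>. \<psi> \<in> vecs (free_space M) \<Longrightarrow> \<bar>\<xi> \<psi>\<bar> \<le> K * nrm (free_space M) \<psi>"
  obtains h where "lip M K h" "\<And>\<psi>. \<psi> \<in> vecs (free_space M) \<Longrightarrow> \<xi> \<psi> = \<psi> (lip_eval M h)"
proof -
  let ?e = "bidual_embed (free0 M)"
  note F = seminormed_free_space[of M]
  obtain b where b: "b \<in> mspace M \<or> mspace M = {}" by blast
  have lin': "linear_on (vecs (free0 M)) (\<lambda>w. \<xi> (?e w))"
    using lin by (simp add: linear_on_def bidual_embed_add bidual_embed_scaleR embed_free_space)
  define h where "h = (\<lambda>u. \<xi> (?e (dipole u b)))"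
  have rep: "\<xi> (?e w) = pairing w h" if "w \<in> vecs (free0 M)" for w
    using free0_functional_repr[OF lin' b that] by (simp add: h_def)
  have h: "lip M K h"
  proof (rule lipI)
    fix u v assume uv: "u \<in> mspace M" "v \<in> mspace M"
    note w = dipole_free0[OF uv]
    have "\<bar>h u - h v\<bar> = \<bar>\<xi> (?e (dipole u v))\<bar>" using rep[OF w] by (simp add: dipole_pairing)
    also have "\<dots> \<le> K * nrm (free_space M) (?e (dipole u v))" by (rule bd[OF embed_free_space[OF w]])
    also have "\<dots> \<le> K * mdist M u v"
      using K dipole_nrm[OF uv] by (simp add: free0_embedding_isometric[OF w] mult_left_mono)
    finally show "\<bar>h u - h v\<bar> \<le> K * mdist M u v" .
  qed
  have "\<xi> \<psi> = \<psi> (lip_eval M h)" if \<psi>: "\<psi> \<in> vecs (free_space M)" for \<psi>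
  proof (rule ccontr)
    assume ne: "\<xi> \<psi> \<noteq> \<psi> (lip_eval M h)"
    define e where "e = \<bar>\<xi> \<psi> - \<psi> (lip_eval M h)\<bar> / (2 * K + 1)"
    have "e > 0" using ne K by (simp add: e_def)
    then obtain w where w: "w \<in> vecs (free0 M)" "nrm (free_space M) (\<psi> - ?e w) < e"
      using completion_dense[of \<psi> "free0 M" e] \<psi> unfolding free_space_def by blast
    note ew = embed_free_space[OF w(1)]
    have mem: "\<psi> - ?e w \<in> vecs (free_space M)" by (rule seminormedD(7)[OF F \<psi> ew])
    have eq: "\<xi> \<psi> - \<psi> (lip_eval M h) = \<xi> (\<psi> - ?e w) - (\<psi> - ?e w) (lip_eval M h)"
      using linear_on_diff[OF lin _ \<psi> ew] F rep[OF w(1)] embed_lip_eval[OF h K w(1)]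
      by (simp add: seminormed_def)
    have "\<bar>\<xi> \<psi> - \<psi> (lip_eval M h)\<bar> \<le> K * nrm (free_space M) (\<psi> - ?e w) + K * nrm (free_space M) (\<psi> - ?e w)"
      unfolding eq using bd[OF mem] free_space_bound[OF mem h K] by linarith
    also have "\<dots> \<le> (2 * K) * e" using w(2) K mult_left_mono[of "nrm (free_space M) (\<psi> - ?e w)" e K] by simp
    also have "\<dots> < (2 * K + 1) * e" using \<open>e > 0\<close> by simp
    also have "\<dots> = \<bar>\<xi> \<psi> - \<psi> (lip_eval M h)\<bar>" using K by (simp add: e_def)
    finally show False by simp
  qed
  then show ?thesis using that h by blast
qed

section \<open>Sharp pairs are preserved extreme\<close>

text \<open>This is uniform concavity at a single pair.\<close>

definition sharp_pair :: "'a metric \<Rightarrow> 'a \<Rightarrow> 'a \<Rightarrow> bool" where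
  "sharp_pair M x y \<longleftrightarrow> x \<in> mspace M \<and> y \<in> mspace M \<and> x \<noteq> y \<and>
     (\<forall>\<epsilon>>0. \<exists>\<delta>>0. \<forall>z\<in>mspace M. min (mdist M x z) (mdist M y z) \<ge> \<epsilon> \<longrightarrow>
        mdist M x z + mdist M z y - \<delta> > mdist M x y)"

text \<open>The function \<open>g\<close> follows \<open>C\<close>, the distance from \<open>y\<close> scaled by \<open>1 - s\<close>, but off the ball around \<open>y\<close>
  it is at least \<open>A\<close>, the cone of slope \<open>1 - s\<close> below its value \<open>D\<close> at \<open>x\<close>. Both have
  slope at most \<open>1 - s\<close>, so a steeper slope of \<open>g\<close> occurs only where \<open>A\<close> beats \<open>C\<close> at one point and is
  cut off at the other. Sharpness confines the first point to the ball around \<open>x\<close>, and the second lies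
  in the ball around \<open>y\<close>. For such two points \<open>h\<close> varies little, since \<open>h x = h y\<close>.\<close>

lemma sharp_pair_tent:
  assumes sh: "sharp_pair M x y" and e: "0 < \<epsilon>" "\<epsilon> \<le> 1"
  obtains g s where "0 < s" "s \<le> 1 / 2" "g x - g y = mdist M x y" "lip M (1 + s * \<epsilon>) g"
    "\<And>h r. lip M 1 h \<Longrightarrow> h x = h y \<Longrightarrow> \<bar>r\<bar> \<le> s \<Longrightarrow> lip M (1 + s * \<epsilon>) (\<lambda>z. g z + r * h z)"
proof -
  define D where "D = mdist M x y"
  have xy: "x \<in> mspace M" "y \<in> mspace M" "x \<noteq> y" using sh by (auto simp: sharp_pair_def)
  have D: "D > 0" using mdist_pos[OF xy] by (simp add: D_def)
  \<comment> \<open>for \<open>u\<close>, \<open>v\<close> in the two balls, \<open>g\<close> and \<open>s * h\<close> together gain at most \<open>4 * s * r = s * \<epsilon> * D / 2\<close>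
    over \<open>d(u,v)\<close>, and \<open>D / 2\<close> is less than the distance of \<open>u\<close> and \<open>v\<close>\<close>
  define r where "r = \<epsilon> * D / 8"
  have r: "0 < r" "r \<le> D / 8" using e D by (auto simp: r_def)
  then obtain \<delta> where \<delta>: "\<delta> > 0" "\<And>z. z \<in> mspace M \<Longrightarrow> r \<le> mdist M x z \<Longrightarrow> r \<le> mdist M y z
      \<Longrightarrow> D < mdist M x z + mdist M z y - \<delta>"
    using sh unfolding sharp_pair_def D_def by (metis min.bounded_iff)
  \<comment> \<open>chosen so that \<open>(1 - s) * (D + \<delta>) \<ge> D\<close>: away from both balls the excess \<open>\<delta>\<close> makes up for the
    reduced slope\<close>
  define s where "s = min (1/2) (\<delta> / (D + \<delta>))"
  have s: "0 < s" "s \<le> 1/2"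
    using D \<delta> min.cobounded1[of "1/2" "\<delta> / (D + \<delta>)"] by (simp_all only: s_def) simp
  have sd: "s * (D + \<delta>) \<le> \<delta>"
  proof -
    have "s * (D + \<delta>) \<le> \<delta> / (D + \<delta>) * (D + \<delta>)"
      using D \<delta> by (intro mult_right_mono) (auto simp: s_def)
    then show ?thesis using D \<delta> by simp
  qed
  define C where "C = (\<lambda>z. (1 - s) * mdist M z y)"
  define A where "A = (\<lambda>z. D - (1 - s) * mdist M z x)"
  define g where "g = (\<lambda>z. if mdist M z y < r then C z else max (A z) (C z))"
  have Clip: "C u - C v \<le> (1 - s) * mdist M u v" if "u \<in> mspace M" "v \<in> mspace M" for u v
    using mult_left_mono[of "mdist M u y - mdist M v y" "mdist M u v" "1 - s"]
      mdist_triangle[of u M v y] that xy s by (simp add: C_def algebra_simps)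
  have Alip: "A u - A v \<le> (1 - s) * mdist M u v" if "u \<in> mspace M" "v \<in> mspace M" for u v
    using mult_left_mono[of "mdist M v x - mdist M u x" "mdist M u v" "1 - s"]
      mdist_triangle[of v M u x] that xy s by (simp add: A_def algebra_simps mdist_commute)
  have key: "g u - g v + s * \<bar>h u - h v\<bar> \<le> (1 + s * \<epsilon>) * mdist M u v"
    if uv: "u \<in> mspace M" "v \<in> mspace M" and h: "lip M 1 h" "h x = h y" for u v h
  proof (cases "g u - g v \<le> (1 - s) * mdist M u v")
    case True
    have "s * \<bar>h u - h v\<bar> \<le> s * mdist M u v"
      using lipD[OF h(1) uv] s by (intro mult_left_mono) auto
    moreover have "0 \<le> s * \<epsilon> * mdist M u v" using s e by simp
    ultimately show ?thesis using True by (simp add: algebra_simps)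
  next
    case False
    have vy: "mdist M v y < r"
    proof (rule ccontr)
      assume "\<not> mdist M v y < r"
      then have "g u - g v \<le> (1 - s) * mdist M u v"
        using Clip[OF uv] Alip[OF uv] by (auto simp: g_def max_def split: if_splits)
      with False show False by simp
    qed
    have gu: "mdist M u y \<ge> r" "g u = A u" "A u > C u"
      using False Clip[OF uv] vy by (auto simp: g_def max_def split: if_splits)
    have ux: "mdist M u x < r"
    proof (rule ccontr)
      assume "\<not> mdist M u x < r"
      then have "D < mdist M u x + mdist M u y - \<delta>"
        using \<delta>(2)[OF uv(1)] gu(1) by (simp add: mdist_commute)
      then have "(1 - s) * (D + \<delta>) \<le> (1 - s) * (mdist M u x + mdist M u y)"
        using s by (intro mult_left_mono) auto
      then have "A u \<le> C u" using sd by (simp add: A_def C_def algebra_simps)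
      with gu show False by simp
    qed
    define p where "p = mdist M u x"
    define q where "q = mdist M v y"
    have pq: "0 \<le> p" "0 \<le> q" "p < r" "q < r" using ux vy by (auto simp: p_def q_def)
    have t: "D \<le> p + mdist M u v + q"
      using mdist_triangle[of x M u y] mdist_triangle[of u M v y] uv xy
      by (simp add: D_def p_def q_def mdist_commute)
    have "\<bar>h u - h v\<bar> \<le> p + q"
      using lipD[OF h(1) uv(1) xy(1)] lipD[OF h(1) uv(2) xy(2)] h(2) by (simp add: p_def q_def)
    then have "s * \<bar>h u - h v\<bar> \<le> s * (p + q)" using s by (intro mult_left_mono) auto
    moreover have "g u - g v = D - (p + q) + s * (p + q)"
      using vy gu by (simp add: g_def A_def C_def p_def q_def algebra_simps)
    moreover have "s * (p + q) \<le> s * (2 * r)" using s pq by (intro mult_left_mono) auto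
    moreover have "s * (\<epsilon> * (D / 2)) \<le> s * (\<epsilon> * mdist M u v)"
      using s e r pq t by (intro mult_left_mono) auto
    ultimately show ?thesis using t by (simp add: r_def algebra_simps)
  qed
  have gl: "\<bar>g u - g v\<bar> + s * \<bar>h u - h v\<bar> \<le> (1 + s * \<epsilon>) * mdist M u v"
    if "u \<in> mspace M" "v \<in> mspace M" "lip M 1 h" "h x = h y" for u v h
    using key[OF that] key[OF that(2,1,3,4)]
    unfolding mdist_commute[of M v u] abs_minus_commute[of "h v" "h u"] by linarith
  have lipg: "lip M (1 + s * \<epsilon>) (\<lambda>z. g z + a * h z)"
    if h: "lip M 1 h" "h x = h y" and a: "\<bar>a\<bar> \<le> s" for h a
  proof (rule lipI)
    fix u v assume uv: "u \<in> mspace M" "v \<in> mspace M"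
    have "\<bar>(g u + a * h u) - (g v + a * h v)\<bar> = \<bar>(g u - g v) + a * (h u - h v)\<bar>"
      by (simp add: algebra_simps)
    also have "\<dots> \<le> \<bar>g u - g v\<bar> + \<bar>a\<bar> * \<bar>h u - h v\<bar>"
      using abs_triangle_ineq[of "g u - g v" "a * (h u - h v)"] by (simp add: abs_mult)
    also have "\<dots> \<le> \<bar>g u - g v\<bar> + s * \<bar>h u - h v\<bar>"
      using a by (intro add_left_mono mult_right_mono) auto
    also have "\<dots> \<le> (1 + s * \<epsilon>) * mdist M u v" by (rule gl[OF uv h])
    finally show "\<bar>(g u + a * h u) - (g v + a * h v)\<bar> \<le> (1 + s * \<epsilon>) * mdist M u v" .
  qed
  have "lip M (1 + s * \<epsilon>) g"
    using lipg[of "\<lambda>_. 0" 0] s by (simp add: lip_def)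
  moreover have "g x - g y = mdist M x y"
  proof -
    have "mdist M x x = 0" "mdist M y y = 0" using xy by simp_all
    moreover have "(1 - s) * D \<le> D" using s D by simp
    ultimately show ?thesis using D r by (simp add: g_def A_def C_def max_def flip: D_def)
  qed
  ultimately show ?thesis using that s lipg by blast
qed

text \<open>Elements of the unit balls of the free space and of its bidual both act on Lipschitz functions in
  this way, so that one slice estimate serves for extremality in the bidual and for isometries
  of the free space.\<close>

definition lip_functional :: "'a metric \<Rightarrow> (('a \<Rightarrow> real) \<Rightarrow> real) \<Rightarrow> bool" where
  "lip_functional M \<nu> \<longleftrightarrow>
     (\<forall>f g K L r. 0 \<le> K \<longrightarrow> 0 \<le> L \<longrightarrow> lip M K f \<longrightarrow> lip M L g \<longrightarrow>
        \<nu> (\<lambda>z. f z + r * g z) = \<nu> f + r * \<nu> g) \<and>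
     (\<forall>f K. 0 \<le> K \<longrightarrow> lip M K f \<longrightarrow> \<bar>\<nu> f\<bar> \<le> K)"

lemma lip_functionalD:
  assumes "lip_functional M \<nu>"
  shows "0 \<le> K \<Longrightarrow> 0 \<le> L \<Longrightarrow> lip M K f \<Longrightarrow> lip M L g \<Longrightarrow> \<nu> (\<lambda>z. f z + r * g z) = \<nu> f + r * \<nu> g"
    and "0 \<le> K \<Longrightarrow> lip M K f \<Longrightarrow> \<bar>\<nu> f\<bar> \<le> K"
    and "0 \<le> K \<Longrightarrow> lip M K f \<Longrightarrow> \<nu> (\<lambda>z. r * f z) = r * \<nu> f"
proof -
  show 1: "\<nu> (\<lambda>z. f z + r * g z) = \<nu> f + r * \<nu> g"
    if "0 \<le> K" "0 \<le> L" "lip M K f" "lip M L g" for K L f g r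
    using assms that unfolding lip_functional_def by blast
  show 2: "\<bar>\<nu> f\<bar> \<le> K" if "0 \<le> K" "lip M K f" for K f
    using assms that unfolding lip_functional_def by blast
  show "\<nu> (\<lambda>z. r * f z) = r * \<nu> f" if "0 \<le> K" "lip M K f"
    using 1[of 0 K "\<lambda>_. 0" f r] 2[of 0 "\<lambda>_. 0"] that by (simp add: lip_def)
qed

text \<open>Split \<open>f = c g + k\<close> with \<open>c\<close> the slope of \<open>f\<close> between \<open>x\<close> and \<open>y\<close>, so that \<open>k x = k y\<close>. Adding small
  multiples of \<open>k\<close> to \<open>g\<close> hardly changes its norm; if \<open>\<nu>\<close> nearly norms \<open>g\<close>, then \<open>\<nu> k\<close> must be small.\<close>

lemma sharp_pair_denting:
  assumes sh: "sharp_pair M x y" and \<eta>: "0 < \<eta>"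
  obtains g \<theta> where "0 < \<theta>" "\<theta> \<le> 1 / 2" "lip M 2 g" "g x - g y = mdist M x y"
    "\<And>\<nu> f. lip_functional M \<nu> \<Longrightarrow> 1 - \<theta> \<le> \<nu> g \<Longrightarrow> lip M 1 f \<Longrightarrow>
       \<bar>\<nu> f - (f x - f y) / mdist M x y\<bar> \<le> \<eta>"
proof -
  \<comment> \<open>the error is at most \<open>6 * \<epsilon>\<close> from \<open>\<nu> k\<close> and \<open>\<epsilon>\<close> from \<open>c * (\<nu> g - 1)\<close>\<close>
  define \<epsilon> where "\<epsilon> = min 1 (\<eta> / 7)"
  have e: "0 < \<epsilon>" "\<epsilon> \<le> 1" "7 * \<epsilon> \<le> \<eta>" using \<eta> by (auto simp: \<epsilon>_def)
  have xy: "x \<in> mspace M" "y \<in> mspace M" "x \<noteq> y" using sh by (auto simp: sharp_pair_def)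
  have D: "mdist M x y > 0" using mdist_pos[OF xy] .
  obtain s g where s: "0 < s" "s \<le> 1 / 2" and gD: "g x - g y = mdist M x y"
    and g: "lip M (1 + s * \<epsilon>) g"
    and gh: "\<And>h r. lip M 1 h \<Longrightarrow> h x = h y \<Longrightarrow> \<bar>r\<bar> \<le> s \<Longrightarrow> lip M (1 + s * \<epsilon>) (\<lambda>z. g z + r * h z)"
    by (rule sharp_pair_tent[OF sh e(1,2)]) blast
  have se: "0 < s * \<epsilon>" "s * \<epsilon> \<le> 1 / 2" "s * \<epsilon> \<le> \<epsilon>"
    using s e mult_mono[of s "1/2" \<epsilon> 1] mult_right_mono[of s 1 \<epsilon>] by simp_all
  have g2: "lip M 2 g" by (rule lip_mono[OF g]) (use se in linarith)
  \<comment> \<open>the slice is cut off by \<open>\<theta> = s * \<epsilon>\<close>\<close>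
  have "\<bar>\<nu> f - (f x - f y) / mdist M x y\<bar> \<le> \<eta>"
    if \<nu>: "lip_functional M \<nu>" "1 - s * \<epsilon> \<le> \<nu> g" and f: "lip M 1 f" for \<nu> f
  proof -
    define c where "c = (f x - f y) / mdist M x y"
    have c: "\<bar>c\<bar> \<le> 1" using lipD[OF f xy(1,2)] D by (simp add: c_def divide_le_eq)
    define k where "k = (\<lambda>z. f z + (- c) * g z)"
    have k: "lip M 3 k"
      unfolding k_def by (rule lip_mono[OF lip_comb[OF f g2]]) (use c in simp)
    have h: "lip M 1 (\<lambda>z. (1/3) * k z)" using lip_scale[OF k, of "1/3"] by simp
    have "k x - k y = (f x - f y) - c * (g x - g y)" by (simp add: k_def algebra_simps)
    also have "\<dots> = 0" using D gD by (simp add: c_def)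
    finally have hxy: "(1/3) * k x = (1/3) * k y" by simp
    define N where "N = \<nu> (\<lambda>z. (1/3) * k z)"
    have "\<bar>\<nu> g + r * N\<bar> \<le> 1 + s * \<epsilon>" if "\<bar>r\<bar> \<le> s" for r
    proof -
      have "\<nu> (\<lambda>z. g z + r * ((1/3) * k z)) = \<nu> g + r * \<nu> (\<lambda>z. (1/3) * k z)"
        by (rule lip_functionalD(1)[OF \<nu>(1) _ _ g2 h]) auto
      moreover have "\<bar>\<nu> (\<lambda>z. g z + r * ((1/3) * k z))\<bar> \<le> 1 + s * \<epsilon>"
        using se by (intro lip_functionalD(2)[OF \<nu>(1) _ gh[OF h hxy that]]) auto
      ultimately show ?thesis by (simp add: N_def)
    qed
    from this[of s] this[of "- s"] s
    have "\<bar>\<nu> g + s * N\<bar> \<le> 1 + s * \<epsilon>" "\<bar>\<nu> g - s * N\<bar> \<le> 1 + s * \<epsilon>" by simp_all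
    with \<nu>(2) have "s * N \<le> 2 * (s * \<epsilon>)" "- (s * N) \<le> 2 * (s * \<epsilon>)" by linarith+
    then have "s * N \<le> s * (2 * \<epsilon>)" "s * (- N) \<le> s * (2 * \<epsilon>)" by simp_all
    then have "\<bar>N\<bar> \<le> 2 * \<epsilon>"
      using s by (simp only: mult_le_cancel_left_pos abs_le_iff)
    moreover have "N = (1/3) * \<nu> k"
      unfolding N_def by (rule lip_functionalD(3)[OF \<nu>(1) _ k]) simp
    ultimately have "\<bar>\<nu> k\<bar> \<le> 6 * \<epsilon>" by simp
    moreover have "\<nu> k = \<nu> f + (- c) * \<nu> g"
      unfolding k_def by (rule lip_functionalD(1)[OF \<nu>(1) _ _ f g2]) auto
    moreover have "\<bar>c * (\<nu> g - 1)\<bar> \<le> \<epsilon>"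
    proof -
      have "\<bar>\<nu> g - 1\<bar> \<le> s * \<epsilon>"
        using lip_functionalD(2)[OF \<nu>(1) _ g] \<nu>(2) se by (auto simp: abs_le_iff)
      then have "\<bar>\<nu> g - 1\<bar> \<le> \<epsilon>" using se(3) by linarith
      then have "\<bar>c\<bar> * \<bar>\<nu> g - 1\<bar> \<le> 1 * \<epsilon>" using c by (intro mult_mono) auto
      then show ?thesis by (simp add: abs_mult)
    qed
    moreover have "\<nu> f - c = (\<nu> f + (- c) * \<nu> g) + c * (\<nu> g - 1)" by (simp add: algebra_simps)
    ultimately show ?thesis using e unfolding c_def[symmetric] by linarith
  qed
  then show ?thesis using that[of "s * \<epsilon>" g] se g2 gD by blast
qed

lemma lip_functional_free_space:
  assumes \<psi>: "\<psi> \<in> unit_ball (free_space M)"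
  shows "lip_functional M (\<lambda>f. \<psi> (lip_eval M f))"
proof -
  have m: "\<psi> \<in> vecs (free_space M)" "nrm (free_space M) \<psi> \<le> 1" using \<psi> by (auto simp: unit_ball_def)
  have lin: "linear_on (vecs (dual (free0 M))) \<psi>"
    by (rule dual_linear[OF free_space_dual_dual(1)[OF m(1)]])
  have "\<psi> (lip_eval M (\<lambda>z. f z + r * g z)) = \<psi> (lip_eval M f) + r * \<psi> (lip_eval M g)"
    if "0 \<le> K" "0 \<le> L" "lip M K f" "lip M L g" for f g K L r
    using linear_onD[OF lin] seminormedD(4)[OF seminormed_dual[OF seminormed_free0] lip_eval_dual(1)[OF that(4,2)]]
      lip_eval_dual(1)[OF that(3,1)] lip_eval_dual(1)[OF that(4,2)] by (simp add: lip_eval_comb)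
  moreover have "\<bar>\<psi> (lip_eval M f)\<bar> \<le> K" if "0 \<le> K" "lip M K f" for f K
    using free_space_bound[OF m(1) that(2,1)] mult_left_mono[OF m(2) that(1)] by simp
  ultimately show ?thesis unfolding lip_functional_def by blast
qed

definition free_eval :: "'a metric \<Rightarrow> ('a \<Rightarrow> real) \<Rightarrow> 'a free \<Rightarrow> real" where
  "free_eval M f = (\<lambda>\<psi>. if \<psi> \<in> vecs (free_space M) then \<psi> (lip_eval M f) else 0)"

lemma free_eval_dual:
  assumes "lip M K f" "0 \<le> K"
  shows "free_eval M f \<in> vecs (dual (free_space M))" "nrm (dual (free_space M)) (free_eval M f) \<le> K"
proof -
  have b: "\<bar>free_eval M f x\<bar> \<le> K * nrm (free_space M) x" if "x \<in> vecs (free_space M)" for x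
    using free_space_bound[OF that assms] that by (simp add: free_eval_def)
  then have "\<exists>K. \<forall>x\<in>vecs (free_space M). \<bar>free_eval M f x\<bar> \<le> K * nrm (free_space M) x" by blast
  then show "free_eval M f \<in> vecs (dual (free_space M))"
    unfolding dual_iff
    by (auto simp: linear_on_def free_eval_def scaleR_apply
        seminormedD(4,6)[OF seminormed_free_space])
  show "nrm (dual (free_space M)) (free_eval M f) \<le> K"
    using b assms(2) by (intro dual_nrm_le seminormed_free_space) auto
qed

lemma free_eval_comb:
  assumes "0 \<le> K" "0 \<le> L" "lip M K f" "lip M L g"
  shows "free_eval M (\<lambda>z. f z + r * g z) = free_eval M f + r *\<^sub>R free_eval M g"
proof
  fix \<psi>
  show "free_eval M (\<lambda>z. f z + r * g z) \<psi> = (free_eval M f + r *\<^sub>R free_eval M g) \<psi>"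
  proof (cases "\<psi> \<in> vecs (free_space M)")
    case True
    have lin: "linear_on (vecs (dual (free0 M))) \<psi>"
      by (rule dual_linear[OF free_space_dual_dual(1)[OF True]])
    show ?thesis
      using linear_onD[OF lin]
        seminormedD(4)[OF seminormed_dual[OF seminormed_free0] lip_eval_dual(1)[OF assms(4,2)]]
        lip_eval_dual(1)[OF assms(3,1)] lip_eval_dual(1)[OF assms(4,2)] True
      by (simp add: lip_eval_comb free_eval_def scaleR_apply)
  qed (simp add: free_eval_def scaleR_apply)
qed

lemma lip_functional_bidual:
  assumes \<Psi>: "\<Psi> \<in> unit_ball (dual (dual (free_space M)))"
  shows "lip_functional M (\<lambda>f. \<Psi> (free_eval M f))"
proof -
  let ?D = "dual (free_space M)"
  have m: "\<Psi> \<in> vecs (dual ?D)" "nrm (dual ?D) \<Psi> \<le> 1" using \<Psi> by (auto simp: unit_ball_def)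
  have D: "seminormed ?D" by (intro seminormed_dual seminormed_free_space)
  note lin = dual_linear[OF m(1)]
  have "\<Psi> (free_eval M (\<lambda>z. f z + r * g z)) = \<Psi> (free_eval M f) + r * \<Psi> (free_eval M g)"
    if "0 \<le> K" "0 \<le> L" "lip M K f" "lip M L g" for f g K L r
    using linear_onD[OF lin] seminormedD(4)[OF D]
      free_eval_dual(1)[OF that(3,1)] free_eval_dual(1)[OF that(4,2)] by (simp add: free_eval_comb[OF that])
  moreover have "\<bar>\<Psi> (free_eval M f)\<bar> \<le> K" if "0 \<le> K" "lip M K f" for f K
  proof -
    have "\<bar>\<Psi> (free_eval M f)\<bar> \<le> nrm (dual ?D) \<Psi> * nrm ?D (free_eval M f)"
      by (rule dual_bound[OF D m(1) free_eval_dual(1)[OF that(2,1)]])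
    also have "\<dots> \<le> 1 * K"
      using m(2) free_eval_dual[OF that(2,1)] seminormedD(3)[OF D] that by (intro mult_mono) auto
    finally show ?thesis by simp
  qed
  ultimately show ?thesis unfolding lip_functional_def by blast
qed

lemma dual_free_space_repr:
  assumes \<xi>: "\<xi> \<in> vecs (dual (free_space M))"
  obtains r f where "lip M 1 f" "\<xi> = r *\<^sub>R free_eval M f"
proof -
  let ?n = "nrm (dual (free_space M)) \<xi>"
  note F = seminormed_free_space[of M]
  have n: "0 \<le> ?n" by (rule dual_nrm_nonneg[OF F \<xi>])
  obtain h where h: "lip M ?n h" "\<And>\<psi>. \<psi> \<in> vecs (free_space M) \<Longrightarrow> \<xi> \<psi> = \<psi> (lip_eval M h)"
    using free_space_functional_repr[OF dual_linear[OF \<xi>] n dual_bound[OF F \<xi>]] by blast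
  have x: "\<xi> = free_eval M h" using h(2) dual_outside[OF \<xi>] by (auto simp: free_eval_def)
  have "lip M (inverse (?n + 1) * ?n) (\<lambda>z. inverse (?n + 1) * h z)"
    using lip_scale[OF h(1), of "inverse (?n + 1)"] n by simp
  then have f: "lip M 1 (\<lambda>z. inverse (?n + 1) * h z)"
    by (rule lip_mono) (use n in \<open>simp add: field_simps\<close>)
  have "free_eval M (\<lambda>z. 0 + (?n + 1) * (inverse (?n + 1) * h z)) = free_eval M (\<lambda>_. 0) + (?n + 1) *\<^sub>R free_eval M (\<lambda>z. inverse (?n + 1) * h z)"
    by (rule free_eval_comb[of 0 1]) (use f in \<open>auto simp: lip_def\<close>)
  moreover have "(\<lambda>z. 0 + (?n + 1) * (inverse (?n + 1) * h z)) = h" using n by (auto simp: fun_eq_iff)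
  moreover have "free_eval M (\<lambda>_. 0) = 0"
  proof -
    have "free_eval M (\<lambda>z. 0 + (-1) * 0) = free_eval M (\<lambda>_. 0) + (-1) *\<^sub>R free_eval M (\<lambda>_. 0)"
      by (rule free_eval_comb[of 0 0]) (auto simp: lip_def)
    then show ?thesis by simp
  qed
  ultimately have "\<xi> = (?n + 1) *\<^sub>R free_eval M (\<lambda>z. inverse (?n + 1) * h z)"
    using x by (simp only: add_0)
  then show ?thesis by (rule that[OF f])
qed

text \<open>If the molecule is inside a segment, then for each slice at the molecule at least one end
  of the segment lies in that slice. One of the two ends lies in arbitrarily small slices and is
  therefore the molecule itself.\<close>

lemma sharp_pair_E_ext:
  assumes sh: "sharp_pair M x y"
  shows "(x, y) \<in> E_ext M"
proof -
  let ?F = "free_space M"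
  let ?B = "unit_ball (dual (dual ?F))"
  let ?e = "bidual_embed ?F (molecule M x y)"
  let ?c = "\<lambda>f. (f x - f y) / mdist M x y"
  have xy: "x \<in> mspace M" "y \<in> mspace M" "x \<noteq> y" using sh by (auto simp: sharp_pair_def)
  have D: "mdist M x y > 0" using mdist_pos[OF xy] .
  note F = seminormed_free_space[of M]
  note mol = molecule_free_space[OF xy(1,2)]
  have eB: "?e \<in> ?B"
    using bidual_embed_mem[OF F mol] molecule_nrm[OF xy(1,2)] by (auto simp: unit_ball_def)
  have e_lip_eval: "?e (free_eval M f) = ?c f" if "lip M K f" "0 \<le> K" for f K
    using free_eval_dual(1)[OF that] molecule_lip_eval[OF xy(1,2) that] mol by (simp add: bidual_embed_def free_eval_def)
  have "False" if a: "a \<in> ?B" and b: "b \<in> ?B" and seg: "?e \<in> open_segment a b" for a b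
  proof -
    obtain u where u: "a \<noteq> b" "0 < u" "u < 1" "?e = (1 - u) *\<^sub>R a + u *\<^sub>R b"
      using seg by (auto simp: in_segment)
    define P where "P = (\<lambda>\<eta> \<Psi>. \<forall>f. lip M 1 f \<longrightarrow> \<bar>\<Psi> (free_eval M f) - ?c f\<bar> \<le> \<eta>)"
    have ab: "P \<eta> a \<or> P \<eta> b" if "\<eta> > 0" for \<eta>
    proof -
      obtain \<theta> g where g: "0 < \<theta>" "\<theta> \<le> 1 / 2" "lip M 2 g" "g x - g y = mdist M x y"
        "\<And>\<nu> f. lip_functional M \<nu> \<Longrightarrow> 1 - \<theta> \<le> \<nu> g \<Longrightarrow> lip M 1 f \<Longrightarrow> \<bar>\<nu> f - ?c f\<bar> \<le> \<eta>"
        by (rule sharp_pair_denting[OF sh \<open>\<eta> > 0\<close>]) blast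
      have "1 = ?e (free_eval M g)" using e_lip_eval[OF g(3)] g(4) D by simp
      also have "\<dots> = (1 - u) * a (free_eval M g) + u * b (free_eval M g)"
        unfolding u(4) by (simp add: scaleR_apply)
      finally have eq: "1 = (1 - u) * a (free_eval M g) + u * b (free_eval M g)" .
      have "1 \<le> a (free_eval M g) \<or> 1 \<le> b (free_eval M g)"
      proof (rule ccontr)
        assume "\<not> ?thesis"
        then have "(1 - u) * a (free_eval M g) + u * b (free_eval M g) < (1 - u) * 1 + u * 1"
          using u by (intro add_strict_mono mult_strict_left_mono) auto
        with eq show False by simp
      qed
      then have "1 - \<theta> \<le> a (free_eval M g) \<or> 1 - \<theta> \<le> b (free_eval M g)" using g(1) by linarith
      then show ?thesis
        using g(5)[OF lip_functional_bidual[OF a]] g(5)[OF lip_functional_bidual[OF b]]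
        unfolding P_def by blast
    qed
    have mono: "P \<eta> \<Psi> \<Longrightarrow> \<eta> \<le> \<eta>' \<Longrightarrow> P \<eta>' \<Psi>" for \<eta> \<eta>' \<Psi>
      unfolding P_def by (meson order_trans)
    have "(\<forall>\<eta>>0. P \<eta> a) \<or> (\<forall>\<eta>>0. P \<eta> b)"
    proof (rule ccontr)
      assume "\<not> ?thesis"
      then obtain \<eta>1 \<eta>2 where "\<eta>1 > 0" "\<eta>2 > 0" "\<not> P \<eta>1 a" "\<not> P \<eta>2 b" by blast
      with ab[of "min \<eta>1 \<eta>2"] mono show False by (metis min.cobounded1 min.cobounded2 min_less_iff_conj)
    qed
    then obtain \<Psi> where \<Psi>: "\<Psi> = a \<or> \<Psi> = b" "\<And>\<eta>. \<eta> > 0 \<Longrightarrow> P \<eta> \<Psi>" by blast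
    have m: "\<Psi> \<in> vecs (dual (dual ?F))" using \<Psi>(1) a b by (auto simp: unit_ball_def)
    have em: "?e \<in> vecs (dual (dual ?F))" using eB by (auto simp: unit_ball_def)
    have lip_eval_eq: "\<Psi> (free_eval M f) = ?e (free_eval M f)" if f: "lip M 1 f" for f
    proof -
      have "\<bar>\<Psi> (free_eval M f) - ?c f\<bar> \<le> 0"
      proof (rule field_le_epsilon)
        fix \<eta> :: real assume "0 < \<eta>"
        then have "P \<eta> \<Psi>" by (rule \<Psi>(2))
        then show "\<bar>\<Psi> (free_eval M f) - ?c f\<bar> \<le> 0 + \<eta>" using f unfolding P_def by simp
      qed
      then show ?thesis using e_lip_eval[OF f] by simp
    qed
    have "\<Psi> = ?e"
    proof
      fix \<xi>
      show "\<Psi> \<xi> = ?e \<xi>"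
      proof (cases "\<xi> \<in> vecs (dual ?F)")
        case True
        obtain r f where rf: "lip M 1 f" "\<xi> = r *\<^sub>R free_eval M f" using dual_free_space_repr[OF True] .
        have "free_eval M f \<in> vecs (dual ?F)" using free_eval_dual(1)[OF rf(1)] by simp
        then show ?thesis
          using linear_onD(2)[OF dual_linear[OF m]] linear_onD(2)[OF dual_linear[OF em]] lip_eval_eq[OF rf(1)]
          by (simp add: rf(2))
      next
        case False
        then show ?thesis using dual_outside[OF m] dual_outside[OF em] by simp
      qed
    qed
    have "u *\<^sub>R (b - a) = ?e - a" "(1 - u) *\<^sub>R (b - a) = b - ?e"
      unfolding u(4) by (simp_all add: algebra_simps)
    with \<open>\<Psi> = ?e\<close> \<Psi>(1) have "u *\<^sub>R (b - a) = 0 \<or> (1 - u) *\<^sub>R (b - a) = 0" by force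
    then show False using u by auto
  qed
  then show ?thesis using xy eB by (auto simp: E_ext_def extreme_point_of_def)
qed

section \<open>Preserved extreme molecules come from sharp pairs\<close>

lemma E_ext_vertices: "(x, y) \<in> E_ext M \<Longrightarrow> x \<in> mspace M \<and> y \<in> mspace M \<and> x \<noteq> y"
  by (simp add: E_ext_def)

text \<open>The unit ball of a dual is weak* compact by Tychonoff's theorem. Choosing a filter \<open>F\<close> along which the
  whole sequence converges avoids passing to subnets.\<close>

lemma cluster_functional:
  assumes X: "seminormed X" and w: "\<And>n. w n \<in> unit_ball X"
  obtains \<Phi> F where "\<Phi> \<in> unit_ball (dual (dual X))" "F \<noteq> bot" "F \<le> sequentially"
    "\<And>\<xi>. \<xi> \<in> vecs (dual X) \<Longrightarrow> ((\<lambda>n::nat. \<xi> (w n)) \<longlongrightarrow> \<Phi> \<xi>) F"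
proof -
  let ?D = "dual X"
  let ?e = "\<lambda>n. bidual_embed X (w n)"
  have D: "seminormed ?D" by (intro seminormed_dual X)
  have wX: "w n \<in> vecs X" "nrm X (w n) \<le> 1" for n using w by (auto simp: unit_ball_def)
  define B where "B = (\<Pi>\<^sub>E \<xi>\<in>UNIV. {- \<bar>nrm ?D \<xi>\<bar>..\<bar>nrm ?D \<xi>\<bar>})"
  have "compactin (product_topology (\<lambda>_. euclidean) UNIV) B"
    unfolding B_def by (subst compactin_PiE) auto
  then have B: "compact B" by (simp add: euclidean_product_topology)
  have bd: "\<bar>\<xi> (w n)\<bar> \<le> nrm ?D \<xi>" if "\<xi> \<in> vecs ?D" for \<xi> n
  proof -
    have "\<bar>\<xi> (w n)\<bar> \<le> nrm ?D \<xi> * nrm X (w n)" by (rule dual_bound[OF X that wX(1)])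
    also have "\<dots> \<le> nrm ?D \<xi> * 1"
      using wX seminormedD(3)[OF D that] by (intro mult_left_mono) auto
    finally show ?thesis by simp
  qed
  have eB: "?e n \<in> B" for n
  proof -
    have "\<bar>?e n \<xi>\<bar> \<le> \<bar>nrm ?D \<xi>\<bar>" for \<xi>
      using bd[of \<xi> n] by (cases "\<xi> \<in> vecs ?D") (auto simp: bidual_embed_def)
    then show ?thesis by (auto simp: B_def abs_le_iff minus_le_iff)
  qed
  let ?G = "filtermap ?e sequentially"
  have "eventually (\<lambda>\<Phi>. \<Phi> \<in> B) ?G" by (simp add: eventually_filtermap eB)
  moreover have "?G \<noteq> bot" by (simp add: filtermap_bot_iff)
  ultimately obtain \<Phi> where \<Phi>: "inf (nhds \<Phi>) ?G \<noteq> bot"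
    using B unfolding compact_filter by blast
  define F where "F = inf sequentially (filtercomap ?e (nhds \<Phi>))"
  have Fne: "F \<noteq> bot"
  proof
    assume "F = bot"
    then have "eventually (\<lambda>_. False) (inf (filtercomap ?e (nhds \<Phi>)) sequentially)"
      by (simp add: F_def inf_commute)
    then obtain P Q where PQ: "eventually P (filtercomap ?e (nhds \<Phi>))" "eventually Q sequentially"
      "\<And>n. P n \<Longrightarrow> Q n \<Longrightarrow> False"
      unfolding eventually_inf by blast
    then obtain R where R: "eventually R (nhds \<Phi>)" "\<And>n. R (?e n) \<Longrightarrow> P n"
      unfolding eventually_filtercomap by blast
    have "eventually (\<lambda>\<Psi>. \<not> R \<Psi>) ?G"
      unfolding eventually_filtermap using PQ(2) by (rule eventually_mono) (use PQ(3) R(2) in blast)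
    with R(1) have "eventually (\<lambda>_. False) (inf (nhds \<Phi>) ?G)"
      unfolding eventually_inf by blast
    with \<Phi> show False by (simp add: eventually_False)
  qed
  have lim: "(?e \<longlongrightarrow> \<Phi>) F"
    unfolding filterlim_iff_le_filtercomap F_def by simp
  have co: "((\<lambda>n. ?e n \<xi>) \<longlongrightarrow> \<Phi> \<xi>) F" for \<xi>
    by (rule continuous_on_tendsto_compose[OF continuous_on_product_coordinates lim]) auto
  have le: "\<bar>\<Phi> \<xi>\<bar> \<le> 1 * nrm ?D \<xi>" if "\<xi> \<in> vecs ?D" for \<xi>
  proof -
    have "((\<lambda>n. \<bar>?e n \<xi>\<bar>) \<longlongrightarrow> \<bar>\<Phi> \<xi>\<bar>) F" by (intro tendsto_rabs co)
    moreover have "eventually (\<lambda>n. \<bar>?e n \<xi>\<bar> \<le> nrm ?D \<xi>) F"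
      using bd[OF that] that by (simp add: bidual_embed_def)
    ultimately have "\<bar>\<Phi> \<xi>\<bar> \<le> nrm ?D \<xi>" using tendsto_upperbound Fne by blast
    then show ?thesis by simp
  qed
  have emem: "?e n \<in> vecs (dual ?D)" for n by (rule bidual_embed_mem(1)[OF X wX(1)])
  have "linear_on (vecs ?D) \<Phi>"
    unfolding linear_on_def
  proof (intro conjI ballI allI)
    fix \<xi> \<zeta> assume m: "\<xi> \<in> vecs ?D" "\<zeta> \<in> vecs ?D"
    have "((\<lambda>n. ?e n \<xi> + ?e n \<zeta>) \<longlongrightarrow> \<Phi> \<xi> + \<Phi> \<zeta>) F" by (intro tendsto_add co)
    moreover have "((\<lambda>n. ?e n \<xi> + ?e n \<zeta>) \<longlongrightarrow> \<Phi> (\<xi> + \<zeta>)) F"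
      using co[of "\<xi> + \<zeta>"] by (simp add: linear_onD(1)[OF dual_linear[OF emem] m])
    ultimately show "\<Phi> (\<xi> + \<zeta>) = \<Phi> \<xi> + \<Phi> \<zeta>" using tendsto_unique[OF Fne] by blast
  next
    fix r \<xi> assume m: "\<xi> \<in> vecs ?D"
    have "((\<lambda>n. r *\<^sub>R ?e n \<xi>) \<longlongrightarrow> r *\<^sub>R \<Phi> \<xi>) F" by (intro tendsto_scaleR tendsto_const co)
    moreover have "((\<lambda>n. r *\<^sub>R ?e n \<xi>) \<longlongrightarrow> \<Phi> (r *\<^sub>R \<xi>)) F"
      using co[of "r *\<^sub>R \<xi>"] by (simp add: linear_onD(2)[OF dual_linear[OF emem] m])
    ultimately show "\<Phi> (r *\<^sub>R \<xi>) = r *\<^sub>R \<Phi> \<xi>" using tendsto_unique[OF Fne] by blast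
  qed
  moreover have "\<Phi> \<xi> = 0" if "\<xi> \<notin> vecs ?D" for \<xi>
    using tendsto_unique[OF Fne co[of \<xi>], of 0] that by (simp add: bidual_embed_def)
  ultimately have "\<Phi> \<in> vecs (dual ?D)" unfolding dual_iff[of \<Phi>] using le by blast
  moreover have "nrm (dual ?D) \<Phi> \<le> 1" by (rule dual_nrm_le[OF D _ le]) auto
  ultimately have "\<Phi> \<in> unit_ball (dual ?D)" by (simp add: unit_ball_def)
  moreover have "F \<le> sequentially" by (simp add: F_def)
  moreover have "((\<lambda>n. \<xi> (w n)) \<longlongrightarrow> \<Phi> \<xi>) F" if "\<xi> \<in> vecs ?D" for \<xi>
    using co[of \<xi>] that by (simp add: bidual_embed_def)
  ultimately show ?thesis using that Fne by blast
qed

text \<open>If detours through points \<open>z n\<close> have excess tending to zero, then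
  \<open>m\<^sub>x\<^sub>y = (a n / D) m\<^sub>x\<^sub>z + (b n / D) m\<^sub>z\<^sub>y\<close> with weights that converge to \<open>t\<close> and \<open>1 - t\<close>. A cluster point \<open>\<Phi>\<close>
  of the \<open>m\<^sub>x\<^sub>z\<close> and the complementary functional \<open>\<Psi>\<close> lie in the unit ball and have \<open>m\<^sub>x\<^sub>y\<close> between them.\<close>

lemma E_ext_sharp_pair:
  assumes E: "(x, y) \<in> E_ext M"
  shows "sharp_pair M x y"
proof (rule ccontr)
  assume ns: "\<not> sharp_pair M x y"
  let ?F = "free_space M"
  let ?e = "bidual_embed ?F (molecule M x y)"
  define D where "D = mdist M x y"
  have xy: "x \<in> mspace M" "y \<in> mspace M" "x \<noteq> y" using E_ext_vertices[OF E] by auto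
  have D: "D > 0" using mdist_pos[OF xy] by (simp add: D_def)
  note F = seminormed_free_space[of M]
  obtain \<epsilon> where eps: "\<epsilon> > 0" "\<And>\<delta>. \<delta> > 0 \<Longrightarrow> \<exists>z\<in>mspace M. \<epsilon> \<le> min (mdist M x z) (mdist M y z) \<and>
      mdist M x z + mdist M z y - \<delta> \<le> D"
  proof -
    have "\<exists>\<epsilon>>0. \<forall>\<delta>>0. \<exists>z\<in>mspace M. \<epsilon> \<le> min (mdist M x z) (mdist M y z) \<and>
        \<not> D < mdist M x z + mdist M z y - \<delta>"
      using ns xy unfolding sharp_pair_def D_def by metis
    then show ?thesis using that unfolding not_less by blast
  qed
  then have "\<forall>n. \<exists>z\<in>mspace M. \<epsilon> \<le> min (mdist M x z) (mdist M y z) \<and>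
      mdist M x z + mdist M z y - inverse (real (Suc n)) \<le> D"
    by simp
  then obtain z0 where "\<And>n. z0 n \<in> mspace M \<and> \<epsilon> \<le> min (mdist M x (z0 n)) (mdist M y (z0 n)) \<and>
      mdist M x (z0 n) + mdist M (z0 n) y - inverse (real (Suc n)) \<le> D"
    by metis
  then have z0: "\<And>n. z0 n \<in> mspace M" "\<And>n. \<epsilon> \<le> mdist M x (z0 n)" "\<And>n. \<epsilon> \<le> mdist M y (z0 n)"
      "\<And>n. mdist M x (z0 n) + mdist M (z0 n) y \<le> D + inverse (real (Suc n))"
    by (simp_all only: min.bounded_iff diff_le_eq)
  have "bounded (range (\<lambda>n. mdist M x (z0 n)))"
  proof (rule boundedI)
    fix t assume "t \<in> range (\<lambda>n. mdist M x (z0 n))"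
    then obtain n where "t = mdist M x (z0 n)" by auto
    then show "norm t \<le> D + 1"
      using z0(4)[of n] mdist_nonneg[of M "z0 n" y] mdist_nonneg[of M x "z0 n"]
        inverse_le_1_iff[of "real (Suc n)"] unfolding real_norm_def by linarith
  qed
  then obtain l s where s: "strict_mono s" "((\<lambda>n. mdist M x (z0 n)) \<circ> s) \<longlonglongrightarrow> l"
    using bounded_imp_convergent_subsequence by blast
  define z where "z = (\<lambda>n. z0 (s n))"
  have z: "z n \<in> mspace M" "\<epsilon> \<le> mdist M x (z n)" "\<epsilon> \<le> mdist M y (z n)" for n
    using z0 by (auto simp: z_def)
  define a where "a = (\<lambda>n. mdist M x (z n))"
  define b where "b = (\<lambda>n. mdist M (z n) y)"
  have al: "a \<longlonglongrightarrow> l" using s(2) by (simp add: a_def z_def o_def)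
  have sum: "(\<lambda>n. a n + b n) \<longlonglongrightarrow> D"
  proof (rule tendsto_sandwich[of "\<lambda>_. D" _ _ "\<lambda>n. D + inverse (real (Suc (s n)))"])
    show "\<forall>\<^sub>F n in sequentially. D \<le> a n + b n"
      using mdist_triangle[OF xy(1) z(1) xy(2)] by (simp add: a_def b_def D_def)
    show "\<forall>\<^sub>F n in sequentially. a n + b n \<le> D + inverse (real (Suc (s n)))"
      using z0(4) by (simp add: a_def b_def z_def)
    have "(\<lambda>n. inverse (real (Suc (s n)))) \<longlonglongrightarrow> 0"
      using LIMSEQ_subseq_LIMSEQ[OF LIMSEQ_inverse_real_of_nat s(1)] by (simp add: o_def)
    then show "(\<lambda>n. D + inverse (real (Suc (s n)))) \<longlonglongrightarrow> D"
      using tendsto_add[OF tendsto_const] by force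
  qed simp
  have bl: "b \<longlonglongrightarrow> D - l" using tendsto_diff[OF sum al] by simp
  have l: "\<epsilon> \<le> l" "\<epsilon> \<le> D - l"
    using z by (auto intro!: tendsto_lowerbound[OF al] tendsto_lowerbound[OF bl] simp: a_def b_def mdist_commute)
  define w where "w = (\<lambda>n. molecule M x (z n))"
  have wB: "w n \<in> unit_ball ?F" for n
    using molecule_free_space[OF xy(1) z(1)] molecule_nrm[OF xy(1) z(1)] by (simp add: w_def unit_ball_def)
  obtain \<Phi> G where \<Phi>: "\<Phi> \<in> unit_ball (dual (dual ?F))" and G: "G \<noteq> bot" "G \<le> sequentially"
    and lim: "\<And>\<xi>. \<xi> \<in> vecs (dual ?F) \<Longrightarrow> ((\<lambda>n. \<xi> (w n)) \<longlongrightarrow> \<Phi> \<xi>) G"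
    by (rule cluster_functional[where w = w, OF F wB]) blast
  define t where "t = l / D"
  have t: "0 < t" "t < 1" using l eps(1) D by (auto simp: t_def)
  define \<Psi> where "\<Psi> = (1 / (1 - t)) *\<^sub>R (?e - t *\<^sub>R \<Phi>)"
  have DF: "seminormed (dual ?F)" and DDF: "seminormed (dual (dual ?F))"
    by (intro seminormed_dual F)+
  have m: "molecule M x y \<in> vecs ?F" by (rule molecule_free_space[OF xy(1,2)])
  have em: "?e \<in> vecs (dual (dual ?F))" by (rule bidual_embed_mem(1)[OF F m])
  have \<Phi>m: "\<Phi> \<in> vecs (dual (dual ?F))" using \<Phi> by (simp add: unit_ball_def)
  have \<Psi>m: "\<Psi> \<in> vecs (dual (dual ?F))"
    unfolding \<Psi>_def by (intro seminormedD(4,7)[OF DDF] em \<Phi>m)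
  have \<Psi>b: "\<bar>\<Psi> \<xi>\<bar> \<le> 1 * nrm (dual ?F) \<xi>" if \<xi>: "\<xi> \<in> vecs (dual ?F)" for \<xi>
  proof -
    have lin: "linear_on (vecs ?F) \<xi>" by (rule dual_linear[OF \<xi>])
    have dec: "\<xi> (molecule M x y) = (a n / D) * \<xi> (w n) + (b n / D) * \<xi> (molecule M (z n) y)" for n
    proof -
      have ab: "a n > 0" "b n > 0" using z[of n] eps(1) by (auto simp: a_def b_def mdist_commute)
      have eq: "molecule M x y = (a n / D) *\<^sub>R w n + (b n / D) *\<^sub>R molecule M (z n) y"
      proof -
        let ?emb = "bidual_embed (free0 M)"
        have "a n \<noteq> 0" "b n \<noteq> 0" using ab by simp_all
        have an: "mdist M x (z n) = a n" "mdist M (z n) y = b n" by (simp_all add: a_def b_def)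
        have "(a n / D) *\<^sub>R w n = (1 / D) *\<^sub>R ?emb (dipole x (z n))"
          unfolding w_def molecule_dipole[OF xy(1) z(1)] scaleR_scaleR using \<open>a n \<noteq> 0\<close>
          by (simp add: an)
        moreover have "(b n / D) *\<^sub>R molecule M (z n) y = (1 / D) *\<^sub>R ?emb (dipole (z n) y)"
          unfolding molecule_dipole[OF z(1) xy(2)] scaleR_scaleR using \<open>b n \<noteq> 0\<close>
          by (simp add: an)
        moreover have "?emb (dipole x y) = ?emb (dipole x (z n)) + ?emb (dipole (z n) y)"
          using bidual_embed_add[OF dipole_free0[OF xy(1) z(1)[of n]] dipole_free0[OF z(1)[of n] xy(2)]]
          by (simp add: dipole_add)
        ultimately show ?thesis
          by (simp add: molecule_dipole xy D_def scaleR_add_right)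
      qed
      have m1: "w n \<in> vecs ?F" using wB[of n] by (simp add: unit_ball_def)
      note m2 = molecule_free_space[OF z(1) xy(2), of n]
      show ?thesis
        unfolding eq linear_onD(1)[OF lin seminormedD(4)[OF F m1] seminormedD(4)[OF F m2]]
        by (simp add: linear_onD(2)[OF lin m1] linear_onD(2)[OF lin m2])
    qed
    have "((\<lambda>n. \<xi> (molecule M x y) - (a n / D) * \<xi> (w n)) \<longlongrightarrow> \<xi> (molecule M x y) - t * \<Phi> \<xi>) G"
      unfolding t_def using tendsto_mono[OF G(2) al] D
      by (intro tendsto_intros lim \<xi>) auto
    then have "((\<lambda>n. \<bar>\<xi> (molecule M x y) - (a n / D) * \<xi> (w n)\<bar>) \<longlongrightarrow> \<bar>\<xi> (molecule M x y) - t * \<Phi> \<xi>\<bar>) G"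
      by (rule tendsto_rabs)
    moreover have "((\<lambda>n. (b n / D) * nrm (dual ?F) \<xi>) \<longlongrightarrow> ((D - l) / D) * nrm (dual ?F) \<xi>) G"
      using tendsto_mono[OF G(2) bl] D by (intro tendsto_intros) auto
    moreover have "\<bar>\<xi> (molecule M x y) - (a n / D) * \<xi> (w n)\<bar> \<le> (b n / D) * nrm (dual ?F) \<xi>" for n
    proof -
      have "\<bar>\<xi> (molecule M (z n) y)\<bar> \<le> nrm (dual ?F) \<xi> * nrm ?F (molecule M (z n) y)"
        by (rule dual_bound[OF F \<xi> molecule_free_space[OF z(1) xy(2)]])
      also have "\<dots> \<le> nrm (dual ?F) \<xi> * 1"
        using molecule_nrm[OF z(1) xy(2), of n] seminormedD(3)[OF DF \<xi>] by (intro mult_left_mono)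
      finally have "(b n / D) * \<bar>\<xi> (molecule M (z n) y)\<bar> \<le> (b n / D) * nrm (dual ?F) \<xi>"
        using D by (intro mult_left_mono) (auto simp: b_def)
      then show ?thesis using D by (simp add: dec[of n] abs_mult b_def)
    qed
    ultimately have "\<bar>\<xi> (molecule M x y) - t * \<Phi> \<xi>\<bar> \<le> ((D - l) / D) * nrm (dual ?F) \<xi>"
      using tendsto_le[OF G(1)] by (metis (mono_tags, lifting) always_eventually)
    moreover have "(D - l) / D = 1 - t" using D by (simp add: t_def diff_divide_distrib)
    moreover have "\<Psi> \<xi> = (\<xi> (molecule M x y) - t * \<Phi> \<xi>) / (1 - t)"
      using \<xi> by (simp add: \<Psi>_def scaleR_apply bidual_embed_def)
    ultimately show ?thesis using t by (simp add: divide_le_eq mult.commute)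
  qed
  have \<Psi>B: "\<Psi> \<in> unit_ball (dual (dual ?F))"
    using \<Psi>m dual_nrm_le[OF DF _ \<Psi>b] by (simp add: unit_ball_def)
  have eq: "?e = (1 - t) *\<^sub>R \<Psi> + t *\<^sub>R \<Phi>" using t by (simp add: \<Psi>_def)
  have "\<Psi> \<noteq> \<Phi>"
  proof
    assume "\<Psi> = \<Phi>"
    then have "?e = \<Phi>" unfolding eq by (simp flip: scaleR_add_left)
    \<comment> \<open>its slope is \<open>\<epsilon> / D\<close> from \<open>x\<close> to \<open>y\<close>, but tends to the larger \<open>\<epsilon> / l\<close> from \<open>x\<close> to \<open>z n\<close>\<close>
    define f where "f = (\<lambda>u. min (mdist M x u) \<epsilon>)"
    have f: "lip M 1 f"
    proof (rule lipI)
      fix u v assume "u \<in> mspace M" "v \<in> mspace M"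
      then show "\<bar>f u - f v\<bar> \<le> 1 * mdist M u v"
        using lipD[OF lip_dist'[OF xy(1)], of u v] by (auto simp: f_def min_def)
    qed
    have fv: "f x = 0" "f y = \<epsilon>" "\<And>n. f (z n) = \<epsilon>"
    proof -
      have "mdist M x x = 0" using xy by simp
      then show "f x = 0" using eps(1) by (simp add: f_def)
      show "f y = \<epsilon>" using l eps(1) by (simp add: f_def min_def flip: D_def)
      show "f (z n) = \<epsilon>" for n using z(2)[of n] by (simp add: f_def min_def)
    qed
    have lip_eval: "free_eval M f \<in> vecs (dual ?F)" using free_eval_dual(1)[OF f] by simp
    have "((\<lambda>n. free_eval M f (w n)) \<longlongrightarrow> ?e (free_eval M f)) G" using lim[OF lip_eval] \<open>?e = \<Phi>\<close> by simp
    moreover have "?e (free_eval M f) = - \<epsilon> / D"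
      using lip_eval m molecule_lip_eval[OF xy(1,2) f] by (simp add: bidual_embed_def free_eval_def fv D_def)
    moreover have "free_eval M f (w n) = - \<epsilon> / a n" for n
      using wB[of n] molecule_lip_eval[OF xy(1) z(1) f, of n] by (simp add: unit_ball_def free_eval_def w_def fv a_def)
    ultimately have "((\<lambda>n. - \<epsilon> / a n) \<longlongrightarrow> - \<epsilon> / D) G" by simp
    moreover have "((\<lambda>n. - \<epsilon> / a n) \<longlongrightarrow> - \<epsilon> / l) G"
      using tendsto_mono[OF G(2) al] l eps(1) by (intro tendsto_intros) auto
    ultimately have "- \<epsilon> / D = - \<epsilon> / l" using tendsto_unique[OF G(1)] by blast
    then show False using l eps(1) D by (simp add: field_simps)
  qed
  then have "?e \<in> open_segment \<Psi> \<Phi>" using t eq by (auto simp: in_segment)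
  then show False using E \<Phi> \<Psi>B by (auto simp: E_ext_def extreme_point_of_def)
qed

lemma E_ext_iff_sharp_pair: "(x, y) \<in> E_ext M \<longleftrightarrow> sharp_pair M x y"
  by (rule iffI[OF E_ext_sharp_pair sharp_pair_E_ext])

section \<open>Isometries send sharp molecules to molecules\<close>

lemma free_space_definite:
  assumes "\<psi> \<in> vecs (free_space M)" "nrm (free_space M) \<psi> \<le> 0"
  shows "\<psi> = 0"
  using dual_nrm_zero[OF seminormed_dual[OF seminormed_free0] free_space_dual_dual(1)[OF assms(1)]]
    assms(2) by (simp add: free_space_dual_dual(2))

text \<open>Isometries are injective because the seminorm of the free space is a norm.\<close>

lemma surj_linear_isometry_inverse:
  assumes T: "surj_linear_isometry (free_space M) T"
  obtains T' where "surj_linear_isometry (free_space M) T'"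
    "\<And>\<psi>. \<psi> \<in> vecs (free_space M) \<Longrightarrow> T' (T \<psi>) = \<psi>"
    "\<And>\<psi>. \<psi> \<in> vecs (free_space M) \<Longrightarrow> T (T' \<psi>) = \<psi>"
proof -
  let ?V = "vecs (free_space M)"
  note F = seminormed_free_space[of M]
  have S: "subspace ?V" using F by (simp add: seminormed_def)
  have lin: "linear_on ?V T" and sur: "T ` ?V = ?V"
    and iso: "\<And>\<psi>. \<psi> \<in> ?V \<Longrightarrow> nrm (free_space M) (T \<psi>) = nrm (free_space M) \<psi>"
    using T by (auto simp: surj_linear_isometry_def)
  have inj: "inj_on T ?V"
  proof (rule inj_onI)
    fix \<phi> \<psi> assume m: "\<phi> \<in> ?V" "\<psi> \<in> ?V" and eq: "T \<phi> = T \<psi>"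
    have d: "\<phi> - \<psi> \<in> ?V" by (rule subspace_diff[OF S m])
    have "nrm (free_space M) (\<phi> - \<psi>) = nrm (free_space M) (T \<phi> - T \<psi>)"
      using iso[OF d] linear_on_diff[OF lin S m] by simp
    also have "\<dots> = 0" using eq seminormedD(2)[OF F] by simp
    finally have "\<phi> - \<psi> = 0" using free_space_definite[OF d] by simp
    then show "\<phi> = \<psi>" by simp
  qed
  define T' where "T' = inv_into ?V T"
  have TT': "T (T' \<psi>) = \<psi>" and T'V: "T' \<psi> \<in> ?V" if "\<psi> \<in> ?V" for \<psi>
    using that sur by (auto simp: T'_def f_inv_into_f intro: inv_into_into)
  have T'T: "T' (T \<psi>) = \<psi>" if "\<psi> \<in> ?V" for \<psi>
    using inj that by (simp add: T'_def)
  have "linear_on ?V T'"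
    unfolding linear_on_def
  proof (intro conjI ballI allI)
    fix \<phi> \<psi> assume m: "\<phi> \<in> ?V" "\<psi> \<in> ?V"
    have "T (T' \<phi> + T' \<psi>) = \<phi> + \<psi>"
      using linear_onD(1)[OF lin T'V[OF m(1)] T'V[OF m(2)]] m by (simp add: TT')
    then show "T' (\<phi> + \<psi>) = T' \<phi> + T' \<psi>"
      using T'T[OF subspace_add[OF S T'V[OF m(1)] T'V[OF m(2)]]] by simp
  next
    fix r \<psi> assume m: "\<psi> \<in> ?V"
    have "T (r *\<^sub>R T' \<psi>) = r *\<^sub>R \<psi>"
      using linear_onD(2)[OF lin T'V[OF m]] m by (simp add: TT')
    then show "T' (r *\<^sub>R \<psi>) = r *\<^sub>R T' \<psi>"
      using T'T[OF subspace_scale[OF S T'V[OF m], of r]] by simp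
  qed
  moreover have "T' ` ?V = ?V"
  proof
    show "?V \<subseteq> T' ` ?V"
    proof
      fix \<psi> assume "\<psi> \<in> ?V"
      then have "\<psi> = T' (T \<psi>)" "T \<psi> \<in> ?V" using T'T sur by auto
      then show "\<psi> \<in> T' ` ?V" by blast
    qed
  qed (use T'V in blast)
  moreover have "nrm (free_space M) (T' \<psi>) = nrm (free_space M) \<psi>" if "\<psi> \<in> ?V" for \<psi>
    using iso[OF T'V[OF that]] TT'[OF that] by simp
  ultimately have "surj_linear_isometry (free_space M) T'"
    unfolding surj_linear_isometry_def by blast
  then show ?thesis using that T'T TT' by blast
qed

lemma molecule_swap:
  assumes "x \<in> mspace M" "y \<in> mspace M"
  shows "molecule M y x = - molecule M x y"
proof -
  have "dipole y x = (-1) *\<^sub>R dipole x y" by (simp add: dipole_minus)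
  then show ?thesis
    using bidual_embed_scaleR[OF dipole_free0[OF assms], of "-1"]
    by (simp add: molecule_dipole assms mdist_commute)
qed

text \<open>A bump at \<open>u\<close> of height \<open>r\<close> that vanishes at \<open>v\<close> and \<open>u'\<close> takes the value \<open>r / d(u,v)\<close> at the first
  molecule and a value \<open>\<le> 0\<close> at the second, so that \<open>r \<le> k * d(u,v)\<close>. As \<open>k < 1\<close>, the minimum
  defining \<open>r\<close> is \<open>d(u,u')\<close>.\<close>

lemma molecule_nearby_endpoint:
  assumes uv: "u \<in> mspace M" "v \<in> mspace M" "u \<noteq> v"
    and uv': "u' \<in> mspace M" "v' \<in> mspace M"
    and k: "nrm (free_space M) (molecule M u v - molecule M u' v') \<le> k" "k < 1"
  shows "mdist M u u' \<le> k * mdist M u v"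
proof -
  note F = seminormed_free_space[of M]
  have D: "mdist M u v > 0" by (rule mdist_pos[OF uv])
  define r where "r = min (mdist M u u') (mdist M u v)"
  define f where "f = (\<lambda>z. max (r - mdist M z u) 0)"
  have f: "lip M 1 f"
  proof (rule lipI)
    fix a b assume "a \<in> mspace M" "b \<in> mspace M"
    then show "\<bar>f a - f b\<bar> \<le> 1 * mdist M a b"
      using lipD[OF lip_dist[OF uv(1)], of a b] by (auto simp: f_def)
  qed
  have m: "molecule M u v \<in> vecs (free_space M)" "molecule M u' v' \<in> vecs (free_space M)"
    by (intro molecule_free_space uv uv')+
  have fv: "f u = r" "f v = 0" "f u' = 0" "f v' \<ge> 0"
  proof -
    have "mdist M u u = 0" using uv by simp
    then show "f u = r" by (simp add: f_def r_def)
  qed (auto simp: f_def r_def mdist_commute)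
  have "r / mdist M u v \<le> r / mdist M u v + f v' / mdist M u' v'" using fv by simp
  also have "\<dots> = (molecule M u v - molecule M u' v') (lip_eval M f)"
    using fv by (simp add: molecule_lip_eval[OF _ _ f] uv uv')
  also have "\<dots> \<le> k"
    using free_space_bound[OF seminormedD(7)[OF F m] f] k(1) by simp
  finally have "r \<le> k * mdist M u v" using D by (simp add: divide_le_eq)
  moreover have "k * mdist M u v < mdist M u v" using k(2) D by simp
  ultimately show ?thesis by (auto simp: r_def min_def split: if_splits)
qed

text \<open>By \<open>molecule_nearby_endpoint\<close>, the end points of a norm convergent sequence of molecules are Cauchy
  sequences whose distance is bounded and bounded away from zero.\<close>

lemma molecules_closed:
  assumes comp: "mcomplete_of M" and \<psi>: "\<psi> \<in> vecs (free_space M)"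
    and appr: "\<And>\<eta>. 0 < \<eta> \<Longrightarrow> \<exists>u\<in>mspace M. \<exists>v\<in>mspace M. u \<noteq> v \<and>
        nrm (free_space M) (\<psi> - molecule M u v) \<le> \<eta>"
  obtains u v where "u \<in> mspace M" "v \<in> mspace M" "u \<noteq> v" "\<psi> = molecule M u v"
proof -
  interpret Metric_space "mspace M" "mdist M" by (rule Metric_space_mspace_mdist)
  note F = seminormed_free_space[of M]
  \<comment> \<open>with two errors of at most \<open>1/8\<close>, all end points stay within a quarter of \<open>d(u 0, v 0)\<close> of \<open>u 0\<close>
    and \<open>v 0\<close>\<close>
  define \<eta> where "\<eta> = (\<lambda>n. inverse (real (Suc n)) / 8)"
  have \<eta>: "0 < \<eta> n" "\<eta> n \<le> 1 / 8" for n
    using inverse_le_1_iff[of "real (Suc n)"] by (auto simp: \<eta>_def)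
  have \<eta>0: "\<eta> \<longlonglongrightarrow> 0"
    unfolding \<eta>_def using tendsto_divide[OF LIMSEQ_inverse_real_of_nat tendsto_const[of 8]] by simp
  have "\<exists>w. fst w \<in> mspace M \<and> snd w \<in> mspace M \<and> fst w \<noteq> snd w \<and>
      nrm (free_space M) (\<psi> - molecule M (fst w) (snd w)) \<le> \<eta> n" for n
    using appr[OF \<eta>(1)[of n]] by auto
  then obtain w where w: "\<And>n. fst (w n) \<in> mspace M \<and> snd (w n) \<in> mspace M \<and> fst (w n) \<noteq> snd (w n) \<and>
      nrm (free_space M) (\<psi> - molecule M (fst (w n)) (snd (w n))) \<le> \<eta> n" by metis
  define u where "u = (\<lambda>n. fst (w n))"
  define v where "v = (\<lambda>n. snd (w n))"
  let ?m = "\<lambda>n. molecule M (u n) (v n)"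
  have uv: "u n \<in> mspace M" "v n \<in> mspace M" "u n \<noteq> v n"
    and near: "nrm (free_space M) (\<psi> - ?m n) \<le> \<eta> n" for n
    using w[of n] by (auto simp: u_def v_def)
  have m: "?m n \<in> vecs (free_space M)" for n by (rule molecule_free_space[OF uv(1,2)])
  have mm: "nrm (free_space M) (?m n - ?m k) \<le> \<eta> n + \<eta> k" for n k
  proof -
    have "?m n - ?m k = (\<psi> - ?m k) + (?m n - \<psi>)" by simp
    then have "nrm (free_space M) (?m n - ?m k) \<le> nrm (free_space M) (\<psi> - ?m k) + nrm (free_space M) (?m n - \<psi>)"
      using seminormedD(8)[OF F seminormedD(7)[OF F \<psi> m] seminormedD(7)[OF F m \<psi>], of k n] by simp
    then show ?thesis using near[of n] near[of k] seminormed_nrm_minus[OF F m \<psi>, of n] by simp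
  qed
  have small: "\<eta> n + \<eta> k < 1" for n k using \<eta>(2)[of n] \<eta>(2)[of k] by linarith
  have du: "mdist M (u n) (u k) \<le> (\<eta> n + \<eta> k) * mdist M (u n) (v n)" for n k
    by (rule molecule_nearby_endpoint[OF uv uv(1,2) mm small])
  have dv: "mdist M (v n) (v k) \<le> (\<eta> n + \<eta> k) * mdist M (u n) (v n)" for n k
  proof -
    have "molecule M (v n) (u n) - molecule M (v k) (u k) = ?m k - ?m n"
      by (simp add: molecule_swap[OF uv(1,2)])
    then have "nrm (free_space M) (molecule M (v n) (u n) - molecule M (v k) (u k)) \<le> \<eta> n + \<eta> k"
      using mm[of k n] by simp
    from molecule_nearby_endpoint[OF uv(2,1) uv(3)[symmetric] uv(2,1) this small]
    show ?thesis by (simp add: mdist_commute)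
  qed
  define D where "D = mdist M (u 0) (v 0)"
  have D: "D > 0" unfolding D_def by (rule mdist_pos[OF uv])
  have D4: "mdist M (u 0) (u n) \<le> D / 4" "mdist M (v 0) (v n) \<le> D / 4" for n
  proof -
    have "(\<eta> 0 + \<eta> n) * D \<le> (1 / 4) * D"
      using \<eta>(2)[of 0] \<eta>(2)[of n] D by (intro mult_right_mono) auto
    then show "mdist M (u 0) (u n) \<le> D / 4" "mdist M (v 0) (v n) \<le> D / 4"
      using du[of 0 n] dv[of 0 n] unfolding D_def by linarith+
  qed
  have upper: "mdist M (u n) (v n) \<le> 2 * D" and lower: "D / 2 \<le> mdist M (u n) (v n)" for n
    using D4[of n] mdist_triangle[OF uv(1)[of n] uv(1)[of 0] uv(2)[of n]]
      mdist_triangle[OF uv(1)[of 0] uv(2)[of 0] uv(2)[of n]]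
      mdist_triangle[OF uv(1)[of 0] uv(1)[of n] uv(2)[of 0]]
      mdist_triangle[OF uv(1)[of n] uv(2)[of n] uv(2)[of 0]] D
    unfolding D_def[symmetric] mdist_commute[of M "u n" "u 0"] mdist_commute[of M "v n" "v 0"]
    by linarith+
  have cauchy: "\<exists>l\<in>mspace M. (\<lambda>n. mdist M (a n) l) \<longlonglongrightarrow> 0"
    if a: "\<And>n. a n \<in> mspace M" "\<And>n k. mdist M (a n) (a k) \<le> (\<eta> n + \<eta> k) * mdist M (u n) (v n)" for a
  proof -
    have "MCauchy a"
      unfolding MCauchy_def
    proof (intro conjI allI impI)
      show "range a \<subseteq> mspace M" using a(1) by auto
      fix e :: real assume "e > 0"
      then have "\<forall>\<^sub>F n in sequentially. \<eta> n < e / (4 * D)"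
        using \<eta>0 D by (intro order_tendstoD(2)) auto
      then obtain N where N: "\<And>n. n \<ge> N \<Longrightarrow> \<eta> n < e / (4 * D)" by (auto simp: eventually_sequentially)
      have "mdist M (a n) (a k) < e" if "N \<le> n" "N \<le> k" for n k
      proof -
        have "mdist M (a n) (a k) \<le> (\<eta> n + \<eta> k) * (2 * D)"
          using a(2)[of n k] mult_left_mono[OF upper[of n], of "\<eta> n + \<eta> k"] \<eta>(1)[of n] \<eta>(1)[of k]
          by linarith
        also have "\<dots> < (e / (4 * D) + e / (4 * D)) * (2 * D)"
          using N[OF that(1)] N[OF that(2)] D by (intro mult_strict_right_mono) auto
        also have "\<dots> = e" using D by simp
        finally show ?thesis .
      qed
      then show "\<exists>N. \<forall>n n'. N \<le> n \<longrightarrow> N \<le> n' \<longrightarrow> mdist M (a n) (a n') < e" by blast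
    qed
    then obtain l where "limitin mtopology a l sequentially"
      using comp unfolding mcomplete_of_def mcomplete_def by blast
    then have l: "l \<in> mspace M" "\<And>e. e > 0 \<Longrightarrow> \<exists>N. \<forall>n\<ge>N. mdist M (a n) l < e"
      unfolding limit_metric_sequentially by blast+
    then have "(\<lambda>n. mdist M (a n) l) \<longlonglongrightarrow> 0" by (intro LIMSEQ_I) simp
    with l(1) show ?thesis by blast
  qed
  obtain ul where ul: "ul \<in> mspace M" "(\<lambda>n. mdist M (u n) ul) \<longlonglongrightarrow> 0" using cauchy[OF uv(1) du] by blast
  obtain vl where vl: "vl \<in> mspace M" "(\<lambda>n. mdist M (v n) vl) \<longlonglongrightarrow> 0" using cauchy[OF uv(2) dv] by blast
  have lim: "(\<lambda>n. f (a n)) \<longlonglongrightarrow> f l"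
    if f: "lip M 1 f" and a: "\<And>n. a n \<in> mspace M" and l: "l \<in> mspace M" "(\<lambda>n. mdist M (a n) l) \<longlonglongrightarrow> 0" for f a l
  proof (rule LIM_zero_cancel, rule Lim_null_comparison[OF _ l(2)])
    show "\<forall>\<^sub>F n in sequentially. norm (f (a n) - f l) \<le> mdist M (a n) l"
      using lipD[OF f a l(1)] by simp
  qed
  have dipole: "(\<lambda>n. mdist M (u n) (v n)) \<longlonglongrightarrow> mdist M ul vl"
  proof (rule LIM_zero_cancel, rule Lim_null_comparison)
    show "(\<lambda>n. mdist M (u n) ul + mdist M (v n) vl) \<longlonglongrightarrow> 0"
      using tendsto_add[OF ul(2) vl(2)] by simp
    have "\<bar>mdist M (u n) (v n) - mdist M ul vl\<bar> \<le> mdist M (u n) ul + mdist M (v n) vl" for n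
      using lipD[OF lip_dist[OF uv(2)[of n]] uv(1)[of n] ul(1)]
        lipD[OF lip_dist'[OF ul(1)] uv(2)[of n] vl(1)] by linarith
    then show "\<forall>\<^sub>F n in sequentially. norm (mdist M (u n) (v n) - mdist M ul vl) \<le> mdist M (u n) ul + mdist M (v n) vl"
      by simp
  qed
  have "D / 2 \<le> mdist M ul vl" using lower by (intro tendsto_lowerbound[OF dipole]) auto
  then have pos: "mdist M ul vl > 0" using D by simp
  have "\<psi> = molecule M ul vl"
  proof (rule free_space_eqI[OF \<psi> molecule_free_space[OF ul(1) vl(1)]])
    fix f assume f: "lip M 1 f"
    have "(\<lambda>n. (f (u n) - f (v n)) / mdist M (u n) (v n)) \<longlonglongrightarrow> (f ul - f vl) / mdist M ul vl"
      using pos by (intro tendsto_divide tendsto_diff lim[OF f] uv ul vl dipole) auto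
    then have "(\<lambda>n. ?m n (lip_eval M f)) \<longlonglongrightarrow> molecule M ul vl (lip_eval M f)"
      by (simp add: molecule_lip_eval[OF _ _ f] uv ul vl)
    moreover have "(\<lambda>n. ?m n (lip_eval M f)) \<longlonglongrightarrow> \<psi> (lip_eval M f)"
    proof (rule LIM_zero_cancel, rule Lim_null_comparison[OF _ \<eta>0])
      have "\<bar>?m n (lip_eval M f) - \<psi> (lip_eval M f)\<bar> \<le> \<eta> n" for n
        using free_space_bound[OF seminormedD(7)[OF F \<psi> m[of n]] f] near[of n] by simp
      then show "\<forall>\<^sub>F n in sequentially. norm (?m n (lip_eval M f) - \<psi> (lip_eval M f)) \<le> \<eta> n" by simp
    qed
    ultimately show "\<psi> (lip_eval M f) = molecule M ul vl (lip_eval M f)" using LIMSEQ_unique by blast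
  qed
  moreover have "ul \<noteq> vl" using pos ul(1) by auto
  ultimately show ?thesis using that ul(1) vl(1) by blast
qed

text \<open>The slice of \<open>g\<close> contains the preimage of some molecule: otherwise the Lipschitz function
  that represents \<open>g \<circ> T\<inverse>\<close> would have all slopes at most \<open>1 - \<theta>\<close>, although its value at the unit vector
  \<open>T m\<^sub>x\<^sub>y\<close> is \<open>1\<close>.\<close>

lemma isometry_sharp_molecule:
  assumes comp: "mcomplete_of M" and T: "surj_linear_isometry (free_space M) T"
    and sh: "sharp_pair M x y"
  obtains u v where "u \<in> mspace M" "v \<in> mspace M" "u \<noteq> v" "T (molecule M x y) = molecule M u v"
proof -
  let ?V = "vecs (free_space M)"
  let ?e = "molecule M x y"
  note F = seminormed_free_space[of M]
  have xy: "x \<in> mspace M" "y \<in> mspace M" "x \<noteq> y" using sh by (auto simp: sharp_pair_def)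
  have D: "mdist M x y > 0" using mdist_pos[OF xy] .
  have e: "?e \<in> ?V" by (rule molecule_free_space[OF xy(1,2)])
  have S: "subspace ?V" using F by (simp add: seminormed_def)
  have lin: "linear_on ?V T" and TV: "\<And>\<psi>. \<psi> \<in> ?V \<Longrightarrow> T \<psi> \<in> ?V"
    and iso: "\<And>\<psi>. \<psi> \<in> ?V \<Longrightarrow> nrm (free_space M) (T \<psi>) = nrm (free_space M) \<psi>"
    using T by (auto simp: surj_linear_isometry_def)
  obtain T' where T': "surj_linear_isometry (free_space M) T'"
    and T'T: "\<And>\<psi>. \<psi> \<in> ?V \<Longrightarrow> T' (T \<psi>) = \<psi>" and TT': "\<And>\<psi>. \<psi> \<in> ?V \<Longrightarrow> T (T' \<psi>) = \<psi>"
    by (rule surj_linear_isometry_inverse[OF T]) blast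
  have lin': "linear_on ?V T'" and T'V: "\<And>\<psi>. \<psi> \<in> ?V \<Longrightarrow> T' \<psi> \<in> ?V"
    and iso': "\<And>\<psi>. \<psi> \<in> ?V \<Longrightarrow> nrm (free_space M) (T' \<psi>) = nrm (free_space M) \<psi>"
    using T' by (auto simp: surj_linear_isometry_def)
  have "\<exists>u\<in>mspace M. \<exists>v\<in>mspace M. u \<noteq> v \<and> nrm (free_space M) (T ?e - molecule M u v) \<le> \<eta>"
    if \<eta>: "\<eta> > 0" for \<eta>
  proof -
    obtain \<theta> g where \<theta>: "0 < \<theta>" "\<theta> \<le> 1 / 2" and g: "lip M 2 g" "g x - g y = mdist M x y"
      and slice: "\<And>\<nu> f. lip_functional M \<nu> \<Longrightarrow> 1 - \<theta> \<le> \<nu> g \<Longrightarrow> lip M 1 f \<Longrightarrow>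
        \<bar>\<nu> f - (f x - f y) / mdist M x y\<bar> \<le> \<eta>"
      by (rule sharp_pair_denting[OF sh \<eta>]) blast
    have "\<exists>u\<in>mspace M. \<exists>v\<in>mspace M. u \<noteq> v \<and> 1 - \<theta> \<le> T' (molecule M u v) (lip_eval M g)"
    proof (rule ccontr)
      assume "\<not> ?thesis"
      then have neg: "T' (molecule M u v) (lip_eval M g) < 1 - \<theta>"
        if "u \<in> mspace M" "v \<in> mspace M" "u \<noteq> v" for u v
        using that by (meson not_le)
      define G where "G = (\<lambda>\<psi>. T' \<psi> (lip_eval M g))"
      have "linear_on ?V G"
        using lin' by (simp add: G_def linear_on_def scaleR_apply)
      moreover have "\<bar>G \<psi>\<bar> \<le> 2 * nrm (free_space M) \<psi>" if "\<psi> \<in> ?V" for \<psi>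
        using free_space_bound[OF T'V[OF that] g(1)] iso'[OF that] by (simp add: G_def)
      ultimately obtain h where h: "lip M 2 h" "\<And>\<psi>. \<psi> \<in> ?V \<Longrightarrow> G \<psi> = \<psi> (lip_eval M h)"
        using free_space_functional_repr[of M G 2] by (metis zero_le_numeral)
      have less: "h u - h v \<le> (1 - \<theta>) * mdist M u v" if uv: "u \<in> mspace M" "v \<in> mspace M" for u v
      proof (cases "u = v")
        case False
        have "(h u - h v) / mdist M u v < 1 - \<theta>"
          using neg[OF uv False] h(2)[OF molecule_free_space[OF uv]] molecule_lip_eval[OF uv h(1)]
          by (simp add: G_def)
        then show ?thesis using mdist_pos[OF uv False] by (simp add: divide_less_eq)
      qed (use \<theta> in simp)
      have "lip M (1 - \<theta>) h"
      proof (rule lipI)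
        fix u v assume "u \<in> mspace M" "v \<in> mspace M"
        then show "\<bar>h u - h v\<bar> \<le> (1 - \<theta>) * mdist M u v"
          using less[of u v] less[of v u] by (simp add: mdist_commute abs_le_iff)
      qed
      then have "\<bar>T ?e (lip_eval M h)\<bar> \<le> (1 - \<theta>) * nrm (free_space M) (T ?e)"
        using \<theta> by (intro free_space_bound TV e) auto
      moreover have "nrm (free_space M) (T ?e) = 1" using iso[OF e] molecule_nrm_eq[OF xy] by simp
      moreover have "T ?e (lip_eval M h) = 1"
      proof -
        have "T ?e (lip_eval M h) = ?e (lip_eval M g)" using h(2)[OF TV[OF e]] T'T[OF e] by (simp add: G_def)
        also have "\<dots> = 1" using molecule_lip_eval[OF xy(1,2) g(1)] g(2) D by simp
        finally show ?thesis .
      qed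
      ultimately show False using \<theta> by simp
    qed
    then obtain u v where uv: "u \<in> mspace M" "v \<in> mspace M" "u \<noteq> v"
      and big: "1 - \<theta> \<le> T' (molecule M u v) (lip_eval M g)" by blast
    have m: "molecule M u v \<in> ?V" by (rule molecule_free_space[OF uv(1,2)])
    have ball: "T' (molecule M u v) \<in> unit_ball (free_space M)"
      using T'V[OF m] iso'[OF m] molecule_nrm[OF uv(1,2)] by (simp add: unit_ball_def)
    have "nrm (free_space M) (?e - T' (molecule M u v)) \<le> \<eta>"
    proof (rule free_space_nrm_le)
      show "?e - T' (molecule M u v) \<in> ?V" by (rule subspace_diff[OF S e T'V[OF m]])
      fix f assume f: "lip M 1 f"
      show "\<bar>(?e - T' (molecule M u v)) (lip_eval M f)\<bar> \<le> \<eta>"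
        using slice[OF lip_functional_free_space[OF ball] big f] molecule_lip_eval[OF xy(1,2) f]
        by (simp add: abs_minus_commute)
    qed (use \<eta> in simp)
    moreover have "T (?e - T' (molecule M u v)) = T ?e - molecule M u v"
      using linear_on_diff[OF lin S e T'V[OF m]] TT'[OF m] by simp
    ultimately have "nrm (free_space M) (T ?e - molecule M u v) \<le> \<eta>"
      using iso[OF subspace_diff[OF S e T'V[OF m]]] by simp
    with uv show ?thesis by blast
  qed
  from molecules_closed[OF comp TV[OF e] this] that show ?thesis by blast
qed

section \<open>Linear maps that respect the edges of a 3-connected graph\<close>

abbreviation dipoles :: "('a \<times> 'a) set \<Rightarrow> ('a \<Rightarrow> real) set" where
  "dipoles R \<equiv> (\<lambda>(a, b). dipole a b) ` R"

lemma dipoles_span_subset: "R \<subseteq> A \<times> A \<Longrightarrow> span (dipoles R) \<subseteq> zero_sum A"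
  by (rule span_minimal[OF _ subspace_zero_sum]) (auto intro!: dipole_zero_sum)

text \<open>A path from \<open>a\<close> to \<open>b\<close> telescopes to \<open>\<delta>\<^sub>a - \<delta>\<^sub>b\<close>.\<close>

lemma zero_sum_span:
  assumes "connected_graph A R"
  shows "zero_sum A = span (dipoles (R \<inter> A \<times> A))"
proof
  let ?W = "span (dipoles (R \<inter> A \<times> A))"
  have path: "dipole a b \<in> ?W" if "(a, b) \<in> (R \<inter> A \<times> A)\<^sup>*" for a b
    using that
  proof (induction rule: rtrancl_induct)
    case base
    show ?case unfolding dipole_self by (rule span_zero)
  next
    case (step y z)
    have "dipole y z \<in> ?W" using step(2) by (intro span_base) force
    from span_add[OF step(3) this] show ?case by (simp add: dipole_add)
  qed
  show "zero_sum A \<subseteq> ?W"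
  proof
    fix x assume x: "x \<in> zero_sum A"
    show "x \<in> ?W"
    proof (cases "A = {}")
      case True
      then have "x = 0" using x by (intro zero_sum_disjoint[of x A A]) auto
      then show ?thesis by (simp add: span_zero)
    next
      case False
      then obtain b where b: "b \<in> A" by blast
      have "x = (\<Sum>m | x m \<noteq> 0. x m *\<^sub>R dipole m b)"
        using x by (intro dipole_decomp) (auto simp: zero_sum_def)
      also have "\<dots> \<in> ?W"
      proof (intro span_sum span_scale path)
        fix m assume "m \<in> {m. x m \<noteq> 0}"
        then have "m \<in> A" using x by (auto simp: zero_sum_def)
        then show "(m, b) \<in> (R \<inter> A \<times> A)\<^sup>*" using assms b by (auto simp: connected_graph_def)
      qed
      finally show ?thesis .
    qed
  qed
  show "?W \<subseteq> zero_sum A" by (rule dipoles_span_subset) auto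
qed

text \<open>Let \<open>R\<close> be the graph of the images of the edges avoiding \<open>v\<close>, and \<open>A\<close> one of its components that
  contains an edge. Each edge avoiding \<open>v\<close> has its image inside \<open>A\<close> or inside the complement of \<open>A\<close>. As
  the graph without \<open>v\<close> is connected, edges of both kinds would meet at some vertex \<open>u\<close>, which
  \<open>no_mixed\<close> excludes. So all images lie inside \<open>A\<close>, the image of the hyperplane is \<open>zero_sum A\<close>, and
  its codimension one leaves exactly one vertex outside \<open>A\<close>.\<close>

lemma vertex_hyperplane_image:
  assumes tc: "three_connected_graph V E" and symE: "sym E"
    and irr: "\<And>x y. (x, y) \<in> E \<Longrightarrow> x \<noteq> y"
    and big: "\<And>a b. \<exists>y\<in>V. y \<noteq> a \<and> y \<noteq> b"
    and lin: "linear_on (zero_sum V) S" and surS: "S ` zero_sum V = zero_sum V"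
    and inj: "inj_on S (zero_sum V)"
    and edge: "\<And>x y. (x, y) \<in> E \<Longrightarrow> x \<in> V \<Longrightarrow> y \<in> V \<Longrightarrow>
        \<exists>u\<in>V. \<exists>w\<in>V. \<exists>c. c \<noteq> 0 \<and> u \<noteq> w \<and> S (dipole x y) = c *\<^sub>R dipole u w"
    and v: "v \<in> V"
  shows "\<exists>w\<in>V. S ` zero_sum (V - {v}) = zero_sum (V - {w})"
proof -
  note Z = subspace_zero_sum[of V]
  define V0 where "V0 = V - {v}"
  have V0: "V0 \<subseteq> V" "v \<notin> V0" by (auto simp: V0_def)
  have conn: "connected_graph (V - {v, u}) E" if "u \<in> V" for u
    using tc v that card_insert_le_m1[of 2 "{u}" v] unfolding three_connected_graph_def by auto
  have conn0: "connected_graph V0 E" using conn[OF v] by (simp add: V0_def)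
  define K where "K = (\<lambda>B. {x \<in> zero_sum V. S x \<in> zero_sum B})"
  have subK: "subspace (K B)" for B
    unfolding K_def using lin Z subspace_zero_sum[of B]
    by (intro subspaceI) (auto simp: linear_on_0[OF lin Z] linear_onD[OF lin] subspace_0 subspace_add subspace_scale)
  define E0 where "E0 = E \<inter> V0 \<times> V0"
  have symE0: "(y, x) \<in> E0" if "(x, y) \<in> E0" for x y
    using that symE by (auto simp: E0_def dest: symD)
  define R where "R = {(u, w). u \<in> V \<and> w \<in> V \<and> u \<noteq> w \<and> (\<exists>x y c. (x, y) \<in> E0 \<and> c \<noteq> 0 \<and> S (dipole x y) = c *\<^sub>R dipole u w)}"
  have RI: "\<exists>u w c. (u, w) \<in> R \<and> c \<noteq> 0 \<and> S (dipole x y) = c *\<^sub>R dipole u w" if "(x, y) \<in> E0" for x y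
    using edge[of x y] that V0 unfolding R_def E0_def by blast
  have symR: "sym R"
  proof (rule symI)
    fix u w assume "(u, w) \<in> R"
    then obtain x y c where *: "u \<in> V" "w \<in> V" "u \<noteq> w" "(x, y) \<in> E0" "c \<noteq> 0" "S (dipole x y) = c *\<^sub>R dipole u w"
      by (auto simp: R_def)
    then have "S (dipole x y) = (- c) *\<^sub>R dipole w u" by (simp flip: dipole_minus[of u w])
    with * show "(w, u) \<in> R" unfolding R_def by (blast intro: neg_equal_0_iff_equal[THEN iffD1])
  qed
  obtain a where a: "a \<in> V0" using big[of v v] by (auto simp: V0_def)
  obtain b where b: "b \<in> V0" "b \<noteq> a" using big[of v a] by (auto simp: V0_def)
  have "(a, b) \<in> E0\<^sup>*" using conn0 a b by (simp add: connected_graph_def E0_def)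
  then obtain a' where e0: "(a, a') \<in> E0" using b(2) by (metis converse_rtranclE)
  then obtain u0 w0 c0 where r0: "(u0, w0) \<in> R" "S (dipole a a') = c0 *\<^sub>R dipole u0 w0" using RI by metis
  define A where "A = R\<^sup>* `` {u0}"
  have RV: "R \<subseteq> V \<times> V" by (auto simp: R_def)
  have u0: "u0 \<in> A" "w0 \<in> A" "u0 \<in> V" using r0 RV by (auto simp: A_def)
  have AV: "A \<subseteq> V"
  proof
    fix t assume "t \<in> A"
    then have "(u0, t) \<in> R\<^sup>*" by (simp add: A_def)
    then show "t \<in> V" by (induction rule: rtrancl_induct) (use u0 RV in auto)
  qed
  have step: "w \<in> A" if "u \<in> A" "(u, w) \<in> R" for u w
    using that by (auto simp: A_def intro: rtrancl_into_rtrancl)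
  have E0V: "dipole x y \<in> zero_sum V" if "(x, y) \<in> E0" for x y
    using that V0 by (auto simp: E0_def intro!: dipole_zero_sum)
  have side: "dipole x y \<in> K A \<or> dipole x y \<in> K (V - A)" if xy: "(x, y) \<in> E0" for x y
  proof -
    obtain u w c where uw: "(u, w) \<in> R" "S (dipole x y) = c *\<^sub>R dipole u w" using RI[OF xy] by blast
    have "u \<in> A \<longleftrightarrow> w \<in> A" using step[OF _ uw(1)] step[OF _ symD[OF symR uw(1)]] by blast
    then have "u \<in> A \<and> w \<in> A \<or> u \<in> V - A \<and> w \<in> V - A" using uw(1) RV by auto
    then show ?thesis
      using uw(2) E0V[OF xy] by (auto simp: K_def intro!: subspace_scale[OF subspace_zero_sum] dipole_zero_sum)
  qed
  \<comment> \<open>\<open>\<delta>\<^sub>u - \<delta>\<^sub>y\<^sub>1\<close>, a combination \<open>p1 + p2 = \<delta>\<^sub>y\<^sub>1 - \<delta>\<^sub>y\<^sub>2\<close> of edges avoiding \<open>u\<close> and \<open>v\<close>, and \<open>\<delta>\<^sub>y\<^sub>2 - \<delta>\<^sub>u\<close> sum to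
    zero; grouped by kind, both parts have disjointly supported images and vanish, but the first one is
    \<open>1\<close> at \<open>u\<close>\<close>
  have no_mixed: False if m: "(u, y1) \<in> E0" "(u, y2) \<in> E0" "dipole u y1 \<in> K A" "dipole u y2 \<in> K (V - A)" for u y1 y2
  proof -
    let ?U = "V - {v, u}"
    have u: "u \<in> V" "y1 \<in> ?U" "y2 \<in> ?U" using m irr by (auto simp: E0_def V0_def)
    let ?Y = "\<lambda>B. {(x, y) \<in> E \<inter> ?U \<times> ?U. dipole x y \<in> K B}"
    have "E \<inter> ?U \<times> ?U \<subseteq> ?Y A \<union> ?Y (V - A)"
      using side by (auto simp: E0_def V0_def)
    then have "dipoles (E \<inter> ?U \<times> ?U) \<subseteq> dipoles (?Y A) \<union> dipoles (?Y (V - A))" by blast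
    then have "zero_sum ?U \<subseteq> span (dipoles (?Y A) \<union> dipoles (?Y (V - A)))"
      unfolding zero_sum_span[OF conn[OF u(1)]] by (rule span_mono)
    moreover have "dipole y1 y2 \<in> zero_sum ?U" using u by (intro dipole_zero_sum)
    ultimately obtain p1 p2 where p: "dipole y1 y2 = p1 + p2"
      "p1 \<in> span (dipoles (?Y A))" "p2 \<in> span (dipoles (?Y (V - A)))"
      unfolding span_Un by blast
    have "span (dipoles (?Y B)) \<subseteq> K B" for B by (rule span_minimal[OF _ subK]) auto
    with p have pK: "p1 \<in> K A" "p2 \<in> K (V - A)" by blast+
    have p1u: "p1 u = 0"
    proof -
      have "span (dipoles (?Y A)) \<subseteq> zero_sum ?U" by (rule dipoles_span_subset) auto
      with p(2) have "p1 \<in> zero_sum ?U" by blast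
      then show ?thesis by (rule zero_sum_outside) simp
    qed
    have q1: "dipole u y1 + p1 \<in> K A" by (rule subspace_add[OF subK m(3) pK(1)])
    have q2: "p2 - dipole u y2 \<in> K (V - A)" by (rule subspace_diff[OF subK pK(2) m(4)])
    have "dipole u y1 + dipole y1 y2 - dipole u y2 = 0" by (auto simp: dipole_def)
    then have q: "dipole u y1 + p1 + (p2 - dipole u y2) = 0" by (simp add: p(1) algebra_simps)
    then have "S (dipole u y1 + p1) + S (p2 - dipole u y2) = 0"
      using linear_onD(1)[OF lin, of "dipole u y1 + p1" "p2 - dipole u y2"] q1 q2
      by (simp add: K_def linear_on_0[OF lin Z])
    then have "S (dipole u y1 + p1) = - S (p2 - dipole u y2)" by (simp add: eq_neg_iff_add_eq_0)
    moreover have "S (p2 - dipole u y2) \<in> zero_sum (V - A)" using q2 by (simp add: K_def)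
    ultimately have "S (dipole u y1 + p1) \<in> zero_sum (V - A)"
      by (metis subspace_neg[OF subspace_zero_sum])
    then have "S (dipole u y1 + p1) = 0" using q1 by (intro zero_sum_disjoint[of _ A "V - A"]) (auto simp: K_def)
    then have "dipole u y1 + p1 = 0"
      using inj_onD[OF inj, of "dipole u y1 + p1" 0] q1 subspace_0[OF Z] by (simp add: K_def linear_on_0[OF lin Z])
    then have "(dipole u y1 + p1) u = 0" by simp
    then show False using p1u u by (auto simp: dipole_def)
  qed
  have allA: "dipole x y \<in> K A" if xy: "(x, y) \<in> E0" for x y
  proof (rule ccontr)
    assume "dipole x y \<notin> K A"
    then have K2: "dipole x y \<in> K (V - A)" using side[OF xy] by blast
    have "x \<in> V0" using xy by (auto simp: E0_def)
    then have "(a, x) \<in> E0\<^sup>*" using conn0 a by (simp add: connected_graph_def E0_def)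
    then have "\<exists>t. (x, t) \<in> E0 \<and> dipole x t \<in> K A"
    proof (induction rule: rtrancl_induct)
      case base
      have "dipole a a' \<in> K A"
        using r0(2) u0 E0V[OF e0] by (auto simp: K_def intro!: subspace_scale[OF subspace_zero_sum] dipole_zero_sum)
      with e0 show ?case by blast
    next
      case (step y z)
      then have "dipole y z \<in> K A" using side[OF step(2)] no_mixed[OF _ step(2)] by blast
      then have "dipole z y \<in> K A" using subspace_neg[OF subK] dipole_minus[of y z] by metis
      with symE0[OF step(2)] show ?case by blast
    qed
    with no_mixed[OF _ xy _ K2] show False by blast
  qed
  have image: "S ` zero_sum V0 = zero_sum A"
  proof
    have "zero_sum V0 \<subseteq> K A"
      unfolding zero_sum_span[OF conn0] using allA
      by (intro span_minimal[OF _ subK]) (auto simp: E0_def)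
    then show "S ` zero_sum V0 \<subseteq> zero_sum A" by (auto simp: K_def)
    have V0Z: "zero_sum V0 \<subseteq> zero_sum V" by (rule zero_sum_mono[OF V0(1)])
    have subI: "subspace (S ` zero_sum V0)"
    proof (rule subspaceI)
      show "0 \<in> S ` zero_sum V0"
        using linear_on_0[OF lin Z] subspace_0[OF subspace_zero_sum] by (metis imageI)
      show "x + y \<in> S ` zero_sum V0" if "x \<in> S ` zero_sum V0" "y \<in> S ` zero_sum V0" for x y
      proof -
        obtain x' y' where *: "x = S x'" "y = S y'" "x' \<in> zero_sum V0" "y' \<in> zero_sum V0"
          using \<open>x \<in> S ` zero_sum V0\<close> \<open>y \<in> S ` zero_sum V0\<close> by blast
        have "x + y = S (x' + y')" using linear_onD(1)[OF lin] V0Z * by (simp add: subset_iff)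
        then show ?thesis using subspace_add[OF subspace_zero_sum *(3,4)] by blast
      qed
      show "r *\<^sub>R x \<in> S ` zero_sum V0" if "x \<in> S ` zero_sum V0" for r x
      proof -
        obtain x' where *: "x = S x'" "x' \<in> zero_sum V0" using \<open>x \<in> S ` zero_sum V0\<close> by blast
        have "r *\<^sub>R x = S (r *\<^sub>R x')" using linear_onD(2)[OF lin] V0Z * by (simp add: subset_iff)
        then show ?thesis using subspace_scale[OF subspace_zero_sum *(2)] by blast
      qed
    qed
    have reach: "(u0, t) \<in> (R \<inter> A \<times> A)\<^sup>*" if "t \<in> A" for t
    proof -
      have "(u0, t) \<in> R\<^sup>*" using that by (simp add: A_def)
      then show ?thesis
      proof (induction rule: rtrancl_induct)
        case (step y z)
        then have "y \<in> A" by (simp add: A_def)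
        then have "(y, z) \<in> R \<inter> A \<times> A" using step(2) \<open>\<And>u w. u \<in> A \<Longrightarrow> (u, w) \<in> R \<Longrightarrow> w \<in> A\<close> by blast
        with step(3) show ?case by (rule rtrancl_into_rtrancl)
      qed simp
    qed
    have "sym (R \<inter> A \<times> A)" using symR by (auto simp: sym_def)
    then have "connected_graph A R"
      unfolding connected_graph_def using reach sym_rtrancl by (meson rtrancl_trans symD)
    then have "zero_sum A = span (dipoles (R \<inter> A \<times> A))" by (rule zero_sum_span)
    also have "\<dots> \<subseteq> S ` zero_sum V0"
    proof (rule span_minimal[OF _ subI])
      show "dipoles (R \<inter> A \<times> A) \<subseteq> S ` zero_sum V0"
      proof clarify
        fix u w assume "(u, w) \<in> R"
        then obtain x y c where *: "(x, y) \<in> E0" "c \<noteq> 0" "S (dipole x y) = c *\<^sub>R dipole u w"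
          by (auto simp: R_def)
        have "dipole x y \<in> zero_sum V0" using *(1) by (auto simp: E0_def intro!: dipole_zero_sum)
        then have "(1 / c) *\<^sub>R S (dipole x y) \<in> S ` zero_sum V0" by (intro subspace_scale[OF subI]) blast
        then show "dipole u w \<in> S ` zero_sum V0" using * by simp
      qed
    qed
    finally show "zero_sum A \<subseteq> S ` zero_sum V0" .
  qed
  have "A \<noteq> V"
  proof
    assume "A = V"
    then have "S ` zero_sum V0 = S ` zero_sum V" by (simp only: image surS)
    then have "zero_sum V0 = zero_sum V"
      by (rule inj_on_image_eq_iff[OF inj zero_sum_mono[OF V0(1)] subset_refl, THEN iffD1])
    moreover have "dipole v a \<in> zero_sum V" using v a V0 by (intro dipole_zero_sum) auto
    ultimately have "dipole v a \<in> zero_sum V0" by (simp only:)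
    then have "dipole v a v = 0" by (rule zero_sum_outside) (rule V0(2))
    moreover have "v \<noteq> a" using a V0(2) by auto
    ultimately show False by (simp add: dipole_def)
  qed
  then obtain w where w: "w \<in> V" "w \<notin> A" using AV by blast
  have "w' = w" if w': "w' \<in> V" "w' \<notin> A" for w'
  proof (rule ccontr)
    assume ne: "w' \<noteq> w"
    define q where "q = S (dipole v a)"
    have va: "dipole v a \<in> zero_sum V" "v \<noteq> a" using v a V0 by (auto intro!: dipole_zero_sum)
    \<comment> \<open>modulo \<open>zero_sum A\<close>, every image is a multiple of the single function \<open>q\<close>, so the values at two
      points outside \<open>A\<close> are proportional, which fails for \<open>\<delta>\<^sub>w - \<delta>\<^sub>u\<^sub>0\<close> and \<open>\<delta>\<^sub>w\<^sub>' - \<delta>\<^sub>u\<^sub>0\<close>\<close>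
    have coord: "\<exists>k. \<forall>t\<in>V - A. dipole z u0 t = k * q t" if z: "z \<in> V" for z
    proof -
      have "dipole z u0 \<in> S ` zero_sum V" unfolding surS using z u0 by (intro dipole_zero_sum)
      then obtain k where k: "k \<in> zero_sum V" "dipole z u0 = S k" by blast
      define t where "t = k - k v *\<^sub>R dipole v a"
      have tV: "t \<in> zero_sum V" unfolding t_def
        by (intro subspace_diff[OF Z] subspace_scale[OF Z] k va)
      have "t v = 0" using va by (simp add: t_def scaleR_fun_def dipole_def)
      then have "t \<in> zero_sum V0" using tV by (intro zero_sum_restrict[OF tV]) (auto simp: V0_def)
      then have "S t \<in> S ` zero_sum V0" by (rule imageI)
      then have St: "S t \<in> zero_sum A" by (simp only: image)
      have "S k = S (k v *\<^sub>R dipole v a + t)" by (simp add: t_def)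
      also have "\<dots> = k v *\<^sub>R q + S t"
        using linear_onD[OF lin] subspace_scale[OF Z va(1), of "k v"] va tV by (simp add: q_def)
      finally have "dipole z u0 = k v *\<^sub>R q + S t" using k(2) by simp
      then have "dipole z u0 t' = k v * q t'" if "t' \<in> V - A" for t'
        using zero_sum_outside[OF St, of t'] that by (simp add: scaleR_fun_def)
      then show ?thesis by blast
    qed
    obtain k k' where k: "\<forall>t\<in>V - A. dipole w u0 t = k * q t" "\<forall>t\<in>V - A. dipole w' u0 t = k' * q t"
      using coord w(1) w'(1) by metis
    have "w \<noteq> u0" "w' \<noteq> u0" using w w' u0 by auto
    then have "dipole w u0 w = 1" "dipole w u0 w' = 0" "dipole w' u0 w' = 1" using ne by (simp_all add: dipole_def)
    then have "k * q w = 1" "k * q w' = 0" "k' * q w' = 1" using k w w' by auto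
    then show False by auto
  qed
  then have "A = V - {w}" using AV w by blast
  then show ?thesis using image w(1) unfolding V0_def by blast
qed

text \<open>The vertex \<open>g v\<close> is the one omitted by the image of the hyperplane of \<open>v\<close>. Since \<open>\<delta>\<^sub>x - \<delta>\<^sub>y\<close> lies in the
  hyperplanes of all vertices other than \<open>x\<close> and \<open>y\<close>, its image is supported on \<open>g x\<close> and \<open>g y\<close>. The
  relation of a triangle forces the three factors to agree, and any two pairs of points are
  linked by triangles.\<close>

theorem three_connected_linear_rigidity:
  assumes tc: "three_connected_graph V E" and symE: "sym E"
    and irr: "\<And>x y. (x, y) \<in> E \<Longrightarrow> x \<noteq> y"
    and big: "\<And>a b. \<exists>y\<in>V. y \<noteq> a \<and> y \<noteq> b"
    and lin: "linear_on (zero_sum V) S" "linear_on (zero_sum V) S'"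
    and maps: "S ` zero_sum V \<subseteq> zero_sum V" "S' ` zero_sum V \<subseteq> zero_sum V"
    and inv: "\<And>x. x \<in> zero_sum V \<Longrightarrow> S' (S x) = x" "\<And>x. x \<in> zero_sum V \<Longrightarrow> S (S' x) = x"
    and edge: "\<And>x y. (x, y) \<in> E \<Longrightarrow> x \<in> V \<Longrightarrow> y \<in> V \<Longrightarrow>
        \<exists>u\<in>V. \<exists>w\<in>V. \<exists>c. c \<noteq> 0 \<and> u \<noteq> w \<and> S (dipole x y) = c *\<^sub>R dipole u w"
      "\<And>x y. (x, y) \<in> E \<Longrightarrow> x \<in> V \<Longrightarrow> y \<in> V \<Longrightarrow>
        \<exists>u\<in>V. \<exists>w\<in>V. \<exists>c. c \<noteq> 0 \<and> u \<noteq> w \<and> S' (dipole x y) = c *\<^sub>R dipole u w"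
  obtains g c where "bij_betw g V V" "c \<noteq> 0"
    "\<And>x y. x \<in> V \<Longrightarrow> y \<in> V \<Longrightarrow> S (dipole x y) = c *\<^sub>R dipole (g x) (g y)"
proof -
  note Z = subspace_zero_sum[of V]
  have sur: "S ` zero_sum V = zero_sum V" "S' ` zero_sum V = zero_sum V"
    using maps inv by (auto simp: image_iff) (metis image_subset_iff)+
  have inj: "inj_on S (zero_sum V)" "inj_on S' (zero_sum V)"
    using inv by (metis inj_onI)+
  have "\<forall>v. \<exists>w. v \<in> V \<longrightarrow> w \<in> V \<and> S ` zero_sum (V - {v}) = zero_sum (V - {w})"
    using vertex_hyperplane_image[OF tc symE irr big lin(1) sur(1) inj(1) edge(1)] by blast
  then obtain g where g: "\<And>v. v \<in> V \<Longrightarrow> g v \<in> V" "\<And>v. v \<in> V \<Longrightarrow> S ` zero_sum (V - {v}) = zero_sum (V - {g v})"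
    by metis
  have "\<forall>v. \<exists>w. v \<in> V \<longrightarrow> w \<in> V \<and> S' ` zero_sum (V - {v}) = zero_sum (V - {w})"
    using vertex_hyperplane_image[OF tc symE irr big lin(2) sur(2) inj(2) edge(2)] by blast
  then obtain g' where g': "\<And>v. v \<in> V \<Longrightarrow> g' v \<in> V" "\<And>v. v \<in> V \<Longrightarrow> S' ` zero_sum (V - {v}) = zero_sum (V - {g' v})"
    by metis
  have uniq: "v = w" if "v \<in> V" "w \<in> V" "zero_sum (V - {v}) = zero_sum (V - {w})" for v w
  proof (rule ccontr)
    assume "v \<noteq> w"
    obtain y where "y \<in> V" "y \<noteq> v" "y \<noteq> w" using big by blast
    then have "dipole v y \<in> zero_sum (V - {w})"
      using that(1) \<open>v \<noteq> w\<close> by (intro dipole_zero_sum) auto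
    then have "dipole v y \<in> zero_sum (V - {v})" by (simp only: that(3))
    then have "dipole v y v = 0" by (rule zero_sum_outside) simp
    then show False using \<open>y \<noteq> v\<close> by (simp add: dipole_def)
  qed
  have sub: "zero_sum (V - {v}) \<subseteq> zero_sum V" for v by (rule zero_sum_mono) auto
  have gg: "g' (g v) = v" if v: "v \<in> V" for v
  proof (rule uniq[symmetric])
    have "zero_sum (V - {v}) = S' ` S ` zero_sum (V - {v})"
      using inv(1) sub[of v] by (force simp: image_image)
    also have "\<dots> = zero_sum (V - {g' (g v)})" using g v g' by simp
    finally show "zero_sum (V - {v}) = zero_sum (V - {g' (g v)})" .
  qed (use g g' v in auto)
  have gg': "g (g' v) = v" if v: "v \<in> V" for v
  proof (rule uniq[symmetric])
    have "zero_sum (V - {v}) = S ` S' ` zero_sum (V - {v})"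
      using inv(2) sub[of v] by (force simp: image_image)
    also have "\<dots> = zero_sum (V - {g (g' v)})" using g v g' by simp
    finally show "zero_sum (V - {v}) = zero_sum (V - {g (g' v)})" .
  qed (use g g' v in auto)
  have bij: "bij_betw g V V"
    by (rule bij_betw_byWitness[where f' = g']) (use gg gg' g g' in auto)
  have ginj: "g x \<noteq> g y" if "x \<in> V" "y \<in> V" "x \<noteq> y" for x y
    using gg that by metis
  have coef: "S (dipole x y) = S (dipole x y) (g x) *\<^sub>R dipole (g x) (g y)" if xy: "x \<in> V" "y \<in> V" "x \<noteq> y" for x y
  proof (rule zero_sum_pair, rule zero_sum_restrict)
    have dV: "dipole x y \<in> zero_sum V" using xy by (intro dipole_zero_sum)
    then show "S (dipole x y) \<in> zero_sum V" using maps(1) by blast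
    fix m assume m: "m \<in> V - {g x, g y}"
    define v where "v = g' m"
    have v: "v \<in> V" "g v = m" "v \<noteq> x" "v \<noteq> y" using m g' gg' by (auto simp: v_def)
    then have "dipole x y \<in> zero_sum (V - {v})" using xy by (intro dipole_zero_sum) auto
    then have "S (dipole x y) \<in> zero_sum (V - {m})" using g(2)[OF v(1)] v(2) by blast
    then show "S (dipole x y) m = 0" by (rule zero_sum_outside) simp
  qed
  define k where "k = (\<lambda>x y. S (dipole x y) (g x))"
  have k: "S (dipole x y) = k x y *\<^sub>R dipole (g x) (g y)" if "x \<in> V" "y \<in> V" "x \<noteq> y" for x y
    using coef[OF that] by (simp add: k_def)
  have tri: "k x z = k x y" "k x z = k y z"
    if xyz: "x \<in> V" "y \<in> V" "z \<in> V" "x \<noteq> y" "y \<noteq> z" "x \<noteq> z" for x y z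
  proof -
    have "S (dipole x z) = S (dipole x y) + S (dipole y z)"
      using linear_onD(1)[OF lin(1), of "dipole x y" "dipole y z"] xyz by (simp add: dipole_zero_sum dipole_add)
    then have eq: "k x z *\<^sub>R dipole (g x) (g z) = k x y *\<^sub>R dipole (g x) (g y) + k y z *\<^sub>R dipole (g y) (g z)"
      using k xyz by simp
    have ne: "g x \<noteq> g y" "g y \<noteq> g z" "g x \<noteq> g z" using ginj xyz by auto
    show "k x z = k x y" using fun_cong[OF eq, of "g x"] ne by (simp add: scaleR_fun_def dipole_def)
    show "k x z = k y z" using fun_cong[OF eq, of "g z"] ne by (simp add: scaleR_fun_def dipole_def)
  qed
  obtain x0 where x0: "x0 \<in> V" using big by blast
  obtain y0 where y0: "y0 \<in> V" "y0 \<noteq> x0" using big by blast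
  define c where "c = k x0 y0"
  have k0: "k x0 y = c" if "y \<in> V" "y \<noteq> x0" for y
    using tri(1)[of x0 y0 y] that x0 y0 by (cases "y = y0") (auto simp: c_def)
  have kc: "k x y = c" if xy: "x \<in> V" "y \<in> V" "x \<noteq> y" for x y
  proof (cases "x = x0")
    case True
    then show ?thesis using k0 xy by auto
  next
    case False
    show ?thesis
    proof (cases "y = x0")
      case False
      then show ?thesis using tri(2)[of x x0 y] \<open>x \<noteq> x0\<close> xy x0 k0 by auto
    next
      case True
      obtain z where z: "z \<in> V" "z \<noteq> x" "z \<noteq> x0" using big by blast
      have "k x z = c" using tri(2)[of x x0 z] \<open>x \<noteq> x0\<close> xy x0 z k0 by auto
      then show ?thesis using tri(1)[of x z x0] True z xy x0 by auto
    qed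
  qed
  have "c \<noteq> 0"
  proof
    assume "c = 0"
    then have "S (dipole x0 y0) = 0" using k[OF x0 y0(1)] y0 by (simp add: c_def)
    then have "S' (S (dipole x0 y0)) = 0" using linear_on_0[OF lin(2) Z] by simp
    then have "dipole x0 y0 x0 = 0" using inv(1)[OF dipole_zero_sum[OF x0 y0(1)]] by simp
    then show False using y0 by (simp add: dipole_def)
  qed
  moreover have "S (dipole x y) = c *\<^sub>R dipole (g x) (g y)" if "x \<in> V" "y \<in> V" for x y
    using k[OF that] kc[OF that] linear_on_0[OF lin(1) Z] by (cases "x = y") (auto simp: dipole_self)
  ultimately show ?thesis using that bij by blast
qed

section \<open>Rigidity of spaces with a 3-connected graph\<close>

lemma sharp_pair_sym: "sharp_pair M x y \<Longrightarrow> sharp_pair M y x"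
  unfolding sharp_pair_def by (simp add: mdist_commute min.commute add.commute) (metis mdist_commute)

lemma sym_E_ext: "sym (E_ext M)"
  by (rule symI) (simp add: E_ext_iff_sharp_pair sharp_pair_sym)

lemma embed_dipole:
  assumes "x \<in> mspace M" "y \<in> mspace M" "x \<noteq> y"
  shows "bidual_embed (free0 M) (dipole x y) = mdist M x y *\<^sub>R molecule M x y"
  using mdist_pos[OF assms] by (simp add: molecule_dipole assms)

text \<open>The zero-sum functions are spanned by the edges, whose images are multiples of dipoles. So \<open>T\<close> induces
  a linear map on zero-sum functions, without completion.\<close>

lemma isometry_preserves_free0:
  assumes comp: "mcomplete_of M" and T: "surj_linear_isometry (free_space M) T"
    and conn: "connected_graph (mspace M) (E_ext M)"
  obtains S where "linear_on (zero_sum (mspace M)) S" "S ` zero_sum (mspace M) \<subseteq> zero_sum (mspace M)"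
    "\<And>w. w \<in> zero_sum (mspace M) \<Longrightarrow> bidual_embed (free0 M) (S w) = T (bidual_embed (free0 M) w)"
    "\<And>x y. (x, y) \<in> E_ext M \<Longrightarrow>
       \<exists>u\<in>mspace M. \<exists>v\<in>mspace M. \<exists>c. c \<noteq> 0 \<and> u \<noteq> v \<and> S (dipole x y) = c *\<^sub>R dipole u v"
proof -
  let ?Z = "zero_sum (mspace M)"
  let ?e = "bidual_embed (free0 M)"
  note Z = subspace_zero_sum[of "mspace M"]
  have lin: "linear_on (vecs (free_space M)) T" using T by (simp add: surj_linear_isometry_def)
  have eV: "?e w \<in> vecs (free_space M)" if "w \<in> ?Z" for w
    using that by (intro embed_free_space) (simp add: vecs_free0)
  have e_add: "?e (v + w) = ?e v + ?e w" if "v \<in> ?Z" "w \<in> ?Z" for v w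
    using bidual_embed_add[of v "free0 M" w] that by (simp add: vecs_free0)
  have e_scale: "?e (r *\<^sub>R w) = r *\<^sub>R ?e w" if "w \<in> ?Z" for r w
    using bidual_embed_scaleR[of w "free0 M" r] that by (simp add: vecs_free0)
  have inj: "inj_on ?e ?Z" using embed_inj[of M] by (simp add: vecs_free0)
  have edge: "\<exists>u\<in>mspace M. \<exists>v\<in>mspace M. \<exists>c. c \<noteq> 0 \<and> u \<noteq> v \<and> T (?e (dipole x y)) = ?e (c *\<^sub>R dipole u v)"
    if xy: "(x, y) \<in> E_ext M" for x y
  proof -
    have m: "x \<in> mspace M" "y \<in> mspace M" "x \<noteq> y" using E_ext_vertices[OF xy] by auto
    obtain u v where uv: "u \<in> mspace M" "v \<in> mspace M" "u \<noteq> v" "T (molecule M x y) = molecule M u v"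
      using isometry_sharp_molecule[OF comp T] xy unfolding E_ext_iff_sharp_pair by blast
    have "T (?e (dipole x y)) = mdist M x y *\<^sub>R molecule M u v"
      unfolding embed_dipole[OF m] linear_onD(2)[OF lin molecule_free_space[OF m(1,2)]] uv(4) ..
    also have "\<dots> = ?e ((mdist M x y / mdist M u v) *\<^sub>R dipole u v)"
      unfolding e_scale[OF dipole_zero_sum[OF uv(1,2)]] molecule_dipole[OF uv(1,2)] by simp
    finally have "T (?e (dipole x y)) = ?e ((mdist M x y / mdist M u v) *\<^sub>R dipole u v)" .
    moreover have "mdist M x y / mdist M u v \<noteq> 0" using mdist_pos[OF m] mdist_pos[OF uv(1-3)] by simp
    ultimately show ?thesis using uv(1-3) by blast
  qed
  have "?Z \<subseteq> {w \<in> ?Z. T (?e w) \<in> ?e ` ?Z}"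
    unfolding zero_sum_span[OF conn]
  proof (rule span_minimal)
    show "dipoles (E_ext M \<inter> mspace M \<times> mspace M) \<subseteq> {w \<in> span (dipoles (E_ext M \<inter> mspace M \<times> mspace M)).
        T (?e w) \<in> ?e ` span (dipoles (E_ext M \<inter> mspace M \<times> mspace M))}"
    proof clarify
      fix x y assume xy: "(x, y) \<in> E_ext M" "x \<in> mspace M" "y \<in> mspace M"
      then obtain u v c where uv: "u \<in> mspace M" "v \<in> mspace M" "T (?e (dipole x y)) = ?e (c *\<^sub>R dipole u v)"
        using edge by blast
      then have "c *\<^sub>R dipole u v \<in> ?Z" by (intro subspace_scale[OF Z] dipole_zero_sum)
      then show "dipole x y \<in> span (dipoles (E_ext M \<inter> mspace M \<times> mspace M)) \<and>
          T (?e (dipole x y)) \<in> ?e ` span (dipoles (E_ext M \<inter> mspace M \<times> mspace M))"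
        unfolding zero_sum_span[OF conn, symmetric] uv(3) using xy by (blast intro: dipole_zero_sum)
    qed
    show "subspace {w \<in> span (dipoles (E_ext M \<inter> mspace M \<times> mspace M)).
        T (?e w) \<in> ?e ` span (dipoles (E_ext M \<inter> mspace M \<times> mspace M))}"
      unfolding zero_sum_span[OF conn, symmetric]
    proof (rule subspaceI)
      have "?e 0 = 0" using e_scale[OF subspace_0[OF Z], of 0] by simp
      moreover have "T 0 = 0" using linear_on_0[OF lin] seminormed_free_space[of M] by (simp add: seminormed_def)
      ultimately have "T (?e 0) = ?e 0" by simp
      then show "0 \<in> {w \<in> ?Z. T (?e w) \<in> ?e ` ?Z}" using subspace_0[OF Z] by blast
    next
      fix v w assume "v \<in> {w \<in> ?Z. T (?e w) \<in> ?e ` ?Z}" "w \<in> {w \<in> ?Z. T (?e w) \<in> ?e ` ?Z}"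
      then obtain v' w' where vw: "v \<in> ?Z" "w \<in> ?Z" "v' \<in> ?Z" "w' \<in> ?Z" "T (?e v) = ?e v'" "T (?e w) = ?e w'" by blast
      then have "T (?e (v + w)) = ?e (v' + w')"
        using e_add linear_onD(1)[OF lin eV eV] by simp
      then show "v + w \<in> {w \<in> ?Z. T (?e w) \<in> ?e ` ?Z}"
        using vw subspace_add[OF Z] by blast
    next
      fix r w assume "w \<in> {w \<in> ?Z. T (?e w) \<in> ?e ` ?Z}"
      then obtain w' where vw: "w \<in> ?Z" "w' \<in> ?Z" "T (?e w) = ?e w'" by blast
      then have "T (?e (r *\<^sub>R w)) = ?e (r *\<^sub>R w')"
        using e_scale linear_onD(2)[OF lin eV] by simp
      then show "r *\<^sub>R w \<in> {w \<in> ?Z. T (?e w) \<in> ?e ` ?Z}"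
        using vw subspace_scale[OF Z] by blast
    qed
  qed
  then have "\<forall>w\<in>?Z. \<exists>w'\<in>?Z. ?e w' = T (?e w)" by force
  then obtain S where S: "\<And>w. w \<in> ?Z \<Longrightarrow> S w \<in> ?Z" "\<And>w. w \<in> ?Z \<Longrightarrow> ?e (S w) = T (?e w)"
    by metis
  have linS: "linear_on ?Z S"
    unfolding linear_on_def
  proof (intro conjI ballI allI)
    fix v w assume vw: "v \<in> ?Z" "w \<in> ?Z"
    have "?e (S (v + w)) = ?e (S v + S w)"
      using vw S e_add linear_onD(1)[OF lin eV eV] subspace_add[OF Z] by simp
    then show "S (v + w) = S v + S w"
      by (rule inj_onD[OF inj]) (intro S subspace_add[OF Z] vw)+
  next
    fix r w assume w: "w \<in> ?Z"
    have "?e (S (r *\<^sub>R w)) = ?e (r *\<^sub>R S w)"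
      using w S e_scale linear_onD(2)[OF lin eV] subspace_scale[OF Z] by simp
    then show "S (r *\<^sub>R w) = r *\<^sub>R S w"
      by (rule inj_onD[OF inj]) (intro S subspace_scale[OF Z] w)+
  qed
  have edgeS: "\<exists>u\<in>mspace M. \<exists>v\<in>mspace M. \<exists>c. c \<noteq> 0 \<and> u \<noteq> v \<and> S (dipole x y) = c *\<^sub>R dipole u v"
    if xy: "(x, y) \<in> E_ext M" for x y
  proof -
    obtain u v c where uv: "u \<in> mspace M" "v \<in> mspace M" "c \<noteq> 0" "u \<noteq> v" "T (?e (dipole x y)) = ?e (c *\<^sub>R dipole u v)"
      using edge[OF xy] by blast
    have d: "dipole x y \<in> ?Z" using E_ext_vertices[OF xy] by (intro dipole_zero_sum) auto
    have "?e (S (dipole x y)) = ?e (c *\<^sub>R dipole u v)" using S(2)[OF d] uv(5) by simp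
    then have "S (dipole x y) = c *\<^sub>R dipole u v"
      by (rule inj_onD[OF inj]) (intro S d subspace_scale[OF Z] dipole_zero_sum uv)+
    with uv show ?thesis by blast
  qed
  show ?thesis using that[OF linS _ S(2) edgeS] S(1) by blast
qed

text \<open>The linear map induced by \<open>T\<close> is a multiple \<open>c\<close> of a relabelling \<open>g\<close> of the points. As the norm of
  \<open>\<delta>\<^sub>x - \<delta>\<^sub>y\<close> is the distance of \<open>x\<close> and \<open>y\<close>, the map \<open>g\<close> is a \<open>\<bar>c\<bar>\<close>-dilation, and the sign of \<open>c\<close> is the
  sign in the conclusion.\<close>

theorem three_connected_Lipschitz_free_rigid:
  assumes comp: "mcomplete_of M" and V: "V_ext M = mspace M"
    and tc: "three_connected_graph (V_ext M) (E_ext M)"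
    and big: "\<And>a b. \<exists>y\<in>mspace M. y \<noteq> a \<and> y \<noteq> b"
  shows "Lipschitz_free_rigid M"
  unfolding Lipschitz_free_rigid_def
proof (intro allI impI)
  let ?Z = "zero_sum (mspace M)"
  let ?e = "bidual_embed (free0 M)"
  fix T assume T: "surj_linear_isometry (free_space M) T"
  note Z = subspace_zero_sum[of "mspace M"]
  have lin: "linear_on (vecs (free_space M)) T"
    and iso: "\<And>\<psi>. \<psi> \<in> vecs (free_space M) \<Longrightarrow> nrm (free_space M) (T \<psi>) = nrm (free_space M) \<psi>"
    using T by (auto simp: surj_linear_isometry_def)
  have conn: "connected_graph (mspace M) (E_ext M)"
    using tc unfolding three_connected_graph_def V by (metis Diff_empty card.empty empty_subsetI finite.emptyI zero_le)
  obtain T' where T': "surj_linear_isometry (free_space M) T'"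
    and T'T: "\<And>\<psi>. \<psi> \<in> vecs (free_space M) \<Longrightarrow> T' (T \<psi>) = \<psi>"
    and TT': "\<And>\<psi>. \<psi> \<in> vecs (free_space M) \<Longrightarrow> T (T' \<psi>) = \<psi>"
    by (rule surj_linear_isometry_inverse[OF T]) blast
  have eV: "?e w \<in> vecs (free_space M)" if "w \<in> ?Z" for w
    using that by (intro embed_free_space) (simp add: vecs_free0)
  have inj: "inj_on ?e ?Z" using embed_inj[of M] by (simp add: vecs_free0)
  obtain S where S: "linear_on ?Z S" "S ` ?Z \<subseteq> ?Z" "\<And>w. w \<in> ?Z \<Longrightarrow> ?e (S w) = T (?e w)"
    and edgeS: "\<And>x y. (x, y) \<in> E_ext M \<Longrightarrow>
       \<exists>u\<in>mspace M. \<exists>v\<in>mspace M. \<exists>c. c \<noteq> 0 \<and> u \<noteq> v \<and> S (dipole x y) = c *\<^sub>R dipole u v"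
    by (rule isometry_preserves_free0[OF comp T conn]) blast
  obtain S' where S': "linear_on ?Z S'" "S' ` ?Z \<subseteq> ?Z" "\<And>w. w \<in> ?Z \<Longrightarrow> ?e (S' w) = T' (?e w)"
    and edgeS': "\<And>x y. (x, y) \<in> E_ext M \<Longrightarrow>
       \<exists>u\<in>mspace M. \<exists>v\<in>mspace M. \<exists>c. c \<noteq> 0 \<and> u \<noteq> v \<and> S' (dipole x y) = c *\<^sub>R dipole u v"
    by (rule isometry_preserves_free0[OF comp T' conn]) blast
  have SS: "S' (S w) = w" "S (S' w) = w" if w: "w \<in> ?Z" for w
  proof -
    have m: "S w \<in> ?Z" "S' w \<in> ?Z" using S(2) S'(2) w by auto
    have "?e (S' (S w)) = ?e w" using S'(3)[OF m(1)] S(3)[OF w] T'T[OF eV[OF w]] by simp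
    then show "S' (S w) = w" by (rule inj_onD[OF inj]) (use S'(2) m w in auto)
    have "?e (S (S' w)) = ?e w" using S(3)[OF m(2)] S'(3)[OF w] TT'[OF eV[OF w]] by simp
    then show "S (S' w) = w" by (rule inj_onD[OF inj]) (use S(2) m w in auto)
  qed
  have tc': "three_connected_graph (mspace M) (E_ext M)" using tc by (simp only: V)
  have irr: "x \<noteq> y" if "(x, y) \<in> E_ext M" for x y using E_ext_vertices[OF that] by simp
  obtain g c where g: "bij_betw g (mspace M) (mspace M)" and c: "c \<noteq> 0"
    and Sg: "\<And>x y. x \<in> mspace M \<Longrightarrow> y \<in> mspace M \<Longrightarrow> S (dipole x y) = c *\<^sub>R dipole (g x) (g y)"
    by (rule three_connected_linear_rigidity[OF tc' sym_E_ext irr big S(1) S'(1) S(2) S'(2) SS edgeS edgeS'])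
      blast+
  have gM: "g x \<in> mspace M" if "x \<in> mspace M" for x using g that bij_betwE by blast
  have gne: "g x \<noteq> g y" if "x \<in> mspace M" "y \<in> mspace M" "x \<noteq> y" for x y
    using g that unfolding bij_betw_def inj_on_def by blast
  have Te: "T (?e (dipole x y)) = c *\<^sub>R ?e (dipole (g x) (g y))" if xy: "x \<in> mspace M" "y \<in> mspace M" for x y
  proof -
    have "T (?e (dipole x y)) = ?e (c *\<^sub>R dipole (g x) (g y))"
      using S(3)[OF dipole_zero_sum[OF xy]] Sg[OF xy] by simp
    also have "\<dots> = c *\<^sub>R ?e (dipole (g x) (g y))"
      by (rule bidual_embed_scaleR) (simp add: vecs_free0 dipole_zero_sum gM xy)
    finally show ?thesis .
  qed
  have dist: "mdist M x y = \<bar>c\<bar> * mdist M (g x) (g y)" if xy: "x \<in> mspace M" "y \<in> mspace M" for x y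
  proof (cases "x = y")
    case True
    have "mdist M y y = 0" "mdist M (g y) (g y) = 0" using xy gM[OF xy(2)] by simp_all
    then show ?thesis using True by simp
  next
    case False
    have n: "nrm (free_space M) (?e (dipole u v)) = mdist M u v" if "u \<in> mspace M" "v \<in> mspace M" "u \<noteq> v" for u v
      unfolding embed_dipole[OF that]
      using seminormedD(5)[OF seminormed_free_space molecule_free_space[OF that(1,2)]] molecule_nrm_eq[OF that]
      by simp
    have "mdist M x y = nrm (free_space M) (T (?e (dipole x y)))"
      using iso[OF eV[OF dipole_zero_sum[OF xy]]] n[OF xy False] by simp
    also have "\<dots> = \<bar>c\<bar> * mdist M (g x) (g y)"
      unfolding Te[OF xy]
      using seminormedD(5)[OF seminormed_free_space eV[OF dipole_zero_sum[OF gM[OF xy(1)] gM[OF xy(2)]]]]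
        n[OF gM[OF xy(1)] gM[OF xy(2)] gne[OF xy False]] by simp
    finally show ?thesis .
  qed
  have "surj_dilation M \<bar>c\<bar> g"
    unfolding surj_dilation_def using g dist by (auto simp: bij_betw_def)
  moreover have "T (molecule M x y) = sgn c *\<^sub>R molecule M (g x) (g y)"
    if xy: "x \<in> mspace M" "y \<in> mspace M" "x \<noteq> y" for x y
  proof -
    have "T (molecule M x y) = (1 / mdist M x y) *\<^sub>R c *\<^sub>R ?e (dipole (g x) (g y))"
      unfolding molecule_dipole[OF xy(1,2)] linear_onD(2)[OF lin eV[OF dipole_zero_sum[OF xy(1,2)]]] Te[OF xy(1,2)] ..
    also have "\<dots> = (c / mdist M x y) *\<^sub>R ?e (dipole (g x) (g y))" by simp
    also have "c / mdist M x y = sgn c / mdist M (g x) (g y)"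
      unfolding dist[OF xy(1,2)] using c by (simp add: sgn_real_def)
    also have "(sgn c / mdist M (g x) (g y)) *\<^sub>R ?e (dipole (g x) (g y)) = sgn c *\<^sub>R molecule M (g x) (g y)"
      unfolding molecule_dipole[OF gM[OF xy(1)] gM[OF xy(2)]] by simp
    finally show ?thesis .
  qed
  moreover have "sgn c \<in> {1, - 1}" "\<bar>c\<bar> > 0" using c by (auto simp: sgn_real_def)
  ultimately show "\<exists>\<epsilon>\<in>{1, - 1}. \<exists>a>0. \<exists>g. surj_dilation M a g \<and>
      (\<forall>x\<in>mspace M. \<forall>y\<in>mspace M. x \<noteq> y \<longrightarrow> T (molecule M x y) = \<epsilon> *\<^sub>R molecule M (g x) (g y))"
    by blast
qed

text \<open>There are no molecules, and the identity is a dilation of the empty space.\<close>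

lemma rigid_empty: "mspace M = {} \<Longrightarrow> Lipschitz_free_rigid M"
  unfolding Lipschitz_free_rigid_def surj_dilation_def by (auto intro!: exI[of _ "1::real"])

section \<open>The p-sum\<close>

text \<open>The derivative \<open>p * ((s + a) powr (p - 1) - s powr (p - 1))\<close> of the difference is positive.\<close>

lemma powr_add_strict:
  fixes p a b c :: real
  assumes p: "1 < p" and "0 < a" "0 \<le> b" "b < c"
  shows "(b + a) powr p - b powr p < (c + a) powr p - c powr p"
proof -
  let ?f = "\<lambda>s. (s + a) powr p - s powr p"
  have "\<exists>y. ((?f has_real_derivative y) (at s)) \<and> y > 0" if "b < s" "s < c" for s
  proof -
    have s: "0 < s" using that assms by linarith
    have "(?f has_real_derivative p * (s + a) powr (p - 1) - p * s powr (p - 1)) (at s)"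
      using s assms by (auto intro!: derivative_eq_intros)
    moreover have "s powr (p - 1) < (s + a) powr (p - 1)"
      using s assms by (intro powr_less_mono2) auto
    ultimately show ?thesis using p by force
  qed
  moreover have "continuous_on {b..c} ?f"
    using assms by (intro continuous_on_diff continuous_on_powr' continuous_intros) auto
  ultimately show ?thesis using DERIV_pos_imp_increasing_open[of b c ?f] assms by blast
qed

text \<open>The two summands \<open>(a, 0)\<close> and \<open>(b, e)\<close> are not parallel. With \<open>c\<close> the norm of \<open>(b, e)\<close>, one has \<open>b < c\<close>,
  and the claim is that \<open>s \<mapsto> (s + a) powr p - s powr p\<close> is larger at \<open>c\<close> than at \<open>b\<close>.\<close>

lemma Minkowski_strict:
  fixes p a b e :: real
  assumes p: "1 < p" and a: "0 < a" and b: "0 \<le> b" and e: "0 < e"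
  shows "((a + b) powr p + e powr p) powr (1 / p) < a + (b powr p + e powr p) powr (1 / p)"
proof -
  define c where "c = (b powr p + e powr p) powr (1 / p)"
  have cp: "c powr p = b powr p + e powr p" using p by (simp add: c_def powr_powr)
  have "b = (b powr p) powr (1 / p)" using p b by (simp add: powr_powr)
  also have "\<dots> < c" unfolding c_def using p e by (intro powr_less_mono2) auto
  finally have bc: "b < c" .
  have "(b + a) powr p + e powr p < (c + a) powr p"
    using powr_add_strict[OF p a b bc] cp by simp
  then have "((b + a) powr p + e powr p) powr (1 / p) < ((c + a) powr p) powr (1 / p)"
    using p by (intro powr_less_mono2) (auto intro: add_nonneg_nonneg)
  also have "\<dots> = c + a" using p a b bc by (simp add: powr_powr)
  finally show ?thesis by (simp add: c_def add.commute)
qed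

text \<open>Otherwise there are detours with excess tending to zero that stay away from both end points. Pass to
  limits \<open>(\<alpha>, \<beta>)\<close> and \<open>(\<alpha>', \<beta>')\<close> of the coordinate distances of the two legs. Equality holds throughout
  the chain of Minkowski's inequality, so \<open>\<beta> + \<beta>' = B\<close>, and sharpness of the second coordinates leaves
  only \<open>\<beta> = 0\<close> or \<open>\<beta>' = 0\<close>. Then the legs are not parallel, which contradicts \<open>Minkowski_strict\<close>.\<close>

lemma sharp_pair_lp_sum:
  assumes p: "1 < p" and sh: "sharp_pair N2 b d" and ac: "a \<in> mspace N1" "c \<in> mspace N1"
  shows "sharp_pair (lp_sum p N1 N2) (a, b) (c, d)"
proof (rule ccontr)
  let ?M = "lp_sum p N1 N2"
  let ?L = "\<lambda>s t. (s powr p + t powr p) powr (1 / p)"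
  have p1: "1 \<le> p" using p by simp
  have bd: "b \<in> mspace N2" "d \<in> mspace N2" "b \<noteq> d" using sh by (auto simp: sharp_pair_def)
  define A where "A = mdist N1 a c"
  define B where "B = mdist N2 b d"
  have A: "0 \<le> A" by (simp add: A_def)
  have B: "0 < B" unfolding B_def by (rule mdist_pos[OF bd])
  have mono: "?L s t \<le> ?L s' t'" if "0 \<le> s" "s \<le> s'" "0 \<le> t" "t \<le> t'" for s t s' t'
    using that p by (intro powr_mono2 add_mono) (auto intro: add_nonneg_nonneg)
  have coord: "s \<le> ?L s t" "t \<le> ?L s t" if "0 \<le> s" "0 \<le> t" for s t
    using mono[of s s 0 t] mono[of 0 s t t] that p by (simp_all add: powr_powr)
  assume ns: "\<not> sharp_pair ?M (a, b) (c, d)"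
  have "\<exists>\<epsilon>>0. \<forall>\<delta>>0. \<exists>z\<in>mspace ?M. \<epsilon> \<le> min (mdist ?M (a, b) z) (mdist ?M (c, d) z) \<and>
      \<not> mdist ?M (a, b) (c, d) < mdist ?M (a, b) z + mdist ?M z (c, d) - \<delta>"
    using ns ac bd unfolding sharp_pair_def mspace_lp_sum[OF p1] by simp
  then obtain \<epsilon> where eps: "\<epsilon> > 0" "\<And>\<delta>. \<delta> > 0 \<Longrightarrow> \<exists>z\<in>mspace ?M. \<epsilon> \<le> min (mdist ?M (a, b) z) (mdist ?M (c, d) z) \<and>
      mdist ?M (a, b) z + mdist ?M z (c, d) - \<delta> \<le> mdist ?M (a, b) (c, d)"
    unfolding not_less by blast
  have "\<exists>u v. u \<in> mspace N1 \<and> v \<in> mspace N2 \<and> \<epsilon> \<le> ?L (mdist N1 a u) (mdist N2 b v) \<and>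
      \<epsilon> \<le> ?L (mdist N1 u c) (mdist N2 v d) \<and>
      ?L (mdist N1 a u) (mdist N2 b v) + ?L (mdist N1 u c) (mdist N2 v d) \<le> ?L A B + inverse (real (Suc n))" for n
  proof -
    have "0 < inverse (real (Suc n))" by simp
    from eps(2)[OF this] obtain z where z: "z \<in> mspace ?M"
      "\<epsilon> \<le> mdist ?M (a, b) z" "\<epsilon> \<le> mdist ?M (c, d) z"
      "mdist ?M (a, b) z + mdist ?M z (c, d) \<le> mdist ?M (a, b) (c, d) + inverse (real (Suc n))"
      unfolding min.bounded_iff diff_le_eq by blast
    obtain u v where uv: "z = (u, v)" by (cases z)
    show ?thesis
      using z
      unfolding uv mspace_lp_sum[OF p1] mdist_lp_sum[OF p1] A_def B_def
        mdist_commute[of N1 c u] mdist_commute[of N2 d v]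
      by (intro exI[of _ u] exI[of _ v]) simp
  qed
  then obtain u v where uv: "\<And>n. u n \<in> mspace N1" "\<And>n. v n \<in> mspace N2"
    and far: "\<And>n. \<epsilon> \<le> ?L (mdist N1 a (u n)) (mdist N2 b (v n))"
      "\<And>n. \<epsilon> \<le> ?L (mdist N1 (u n) c) (mdist N2 (v n) d)"
    and near: "\<And>n. ?L (mdist N1 a (u n)) (mdist N2 b (v n)) + ?L (mdist N1 (u n) c) (mdist N2 (v n) d)
        \<le> ?L A B + inverse (real (Suc n))"
    by metis
  define f where "f = (\<lambda>n. (mdist N1 a (u n), mdist N1 (u n) c, mdist N2 b (v n), mdist N2 (v n) d))"
  define C where "C = ?L A B + 1"
  have "f n \<in> {0..C} \<times> {0..C} \<times> {0..C} \<times> {0..C}" for n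
    using near[of n] inverse_le_1_iff[of "real (Suc n)"]
      coord[of "mdist N1 a (u n)" "mdist N2 b (v n)"] coord[of "mdist N1 (u n) c" "mdist N2 (v n) d"]
    unfolding f_def C_def by (auto; smt (verit) mdist_nonneg powr_ge_zero)
  then have "range f \<subseteq> {0..C} \<times> {0..C} \<times> {0..C} \<times> {0..C}" by blast
  moreover have "bounded ({0..C} \<times> {0..C} \<times> {0..C} \<times> {0..C})"
    by (intro bounded_Times) auto
  ultimately have "bounded (range f)" using bounded_subset by blast
  then obtain s l where s: "strict_mono s" "(f \<circ> s) \<longlonglongrightarrow> l"
    using bounded_imp_convergent_subsequence by blast
  obtain \<alpha> \<alpha>' \<beta> \<beta>' where l: "l = (\<alpha>, \<alpha>', \<beta>, \<beta>')" by (cases l) auto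
  have l1: "(\<lambda>n. mdist N1 a (u (s n))) \<longlonglongrightarrow> \<alpha>"
    using tendsto_fst[OF s(2)] by (simp add: l f_def o_def)
  have l2: "(\<lambda>n. mdist N1 (u (s n)) c) \<longlonglongrightarrow> \<alpha>'"
    using tendsto_fst[OF tendsto_snd[OF s(2)]] by (simp add: l f_def o_def)
  have l3: "(\<lambda>n. mdist N2 b (v (s n))) \<longlonglongrightarrow> \<beta>"
    using tendsto_fst[OF tendsto_snd[OF tendsto_snd[OF s(2)]]] by (simp add: l f_def o_def)
  have l4: "(\<lambda>n. mdist N2 (v (s n)) d) \<longlonglongrightarrow> \<beta>'"
    using tendsto_snd[OF tendsto_snd[OF tendsto_snd[OF s(2)]]] by (simp add: l f_def o_def)
  have nn: "0 \<le> \<alpha>" "0 \<le> \<alpha>'" "0 \<le> \<beta>" "0 \<le> \<beta>'"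
    using tendsto_lowerbound[OF l1] tendsto_lowerbound[OF l2] tendsto_lowerbound[OF l3]
      tendsto_lowerbound[OF l4] by (simp_all add: always_eventually)
  have Llim: "(\<lambda>n. ?L (g n) (h n)) \<longlonglongrightarrow> ?L x y"
    if "g \<longlonglongrightarrow> x" "h \<longlonglongrightarrow> y" "\<And>n. 0 \<le> g n" "\<And>n. 0 \<le> h n" for g h x y
    using that p by (intro tendsto_powr' tendsto_add tendsto_const) (auto intro!: always_eventually add_nonneg_nonneg)
  have L1: "(\<lambda>n. ?L (mdist N1 a (u (s n))) (mdist N2 b (v (s n)))) \<longlonglongrightarrow> ?L \<alpha> \<beta>"
    by (rule Llim[OF l1 l3]) auto
  have L2: "(\<lambda>n. ?L (mdist N1 (u (s n)) c) (mdist N2 (v (s n)) d)) \<longlonglongrightarrow> ?L \<alpha>' \<beta>'"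
    by (rule Llim[OF l2 l4]) auto
  have far': "\<epsilon> \<le> ?L \<alpha> \<beta>" "\<epsilon> \<le> ?L \<alpha>' \<beta>'"
    by (rule tendsto_lowerbound[OF L1] tendsto_lowerbound[OF L2]; simp add: far)+
  have inv0: "(\<lambda>n. ?L A B + inverse (real (Suc (s n)))) \<longlonglongrightarrow> ?L A B + 0"
    using LIMSEQ_subseq_LIMSEQ[OF LIMSEQ_inverse_real_of_nat s(1)]
    by (intro tendsto_add tendsto_const) (simp add: o_def)
  have near': "?L \<alpha> \<beta> + ?L \<alpha>' \<beta>' \<le> ?L A B"
    using tendsto_le[OF _ inv0 tendsto_add[OF L1 L2]] near by (simp add: always_eventually)
  have A_le: "A \<le> \<alpha> + \<alpha>'"
    by (rule tendsto_lowerbound[OF tendsto_add[OF l1 l2]])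
      (simp_all add: A_def mdist_triangle ac uv)
  have B_le: "B \<le> \<beta> + \<beta>'"
    by (rule tendsto_lowerbound[OF tendsto_add[OF l3 l4]])
      (simp_all add: B_def mdist_triangle bd uv)
  have mink: "?L (\<alpha> + \<alpha>') (\<beta> + \<beta>') \<le> ?L \<alpha> \<beta> + ?L \<alpha>' \<beta>'"
    by (rule Minkowski_two[OF p1 nn])
  have Lstrict: "?L s t < ?L s' t'" if "0 \<le> s" "s \<le> s'" "0 \<le> t" "t \<le> t'" "s < s' \<or> t < t'" for s t s' t'
  proof -
    have "s powr p \<le> s' powr p" "t powr p \<le> t' powr p" using that p by (auto intro: powr_mono2)
    moreover have "s powr p < s' powr p \<or> t powr p < t' powr p"
      using that p by (auto intro: powr_less_mono2)
    ultimately show ?thesis using p by (intro powr_less_mono2) (auto intro: add_nonneg_nonneg)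
  qed
  have eqA: "\<alpha> + \<alpha>' = A" and eqB: "\<beta> + \<beta>' = B"
    using Lstrict[OF A A_le less_imp_le[OF B] B_le] mink near' A_le B_le by linarith+
  have "\<beta> = 0 \<or> \<beta>' = 0"
  proof (rule ccontr)
    assume "\<not> ?thesis"
    then have "0 < min \<beta> \<beta>' / 2" using nn by auto
    then obtain \<delta> where \<delta>: "\<delta> > 0" "\<And>z. z \<in> mspace N2 \<Longrightarrow> min \<beta> \<beta>' / 2 \<le> min (mdist N2 b z) (mdist N2 d z)
        \<Longrightarrow> B < mdist N2 b z + mdist N2 z d - \<delta>"
      using sh unfolding sharp_pair_def B_def by blast
    have "\<forall>\<^sub>F n in sequentially. min \<beta> \<beta>' / 2 < mdist N2 b (v (s n))"
      by (rule order_tendstoD(1)[OF l3]) (use \<open>0 < min \<beta> \<beta>' / 2\<close> in linarith)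
    moreover have "\<forall>\<^sub>F n in sequentially. min \<beta> \<beta>' / 2 < mdist N2 (v (s n)) d"
      by (rule order_tendstoD(1)[OF l4]) (use \<open>0 < min \<beta> \<beta>' / 2\<close> in linarith)
    moreover have "\<forall>\<^sub>F n in sequentially. mdist N2 b (v (s n)) + mdist N2 (v (s n)) d < B + \<delta>"
      by (rule order_tendstoD(2)[OF tendsto_add[OF l3 l4]]) (use eqB \<delta> in simp)
    ultimately have "\<forall>\<^sub>F n in sequentially. False"
    proof eventually_elim
      case (elim n)
      then show ?case using \<delta>(2)[OF uv(2)[of "s n"]] by (simp add: mdist_commute[of N2 d])
    qed
    then show False by simp
  qed
  then show False
  proof
    assume b0: "\<beta> = 0"
    then have "\<epsilon> \<le> \<alpha>" using far' nn p by (simp add: powr_powr)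
    then have "?L (\<alpha> + \<alpha>') B < \<alpha> + ?L \<alpha>' B" using eps nn B by (intro Minkowski_strict[OF p]) auto
    moreover have "?L \<alpha> \<beta> = \<alpha>" using b0 nn p by (simp add: powr_powr)
    ultimately show False using near' eqA eqB b0 by simp
  next
    assume b0: "\<beta>' = 0"
    then have "\<epsilon> \<le> \<alpha>'" using far' nn p by (simp add: powr_powr)
    then have "?L (\<alpha>' + \<alpha>) B < \<alpha>' + ?L \<alpha> B" using eps nn B by (intro Minkowski_strict[OF p]) auto
    moreover have "?L \<alpha>' \<beta>' = \<alpha>'" using b0 nn p by (simp add: powr_powr)
    ultimately show False using near' eqA eqB b0 by (simp add: add.commute)
  qed
qed

lemma fibre_avoids:
  assumes N1: "infinite N1 \<or> 3 \<le> card N1" and S: "finite S" "card S \<le> 2"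
  shows "\<exists>a\<in>N1. (a, b) \<notin> S"
proof (rule ccontr)
  assume "\<not> ?thesis"
  then have sub: "(\<lambda>a. (a, b)) ` N1 \<subseteq> S" by auto
  have inj: "inj_on (\<lambda>a. (a, b)) N1" by (rule inj_onI) simp
  have "finite N1" using finite_subset[OF sub S(1)] finite_imageD[OF _ inj] by blast
  moreover have "card N1 \<le> 2" using card_mono[OF S(1) sub] card_image[OF inj] S(2) by simp
  ultimately show False using N1 by simp
qed

text \<open>A walk in the second factor lifts to a walk that may use any surviving point of each fibre it
  visits. Two points of the same fibre are joined through the fibre of a neighbour.\<close>

lemma three_connected_fibres:
  assumes N1: "infinite N1 \<or> 3 \<le> card N1"
    and conn: "connected_graph N2 E2" and E2: "E2 \<subseteq> N2 \<times> N2" "sym E2" "N2 = Field E2"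
    and E: "\<And>a b c d. (b, d) \<in> E2 \<Longrightarrow> a \<in> N1 \<Longrightarrow> c \<in> N1 \<Longrightarrow> ((a, b), (c, d)) \<in> E"
  shows "three_connected_graph (N1 \<times> N2) E"
  unfolding three_connected_graph_def connected_graph_def
proof (intro allI impI ballI)
  fix S u v assume S: "S \<subseteq> N1 \<times> N2 \<and> finite S \<and> card S \<le> 2" and uv: "u \<in> N1 \<times> N2 - S" "v \<in> N1 \<times> N2 - S"
  let ?E = "E \<inter> (N1 \<times> N2 - S) \<times> (N1 \<times> N2 - S)"
  obtain a b c d where eq: "u = (a, b)" "v = (c, d)" by (metis surj_pair)
  have ab: "a \<in> N1" "b \<in> N2" "(a, b) \<notin> S" and cd: "c \<in> N1" "d \<in> N2" "(c, d) \<notin> S" using uv eq by auto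
  have avoid: "\<exists>e\<in>N1. (e, t) \<notin> S" for t
    by (rule fibre_avoids[OF N1]) (use S in auto)
  have E': "((x, s), (y, t)) \<in> ?E"
    if "(s, t) \<in> E2" "x \<in> N1" "y \<in> N1" "(x, s) \<notin> S" "(y, t) \<notin> S" for x s y t
    using E[OF that(1-3)] that E2(1) by auto
  have "(b, d) \<in> (E2 \<inter> N2 \<times> N2)\<^sup>*" using conn ab cd unfolding connected_graph_def by blast
  then have "(b, d) \<in> E2\<^sup>*" by (rule rtrancl_mono[THEN subsetD, rotated]) blast
  then have "\<forall>c\<in>N1. (c, d) \<notin> S \<longrightarrow> ((a, b), (c, d)) \<in> ?E\<^sup>*"
  proof (induction rule: rtrancl_induct)
    case base
    obtain b' where b': "(b, b') \<in> E2" using ab(2) E2(2,3) by (auto simp: Field_def dest: symD)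
    obtain e where e: "e \<in> N1" "(e, b') \<notin> S" using avoid by blast
    show ?case
    proof (intro ballI impI)
      fix c assume "c \<in> N1" "(c, b) \<notin> S"
      then have "((e, b'), (c, b)) \<in> ?E" using E'[of b' b e c] e symD[OF E2(2) b'] by blast
      moreover have "((a, b), (e, b')) \<in> ?E" using E'[OF b' ab(1) e(1) ab(3) e(2)] .
      ultimately show "((a, b), (c, b)) \<in> ?E\<^sup>*" by (meson converse_rtrancl_into_rtrancl r_into_rtrancl)
    qed
  next
    case (step t d)
    obtain e where e: "e \<in> N1" "(e, t) \<notin> S" using avoid by blast
    show ?case
    proof (intro ballI impI)
      fix c assume "c \<in> N1" "(c, d) \<notin> S"
      then have "((e, t), (c, d)) \<in> ?E" using E'[OF step(2) e(1) _ e(2)] by blast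
      with step(3) e show "((a, b), (c, d)) \<in> ?E\<^sup>*" by (meson rtrancl_into_rtrancl)
    qed
  qed
  then show "(u, v) \<in> ?E\<^sup>*" using cd eq by blast
qed

section \<open>Walk lengths\<close>

lemma walk_length_ge:
  assumes "\<And>i. i \<le> k \<Longrightarrow> w i \<in> mspace M"
  shows "mdist M (w 0) (w k) \<le> (\<Sum>i<k. mdist M (w i) (w (Suc i)))"
  using assms
proof (induction k)
  case 0
  then have "mdist M (w 0) (w 0) = 0" by simp
  then show ?case by simp
next
  case (Suc k)
  then show ?case using mdist_triangle[of "w 0" M "w k" "w (Suc k)"] by force
qed

lemma walk_lengths_ge:
  assumes "l \<in> walk_lengths M x y" "x \<in> mspace M" "y \<in> mspace M"
  shows "mdist M x y \<le> l"
proof -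
  obtain k w where w: "l = (\<Sum>i<k. mdist M (w i) (w (Suc i)))" "w 0 = x" "w k = y"
    "\<And>i. i < k \<Longrightarrow> (w i, w (Suc i)) \<in> E_ext M"
    using assms(1) by (auto simp: walk_lengths_def)
  have "w i \<in> mspace M" if "i \<le> k" for i
  proof (cases "i = k")
    case False
    then show ?thesis using w(4)[of i] that E_ext_vertices by force
  qed (use w assms in simp)
  then show ?thesis using walk_length_ge[of k w M] w by simp
qed

lemma mdist_eq_Inf_walk_lengths:
  assumes xy: "x \<in> mspace M" "y \<in> mspace M"
    and ex: "\<And>e. 0 < e \<Longrightarrow> \<exists>l\<in>walk_lengths M x y. l < mdist M x y + e"
  shows "mdist M x y = Inf (walk_lengths M x y)"
proof (rule antisym)
  have ne: "walk_lengths M x y \<noteq> {}" using ex[of 1] by auto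
  then show "mdist M x y \<le> Inf (walk_lengths M x y)"
    using walk_lengths_ge[OF _ xy] by (rule cInf_greatest)
  have bdd: "bdd_below (walk_lengths M x y)" using walk_lengths_ge[OF _ xy] by (rule bdd_belowI)
  show "Inf (walk_lengths M x y) \<le> mdist M x y"
  proof (rule field_le_epsilon)
    fix e :: real assume "0 < e"
    then obtain l where "l \<in> walk_lengths M x y" "l < mdist M x y + e" using ex by blast
    then show "Inf (walk_lengths M x y) \<le> mdist M x y + e" using cInf_lower[OF _ bdd, of l] by simp
  qed
qed

lemma walk_lengths_self: "0 \<in> walk_lengths M x x"
  unfolding walk_lengths_def by (rule CollectI, rule exI[of _ 0]) auto

lemma walk_lengths_edge: "(x, y) \<in> E_ext M \<Longrightarrow> mdist M x y \<in> walk_lengths M x y"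
  unfolding walk_lengths_def
  by (rule CollectI, rule exI[of _ 1], rule exI[of _ "\<lambda>i. if i = 0 then x else y"]) simp

lemma walk_lengths_two:
  assumes "(x, z) \<in> E_ext M" "(z, y) \<in> E_ext M"
  shows "mdist M x z + mdist M z y \<in> walk_lengths M x y"
  unfolding walk_lengths_def
  by (rule CollectI, rule exI[of _ 2], rule exI[of _ "\<lambda>i. if i = 0 then x else if i = 1 then z else y"])
    (use assms in \<open>auto simp: numeral_2_eq_2 less_Suc_eq\<close>)

lemma no_isolated_points_near:
  assumes "no_isolated_points N" "b \<in> mspace N" "0 < e"
  obtains v where "v \<in> mspace N" "v \<noteq> b" "mdist N b v < e"
proof -
  interpret Metric_space "mspace N" "mdist N" by (rule Metric_space_mspace_mdist)
  have "\<not> openin mtopology {b}" using assms(1,2) by (simp add: no_isolated_points_def mtopology_of_def)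
  then have "\<not> mball b e \<subseteq> {b}" using assms(2,3) by (auto simp: openin_mtopology)
  then obtain v where "v \<in> mball b e" "v \<noteq> b" by blast
  then show ?thesis using that[of v] by (simp add: in_mball)
qed

section \<open>Rigidity of the p-sum\<close>

theorem corollary5p2:
  fixes N1 :: "'a metric" and N2 :: "'b metric" and p :: real
  assumes "infinite (mspace N1) \<or> 3 \<le> card (mspace N1)"
    and "weak_Prague N2"
    and "V_ext N2 = mspace N2"
    and "1 < p"
  shows "V_ext (lp_sum p N1 N2) = mspace (lp_sum p N1 N2)
    \<and> three_connected_graph (V_ext (lp_sum p N1 N2)) (E_ext (lp_sum p N1 N2))
    \<and> (mcomplete_of (lp_sum p N1 N2) \<longrightarrow> Lipschitz_free_rigid (lp_sum p N1 N2))
    \<and> (uniformly_concave N2 \<and> no_isolated_points N2 \<longrightarrow> Prague (lp_sum p N1 N2))"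
proof -
  let ?M = "lp_sum p N1 N2"
  have p1: "1 \<le> p" using assms(4) by simp
  note M = mspace_lp_sum[OF p1, of N1 N2]
  have E: "((a, b), (c, d)) \<in> E_ext ?M" if "(b, d) \<in> E_ext N2" "a \<in> mspace N1" "c \<in> mspace N1" for a b c d
    using sharp_pair_lp_sum[OF assms(4)] that by (simp add: E_ext_iff_sharp_pair)
  have E2: "E_ext N2 \<subseteq> mspace N2 \<times> mspace N2" "mspace N2 = Field (E_ext N2)"
    using E_ext_vertices[of _ _ N2] assms(3) by (auto simp: V_ext_def)
  have V: "V_ext ?M = mspace ?M"
  proof
    show "V_ext ?M \<subseteq> mspace ?M" using E_ext_vertices[of _ _ ?M] by (auto simp: V_ext_def Field_def)
    show "mspace ?M \<subseteq> V_ext ?M"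
    proof
      fix x assume "x \<in> mspace ?M"
      then obtain a b where ab: "x = (a, b)" "a \<in> mspace N1" "b \<in> Field (E_ext N2)"
        using M E2(2) by auto
      then obtain d where "(b, d) \<in> E_ext N2" using sym_E_ext[of N2] by (auto simp: Field_def dest: symD)
      then have "((a, b), (a, d)) \<in> E_ext ?M" using E ab(2) by blast
      then show "x \<in> V_ext ?M" using ab(1) by (auto simp: V_ext_def Field_def)
    qed
  qed
  have conn2: "connected_graph (mspace N2) (E_ext N2)" using assms(2,3) by (simp add: weak_Prague_def)
  have tc: "three_connected_graph (V_ext ?M) (E_ext ?M)"
    unfolding V M by (rule three_connected_fibres[OF assms(1) conn2 E2(1) sym_E_ext E2(2) E])
  have rigid: "Lipschitz_free_rigid ?M" if comp: "mcomplete_of ?M"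
  proof (cases "mspace N2 = {}")
    case True
    then show ?thesis using rigid_empty M by simp
  next
    case False
    then obtain b0 where b0: "b0 \<in> mspace N2" by blast
    have "\<exists>y\<in>mspace ?M. y \<noteq> a \<and> y \<noteq> b" for a b
    proof -
      have "card {a, b} \<le> 2" by (cases "a = b") auto
      then obtain e where "e \<in> mspace N1" "(e, b0) \<notin> {a, b}"
        using fibre_avoids[OF assms(1), of "{a, b}" b0] by blast
      then show ?thesis using M b0 by auto
    qed
    then show ?thesis by (rule three_connected_Lipschitz_free_rigid[OF comp V tc])
  qed
  have prague: "Prague ?M" if uc: "uniformly_concave N2" and ni: "no_isolated_points N2"
  proof -
    have E': "((a, b), (c, d)) \<in> E_ext ?M"
      if "a \<in> mspace N1" "c \<in> mspace N1" "b \<in> mspace N2" "d \<in> mspace N2" "b \<noteq> d" for a b c d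
    proof (rule E)
      show "(b, d) \<in> E_ext N2"
        using uc that unfolding E_ext_iff_sharp_pair sharp_pair_def uniformly_concave_def by blast
    qed (use that in auto)
    have "connected_graph (V_ext ?M) (E_ext ?M)"
      using tc unfolding three_connected_graph_def
      by (metis Diff_empty card.empty empty_subsetI finite.emptyI zero_le)
    moreover have "mtopology_of ?M closure_of V_ext ?M = mspace ?M"
      unfolding V using closure_of_topspace[of "mtopology_of ?M"] by simp
    moreover have "mdist ?M x y = Inf (walk_lengths ?M x y)" if xy: "x \<in> V_ext ?M" "y \<in> V_ext ?M" for x y
    proof (rule mdist_eq_Inf_walk_lengths)
      show xM: "x \<in> mspace ?M" "y \<in> mspace ?M" using xy V by auto
      fix e :: real assume e: "0 < e"
      obtain a b c d where eq: "x = (a, b)" "y = (c, d)" by (metis surj_pair)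
      have m: "a \<in> mspace N1" "b \<in> mspace N2" "c \<in> mspace N1" "d \<in> mspace N2" using xM M eq by auto
      consider "x = y" | "b \<noteq> d" | "a \<noteq> c" "b = d" using eq by blast
      then show "\<exists>l\<in>walk_lengths ?M x y. l < mdist ?M x y + e"
      proof cases
        case 1
        have "mdist ?M x x = 0" using xM(1) by simp
        then show ?thesis using 1 e walk_lengths_self[of ?M x] by force
      next
        case 2
        have "(x, y) \<in> E_ext ?M" unfolding eq by (rule E'[OF m(1,3,2,4) 2])
        then have "mdist ?M x y \<in> walk_lengths ?M x y" by (rule walk_lengths_edge)
        then show ?thesis using e by force
      next
        case 3
        obtain v where v: "v \<in> mspace N2" "v \<noteq> b" "mdist N2 b v < e / 2"
          using no_isolated_points_near[OF ni m(2), of "e / 2"] e by auto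
        let ?z = "(c, v)"
        \<comment> \<open>go to the fibre of a close point \<open>v\<close>, changing the first coordinate on the way, and return\<close>
        have l: "mdist ?M x ?z + mdist ?M ?z y \<in> walk_lengths ?M x y"
        proof (rule walk_lengths_two)
          show "(x, ?z) \<in> E_ext ?M" unfolding eq by (rule E'[OF m(1,3,2) v(1) v(2)[symmetric]])
          show "(?z, y) \<in> E_ext ?M" unfolding eq using E'[OF m(3) m(3) v(1) m(4)] v(2) 3(2) by blast
        qed
        have z: "mdist N2 d d = 0" "mdist N1 c c = 0" using m by simp_all
        have "mdist ?M x y = mdist N1 a c"
          using assms(4) m 3 by (simp add: z eq mdist_lp_sum[OF p1] powr_powr)
        moreover have "mdist ?M ?z y = mdist N2 b v"
          using assms(4) m 3 by (simp add: z eq mdist_lp_sum[OF p1] powr_powr mdist_commute)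
        moreover have "mdist ?M x ?z \<le> mdist N1 a c + mdist N2 b v"
          using Minkowski_two[OF p1, of "mdist N1 a c" 0 0 "mdist N2 b v"] assms(4)
          by (simp add: eq mdist_lp_sum[OF p1] powr_powr)
        ultimately show ?thesis using l v(3) by (intro bexI[OF _ l]) simp
      qed
    qed
    ultimately show ?thesis unfolding Prague_def weak_Prague_def by blast
  qed
  show ?thesis using V tc rigid prague by blast
qed

end
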